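(* Let $d\in\mathbb{N}$, let $R,S$ be finite subsets of $\mathbb{N}_0^d\setminus\{\mathbf 0\}$, let $(\phi_{\mathbf n})_{\mathbf n\in R},(\theta_{\mathbf n})_{\mathbf n\in S}\subset\mathbb{C}$, and let $(Z_{\mathbf t})_{\mathbf t\in\mathbb{Z}^d}$ be an i.i.d. nondeterministic complex-valued random field. Assume that the ARMA equation $$Y_{\mathbf t}-\sum_{\mathbf n\in R}\phi_{\mathbf n}Y_{\mathbf t-\mathbf n}=Z_{\mathbf t}+\sum_{\mathbf n\in S}\theta_{\mathbf n}Z_{\mathbf t-\mathbf n},\qquad \mathbf t\in\mathbb{Z}^d,$$ admits a causal solution $(Y_{\mathbf t})_{\mathbf t\in\mathbb{Z}^d}$. Then the following two conditions are satisfied: (i) $\Theta(\mathbf z)/\Phi(\mathbf z)\in H^2$, $\mathbf z\in\mathbb{D}^d$. (ii) Let $(Y'_{\mathbf t},Z'_{\mathbf t})_{\mathbf t\in\mathbb{Z}^d}$ be an independent copy of $(Y_{\mathbf t},Z_{\mathbf t})_{\mathbf t\in\mathbb{Z}^d}$ and define $$(\tilde Y_{\mathbf t},\tilde Z_{\mathbf t}):=\begin{cases}(Y_{\mathbf t},Z_{\mathbf t}), & \text{if the distributions } \mathbb{P}_{Y_{\mathbf 0}}\text{ and }\mathbb{P}_{Z_{\mathbf 0}}\text{ are symmetric},\\ (Y_{\mathbf t}-Y'_{\mathbf t},\,Z_{\mathbf t}-Z'_{\mathbf t}), & \text{otherwise}.\end{cases}$$ Let $\Theta(\mathbf z)/\Phi(\mathbf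 z)=\sum_{\mathbf k\in\mathbb{N}_0^d}\alpha_{\mathbf k}\mathbf z^{\mathbf k}$, $\mathbf z\in\mathbb{D}^d$, denote the power series expansion of $\Theta/\Phi$. Then $(\tilde Y_{\mathbf t})_{\mathbf t\in\mathbb{Z}^d}$ is a solution of the symmetrized ARMA equation $$\tilde Y_{\mathbf t}-\sum_{\mathbf n\in R}\phi_{\mathbf n}\tilde Y_{\mathbf t-\mathbf n}=\tilde Z_{\mathbf t}+\sum_{\mathbf n\in S}\theta_{\mathbf n}\tilde Z_{\mathbf t-\mathbf n},\qquad \mathbf t\in\mathbb{Z}^d,$$ and is given by $$\tilde Y_{\mathbf t}=\sum_{\mathbf k\in\mathbb{N}_0^d}\alpha_{\mathbf k}\tilde Z_{\mathbf t-\mathbf k},\qquad \mathbf t\in\mathbb{Z}^d,$$ where the right-hand side converges almost surely in the rectangular sense. In particular, if $\mathbb{P}_{Z_{\mathbf 0}}$ is symmetric, then there is at most one symmetric causal solution.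
   Context: Notation: $\mathbf z^{\mathbf n}=z_1^{n_1}\cdots z_d^{n_d}$; $\Phi(\mathbf z)=1-\sum_{\mathbf n\in R}\phi_{\mathbf n}\mathbf z^{\mathbf n}$, $\Theta(\mathbf z)=1+\sum_{\mathbf n\in S}\theta_{\mathbf n}\mathbf z^{\mathbf n}$; $\mathbb{D}^d=\{\mathbf z\in\mathbb{C}^d:|z_i|<1,\ i=1,\dots,d\}$. $\mathbb{P}_X$ denotes the distribution of $X$. A random field $(Z_{\mathbf t})$ is deterministic if there is a constant $K$ with $\mathbb{P}(Z_{\mathbf t}=K)=1$ for all $\mathbf t$, and nondeterministic otherwise. A distribution $\mathbb{P}_X$ is symmetric if $X$ and $-X$ have the same distribution; a solution $(Y_{\mathbf t})$ is symmetric if $\mathbb{P}_{Y_{\mathbf 0}}$ is symmetric. Uniqueness is understood up to almost sure equality. For $\mathbf s,\mathbf t\in\mathbb{Z}^d$, $\mathbf s\le\mathbf t$ means $s_i\le t_i$ for all $i$. A strictly stationary complex-valued random field $(Y_{\mathbf t})_{\mathbf t\in\mathbb{Z}^d}$ fulfilling the ARMA equation is called a causal solution if $Y_{\mathbf t}$ is measurable with respect to $\sigma(Z_{\mathbf s}:\mathbf s\le\mathbf t)$ for each $\mathbf t\in\mathbb{Z}^d$. $H^2$ is the Hardy space of all holomorphic $f:\mathbb{D}^d\to\mathbb{C}$ with $\sup_{0\le r<1}\frac{1}{(2\pi)^d}\int_{(-\pi,\pi]^d}|f(re^{-i\mathbf t})|^2\,d\lambda^d(\mathbf t)<\infty$,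 where $e^{-i\mathbf t}=(e^{-it_1},\dots,e^{-it_d})$; equivalently $f(\mathbf z)=\sum_{\mathbf k\in\mathbb{N}_0^d}a_{\mathbf k}\mathbf z^{\mathbf k}$ on $\mathbb{D}^d$ with $\sum|a_{\mathbf k}|^2<\infty$. "$\Theta/\Phi\in H^2$" means that there is $f\in H^2$ with $\Phi f=\Theta$ on $\mathbb{D}^d$ (this $f$ is then unique and is denoted $\Theta/\Phi$). A multiple series $\sum_{\mathbf k\in\mathbb{N}_0^d}X_{\mathbf k}$ of random variables converges almost surely in the rectangular sense if the limits $\lim_{k\to\infty}\sum_{k_1=0}^{N_{1k}}\cdots\sum_{k_d=0}^{N_{dk}}X_{\mathbf k}$, for all sequences $(N_{1k},\dots,N_{dk})_{k\in\mathbb{N}}\subset\mathbb{N}_0^d$ with $\min(N_{1k},\dots,N_{dk})\to\infty$ as $k\to\infty$, almost surely exist and coincide; the limit is the value of the series. *)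

theory Defs
  imports "HOL-Probability.Probability"
begin

text \<open>
  The dimension is the cardinality of a finite index type: points of the lattice are vectors
  in \<^typ>\<open>int ^ 'd\<close>, multi-indices are vectors in \<^typ>\<open>nat ^ 'd\<close>, and the order on both
  types is the componentwise one.
\<close>

definition int_vec :: "nat ^ 'd \<Rightarrow> int ^ 'd" where
  "int_vec n = (\<chi> i. int (n $ i))"

definition vec_power :: "complex ^ 'd \<Rightarrow> nat ^ 'd \<Rightarrow> complex" where
  "vec_power z n = (\<Prod>i\<in>UNIV. z $ i ^ (n $ i))"

definition AR_poly :: "(nat ^ 'd) set \<Rightarrow> (nat ^ 'd \<Rightarrow> complex) \<Rightarrow> complex ^ 'd \<Rightarrow> complex" where
  "AR_poly R \<phi> z = 1 - (\<Sum>n\<in>R. \<phi> n * vec_power z n)"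

definition MA_poly :: "(nat ^ 'd) set \<Rightarrow> (nat ^ 'd \<Rightarrow> complex) \<Rightarrow> complex ^ 'd \<Rightarrow> complex" where
  "MA_poly S \<theta> z = 1 + (\<Sum>n\<in>S. \<theta> n * vec_power z n)"

definition polydisc :: "(complex ^ 'd) set" where
  "polydisc = {z. \<forall>i. norm (z $ i) < 1}"

text \<open>
  On an open set, holomorphy in several variables is Frechet differentiability with a
  complex-linear derivative (\<^const>\<open>has_derivative\<close> only provides real linearity).
\<close>

definition mv_holomorphic_on :: "(complex ^ 'd \<Rightarrow> complex) \<Rightarrow> (complex ^ 'd) set \<Rightarrow> bool" where
  "mv_holomorphic_on f U \<longleftrightarrow>
     (\<forall>z\<in>U. \<exists>f'. (f has_derivative f') (at z) \<and> (\<forall>c v. f' (c *s v) = c * f' v))"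

text \<open>
  Only the values on \<^const>\<open>polydisc\<close> matter for membership in the following set.
\<close>

definition hardy_H2 :: "(complex ^ 'd \<Rightarrow> complex) set" where
  "hardy_H2 = {f. mv_holomorphic_on f polydisc \<and>
     (SUP r\<in>{0..<1::real}. ennreal (1 / (2 * pi) ^ CARD('d)) *
        (\<integral>\<^sup>+t\<in>{t :: real ^ 'd. \<forall>i. - pi < t $ i \<and> t $ i \<le> pi}.
           ennreal ((norm (f (\<chi> i. of_real r * exp (- \<i> * of_real (t $ i)))))\<^sup>2) \<partial>lborel)) < \<infinity>}"

definition power_series_expansion ::
    "(complex ^ 'd \<Rightarrow> complex) \<Rightarrow> (nat ^ 'd \<Rightarrow> complex) \<Rightarrow> bool" where
  "power_series_expansion f \<alpha> \<longleftrightarrow>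
     (\<forall>z\<in>polydisc. ((\<lambda>k. \<alpha> k * vec_power z k) has_sum f z) UNIV)"

definition rect_sums :: "(nat ^ 'd \<Rightarrow> complex) \<Rightarrow> complex \<Rightarrow> bool" where
  "rect_sums x L \<longleftrightarrow>
     (\<forall>N :: nat \<Rightarrow> nat ^ 'd.
        filterlim (\<lambda>k. Min (range (\<lambda>i. N k $ i))) at_top sequentially \<longrightarrow>
        (\<lambda>k. \<Sum>n\<in>{..N k}. x n) \<longlonglongrightarrow> L)"

definition random_field :: "'a measure \<Rightarrow> (int ^ 'd \<Rightarrow> 'a \<Rightarrow> complex) \<Rightarrow> bool" where
  "random_field M X \<longleftrightarrow> (\<forall>t. X t \<in> borel_measurable M)"

definition iid_field :: "'a measure \<Rightarrow> (int ^ 'd \<Rightarrow> 'a \<Rightarrow> complex) \<Rightarrow> bool" where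
  "iid_field M Z \<longleftrightarrow>
     prob_space.indep_vars M (\<lambda>_. borel) Z UNIV \<and>
     (\<forall>s t. distr M borel (Z s) = distr M borel (Z t))"

definition deterministic_field :: "'a measure \<Rightarrow> (int ^ 'd \<Rightarrow> 'a \<Rightarrow> complex) \<Rightarrow> bool" where
  "deterministic_field M Z \<longleftrightarrow> (\<exists>K. \<forall>t. measure M {\<omega> \<in> space M. Z t \<omega> = K} = 1)"

definition symmetric_rv :: "'a measure \<Rightarrow> ('a \<Rightarrow> complex) \<Rightarrow> bool" where
  "symmetric_rv M X \<longleftrightarrow> distr M borel X = distr M borel (\<lambda>\<omega>. - X \<omega>)"

definition strictly_stationary :: "'a measure \<Rightarrow> (int ^ 'd \<Rightarrow> 'a \<Rightarrow> complex) \<Rightarrow> bool" where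
  "strictly_stationary M X \<longleftrightarrow>
     (\<forall>h J. finite J \<longrightarrow>
        distr M (Pi\<^sub>M J (\<lambda>_. borel)) (\<lambda>\<omega>. \<lambda>t\<in>J. X (t + h) \<omega>) =
        distr M (Pi\<^sub>M J (\<lambda>_. borel)) (\<lambda>\<omega>. \<lambda>t\<in>J. X t \<omega>))"

definition ARMA_equation ::
    "'a measure \<Rightarrow> (nat ^ 'd) set \<Rightarrow> (nat ^ 'd) set \<Rightarrow> (nat ^ 'd \<Rightarrow> complex) \<Rightarrow>
     (nat ^ 'd \<Rightarrow> complex) \<Rightarrow> (int ^ 'd \<Rightarrow> 'a \<Rightarrow> complex) \<Rightarrow> (int ^ 'd \<Rightarrow> 'a \<Rightarrow> complex) \<Rightarrow> bool"
  where
  "ARMA_equation M R S \<phi> \<theta> Z Y \<longleftrightarrow>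
     (\<forall>t. AE \<omega> in M.
        Y t \<omega> - (\<Sum>n\<in>R. \<phi> n * Y (t - int_vec n) \<omega>) =
        Z t \<omega> + (\<Sum>n\<in>S. \<theta> n * Z (t - int_vec n) \<omega>))"

definition ARMA_solution ::
    "'a measure \<Rightarrow> (nat ^ 'd) set \<Rightarrow> (nat ^ 'd) set \<Rightarrow> (nat ^ 'd \<Rightarrow> complex) \<Rightarrow>
     (nat ^ 'd \<Rightarrow> complex) \<Rightarrow> (int ^ 'd \<Rightarrow> 'a \<Rightarrow> complex) \<Rightarrow> (int ^ 'd \<Rightarrow> 'a \<Rightarrow> complex) \<Rightarrow> bool"
  where
  "ARMA_solution M R S \<phi> \<theta> Z Y \<longleftrightarrow>
     random_field M Y \<and> strictly_stationary M Y \<and> ARMA_equation M R S \<phi> \<theta> Z Y"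

text \<open>
  The sigma-algebra generated by the variables \<open>Z s\<close> with \<open>s \<le> t\<close>, without null sets added.
\<close>

definition past_sigma :: "'a measure \<Rightarrow> (int ^ 'd \<Rightarrow> 'a \<Rightarrow> complex) \<Rightarrow> int ^ 'd \<Rightarrow> 'a measure" where
  "past_sigma M Z t =
     sigma (space M) (\<Union>s\<in>{s. s \<le> t}. {Z s -` A \<inter> space M | A. A \<in> sets borel})"

definition causal_solution ::
    "'a measure \<Rightarrow> (nat ^ 'd) set \<Rightarrow> (nat ^ 'd) set \<Rightarrow> (nat ^ 'd \<Rightarrow> complex) \<Rightarrow>
     (nat ^ 'd \<Rightarrow> complex) \<Rightarrow> (int ^ 'd \<Rightarrow> 'a \<Rightarrow> complex) \<Rightarrow> (int ^ 'd \<Rightarrow> 'a \<Rightarrow> complex) \<Rightarrow> bool"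
  where
  "causal_solution M R S \<phi> \<theta> Z Y \<longleftrightarrow>
     ARMA_solution M R S \<phi> \<theta> Z Y \<and> (\<forall>t. Y t \<in> borel_measurable (past_sigma M Z t))"

text \<open>
  A probability space need not be rich enough to carry an independent copy of a given field.
  Copies are therefore taken on an extension \<open>N\<close> of \<open>M\<close>, to which a random variable \<open>X\<close> on
  \<open>M\<close> is transported as \<open>X \<circ> p\<close>.
\<close>

definition prob_space_extension :: "'b measure \<Rightarrow> 'a measure \<Rightarrow> ('b \<Rightarrow> 'a) \<Rightarrow> bool" where
  "prob_space_extension N M p \<longleftrightarrow>
     prob_space N \<and> p \<in> measurable N M \<and> distr N M p = M"

definition joint_field ::
    "(int ^ 'd \<Rightarrow> 'a \<Rightarrow> complex) \<Rightarrow> (int ^ 'd \<Rightarrow> 'a \<Rightarrow> complex) \<Rightarrow> 'a \<Rightarrow> int ^ 'd \<Rightarrow> complex \<times> complex"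
  where
  "joint_field Y Z \<omega> t = (Y t \<omega>, Z t \<omega>)"

definition independent_copy ::
    "'a measure \<Rightarrow> (int ^ 'd \<Rightarrow> 'a \<Rightarrow> complex) \<Rightarrow> (int ^ 'd \<Rightarrow> 'a \<Rightarrow> complex) \<Rightarrow>
     (int ^ 'd \<Rightarrow> 'a \<Rightarrow> complex) \<Rightarrow> (int ^ 'd \<Rightarrow> 'a \<Rightarrow> complex) \<Rightarrow> bool"
  where
  "independent_copy M Y Z Y' Z' \<longleftrightarrow>
     prob_space.indep_var M (Pi\<^sub>M UNIV (\<lambda>_. borel)) (joint_field Y Z)
                            (Pi\<^sub>M UNIV (\<lambda>_. borel)) (joint_field Y' Z') \<and>
     distr M (Pi\<^sub>M UNIV (\<lambda>_. borel)) (joint_field Y' Z') =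
     distr M (Pi\<^sub>M UNIV (\<lambda>_. borel)) (joint_field Y Z)"

text \<open>Such an extension always exists: take \<open>M \<Otimes>\<^sub>M M\<close> with its two projections.\<close>

lemma independent_copy_exists:
  assumes "prob_space M" "random_field M Y" "random_field M Z"
  shows "prob_space_extension (M \<Otimes>\<^sub>M M) M fst"
    and "independent_copy (M \<Otimes>\<^sub>M M) (\<lambda>t. Y t \<circ> fst) (\<lambda>t. Z t \<circ> fst)
           (\<lambda>t. Y t \<circ> snd) (\<lambda>t. Z t \<circ> snd)"
proof -
  interpret M: prob_space M by fact
  interpret MM: pair_prob_space M M ..
  let ?P = "Pi\<^sub>M UNIV (\<lambda>_. borel) :: (int ^ 'b \<Rightarrow> complex \<times> complex) measure"
  have [measurable]: "Y t \<in> borel_measurable M" "Z t \<in> borel_measurable M" for t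
    using assms by (auto simp: random_field_def)
  have J[measurable]: "joint_field Y Z \<in> measurable M ?P"
    by (rule measurable_PiM_single') (auto simp: joint_field_def)
  have eq: "joint_field (\<lambda>t. Y t \<circ> q) (\<lambda>t. Z t \<circ> q) = (\<lambda>w. joint_field Y Z (q w))"
    for q :: "'a \<times> 'a \<Rightarrow> 'a"
    by (auto simp: joint_field_def fun_eq_iff)
  have f: "distr (M \<Otimes>\<^sub>M M) M fst = M" by (rule M.distr_pair_fst)
  have s: "distr (M \<Otimes>\<^sub>M M) M snd = M"
    by (subst MM.distr_pair_swap) (simp add: distr_distr comp_def case_prod_beta f)
  show "prob_space_extension (M \<Otimes>\<^sub>M M) M fst"
    using f by (simp add: prob_space_extension_def MM.prob_space_axioms)
  have df: "distr (M \<Otimes>\<^sub>M M) ?P (\<lambda>w. joint_field Y Z (fst w)) = distr M ?P (joint_field Y Z)"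
    using distr_distr[of "joint_field Y Z" M ?P fst "M \<Otimes>\<^sub>M M"] f by (simp add: comp_def)
  have ds: "distr (M \<Otimes>\<^sub>M M) ?P (\<lambda>w. joint_field Y Z (snd w)) = distr M ?P (joint_field Y Z)"
    using distr_distr[of "joint_field Y Z" M ?P snd "M \<Otimes>\<^sub>M M"] s by (simp add: comp_def)
  have p: "distr M ?P (joint_field Y Z) \<Otimes>\<^sub>M distr M ?P (joint_field Y Z) =
      distr (M \<Otimes>\<^sub>M M) (?P \<Otimes>\<^sub>M ?P) (\<lambda>(x, y). (joint_field Y Z x, joint_field Y Z y))"
    by (rule pair_measure_distr)
       (auto intro!: prob_space_imp_sigma_finite M.prob_space_distr)
  have "MM.indep_var ?P (\<lambda>w. joint_field Y Z (fst w)) ?P (\<lambda>w. joint_field Y Z (snd w))"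
    unfolding MM.indep_var_distribution_eq df ds p by (auto simp: case_prod_beta')
  then show "independent_copy (M \<Otimes>\<^sub>M M) (\<lambda>t. Y t \<circ> fst) (\<lambda>t. Z t \<circ> fst)
           (\<lambda>t. Y t \<circ> snd) (\<lambda>t. Z t \<circ> snd)"
    unfolding independent_copy_def eq df ds by simp
qed

end

theory Submission
  imports Defs
begin

text \<open>
  Iterating the ARMA equation along a finite down-set \<open>D\<close> of multi-indices gives
  \<open>Y\<^sub>t = (\<Sum>k\<in>D. \<alpha>\<^sub>k Z\<^sub>t\<^sub>-\<^sub>k) + B\<^sub>D\<close>, where \<open>B\<^sub>D\<close> only involves the \<open>Z\<^sub>t\<^sub>-\<^sub>k\<close> with \<open>k \<notin> D\<close> and
  is therefore independent of the sum. So the characteristic function of \<open>Y\<^sub>t\<close> is dominated by the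
  product of those of the \<open>\<alpha>\<^sub>k Z\<^sub>t\<^sub>-\<^sub>k\<close>; in the symmetric case these are real and bounded away from
  0 near the origin, and averaging over frequencies bounds the sum over \<open>k\<close> of the expectations of
  \<open>min 1 (\<delta> \<bar>\<alpha>\<^sub>k Z\<^sub>t\<^sub>-\<^sub>k\<bar>)\<^sup>2\<close>. Hence \<open>\<alpha>\<close> is square summable. The same bound makes the partial sums
  Cauchy in probability, and Levy's reflection argument, applied to one coordinate at a time, turns
  this into almost sure convergence in the rectangular sense to some \<open>X\<close>. Testing against events
  that depend on finitely many innovations gives \<open>exp (\<i> s Y\<^sub>t) = c s * exp (\<i> s X)\<close> with
  \<open>c s > 0\<close> for small \<open>s\<close>, so \<open>c s = 1\<close> and \<open>Y\<^sub>t = X\<close>.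
\<close>

section \<open>Levy's inequality for rectangular partial sums\<close>

text \<open>All that is known of B is its independence from the partial sum and that its
  characteristic function has modulus at most 1. Symmetry makes this usable: the factors are real
  and continuous and do not vanish near 0, hence they stay positive there, and products then control
  sums of \<open>1 - cosU\<close>. The coefficients come from the formal quotient, because Phi may
  vanish inside the polydisc; a function Theta/Phi is built from them only once square summability
  is known. Outside the symmetric case the innovations are the pairs (Z, Z') and not their
  differences: in general Y - Y' and its remainders are measurable only with respect to the pairs.
  Square summability is always derived on the product of M with itself, even when Y and Z are
  symmetric: the coefficients do not depend on the probability space, so any extension that carries
  a copy will do.\<close>

lemma finite_atMost_nat_vec [simp]: "finite {..n :: nat ^ 'd}"
proof -
  have "{..n} \<subseteq> (\<lambda>f. \<chi> i. f i) ` (PiE UNIV (\<lambda>i. {..n $ i}))"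
  proof
    fix k assume "k \<in> {..n}"
    then have "(\<lambda>i. k $ i) \<in> PiE UNIV (\<lambda>i. {..n $ i})" by (auto simp: less_eq_vec_def)
    moreover have "k = (\<chi> i. (\<lambda>i. k $ i) i)" by simp
    ultimately show "k \<in> (\<lambda>f. \<chi> i. f i) ` (PiE UNIV (\<lambda>i. {..n $ i}))" by blast
  qed
  then show ?thesis by (rule finite_subset) (auto intro!: finite_PiE)
qed

text \<open>Reflection principle in abstract form. Split the union according to the first index m at
  which \<open>E m\<close> occurs. The measure-preserving map \<open>T m\<close> leaves this
  first-entrance event invariant and moves each of its points outside \<open>E n\<close> into
  \<open>E n\<close>, so at least half of its mass lies in \<open>E n\<close>.\<close>

lemma (in prob_space) prob_Union_reflection_le:
  fixes E :: "nat \<Rightarrow> 'a set" and T :: "nat \<Rightarrow> 'a \<Rightarrow> 'a"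
  assumes E: "\<And>m. m \<le> n \<Longrightarrow> E m \<in> events"
    and T: "\<And>m. m \<le> n \<Longrightarrow> T m \<in> measurable M M" "\<And>m. m \<le> n \<Longrightarrow> distr M M (T m) = M"
    and inv: "\<And>l m x. l \<le> m \<Longrightarrow> m \<le> n \<Longrightarrow> x \<in> space M \<Longrightarrow> T m x \<in> E l \<longleftrightarrow> x \<in> E l"
    and refl: "\<And>m x. m \<le> n \<Longrightarrow> x \<in> E m \<Longrightarrow> x \<in> E n \<or> T m x \<in> E n"
  shows "prob (\<Union>m\<le>n. E m) \<le> 2 * prob (E n)"
proof -
  \<comment> \<open>First-entrance events: disjoint, with the same union as the
    \<open>E m\<close>.\<close>
  define A where "A m = E m - (\<Union>l<m. E l)" for m
  have A[measurable]: "A m \<in> events" if "m \<le> n" for m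
    using that E unfolding A_def by (intro sets.Diff sets.finite_UN) auto
  have disj: "disjoint_family_on A S" for S
    unfolding disjoint_family_on_def
  proof (intro ballI impI)
    fix m n :: nat assume "m \<noteq> n"
    then show "A m \<inter> A n = {}" unfolding A_def by (cases m n rule: linorder_cases) auto
  qed
  have A_bound: "prob (A m) \<le> 2 * prob (A m \<inter> E n)" if m: "m \<le> n" for m
  proof -
    have [measurable]: "T m \<in> measurable M M" by (rule T(1)[OF m])
    have [measurable]: "A m \<in> events" "E n \<in> events" using A E m by auto
    have "prob (A m \<inter> E n) = measure (distr M M (T m)) (A m \<inter> E n)"
      by (simp add: T(2)[OF m])
    also have "\<dots> = prob (T m -` (A m \<inter> E n) \<inter> space M)"
      by (rule measure_distr) measurable
    finally have e: "prob (T m -` (A m \<inter> E n) \<inter> space M) = prob (A m \<inter> E n)" ..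
    have "A m \<subseteq> (A m \<inter> E n) \<union> (T m -` (A m \<inter> E n) \<inter> space M)"
    proof
      fix x assume x: "x \<in> A m"
      then have xs: "x \<in> space M" using sets.sets_into_space[OF \<open>A m \<in> events\<close>] by auto
      have "T m x \<in> A m"
        using x inv[OF _ m xs] unfolding A_def by auto
      moreover have "x \<in> E n \<or> T m x \<in> E n" using refl[OF m] x by (auto simp: A_def)
      ultimately show "x \<in> (A m \<inter> E n) \<union> (T m -` (A m \<inter> E n) \<inter> space M)"
        using x xs by auto
    qed
    then have "prob (A m) \<le> prob ((A m \<inter> E n) \<union> (T m -` (A m \<inter> E n) \<inter> space M))"
      by (intro finite_measure_mono) measurable
    also have "\<dots> \<le> prob (A m \<inter> E n) + prob (T m -` (A m \<inter> E n) \<inter> space M)"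
      by (intro measure_Un_le) measurable
    finally show ?thesis using e by simp
  qed
  have "(\<Union>m\<le>n. E m) = (\<Union>m\<le>n. A m)"
  proof -
    have "\<exists>l\<le>m. x \<in> A l" if "x \<in> E m" for x m
      using that
    proof (induction m rule: less_induct)
      case (less m)
      show ?case
      proof (cases "x \<in> A m")
        case False
        then obtain l where "l < m" "x \<in> E l" using less.prems by (auto simp: A_def)
        with less.IH[of l] show ?thesis by (meson le_trans less_imp_le)
      qed auto
    qed
    then show ?thesis by (auto simp: A_def intro: order.trans) (metis atMost_iff le_trans)
  qed
  then have "prob (\<Union>m\<le>n. E m) = prob (\<Union>m\<le>n. A m)" by simp
  also have "\<dots> = (\<Sum>m\<le>n. prob (A m))"
    by (rule finite_measure_finite_Union) (use A disj in auto)
  also have "\<dots> \<le> (\<Sum>m\<le>n. 2 * prob (A m \<inter> E n))"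
    using A_bound by (intro sum_mono) auto
  also have "\<dots> = 2 * prob (\<Union>m\<le>n. A m \<inter> E n)"
  proof (subst finite_measure_finite_Union)
    show "disjoint_family_on (\<lambda>m. A m \<inter> E n) {..n}"
      using disj[of "{..n}"] by (auto simp: disjoint_family_on_def)
  qed (use A E in \<open>auto simp: sum_distrib_left\<close>)
  also have "\<dots> \<le> 2 * prob (E n)"
    using E by (intro mult_left_mono finite_measure_mono) auto
  finally show ?thesis .
qed

text \<open>Induction on the set I of directions in which a rectangle may be shorter than L; each
  direction costs one reflection and hence a factor 2. The statement lives on sequence space, where
  reversing signs is a map of the space itself and symmetry of the terms becomes invariance of the
  measure.\<close>

lemma levy_maximal_inequality_rectangular:
  fixes L :: "nat ^ 'd" and \<epsilon> :: real and M :: "(nat ^ 'd \<Rightarrow> real) measure"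
  assumes "prob_space M"
    and M: "sets M = sets (Pi\<^sub>M UNIV (\<lambda>_. borel :: real measure))"
    and flip: "\<And>K :: (nat ^ 'd) set. distr M M (\<lambda>x k. if k \<in> K then - x k else x k) = M"
  shows "measure M {x \<in> space M. \<exists>n\<le>L. (\<forall>i. i \<notin> I \<longrightarrow> n $ i = L $ i) \<and> \<bar>\<Sum>k\<in>{..n}. x k\<bar> > \<epsilon>}
    \<le> 2 ^ card I * measure M {x \<in> space M. \<bar>\<Sum>k\<in>{..L}. x k\<bar> > \<epsilon>}"
    (is "measure M (?E I) \<le> _ * measure M ?F")
proof -
  interpret prob_space M by fact
  have sp: "space M = UNIV" using sets_eq_imp_space_eq[OF M] by (simp add: space_PiM)
  have [measurable]: "(\<lambda>x. x k) \<in> borel_measurable M" for k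
    unfolding measurable_cong_sets[OF M refl] by (rule measurable_component_singleton) simp
  have flip_meas: "(\<lambda>x k. if k \<in> K then - x k else x k) \<in> measurable M M" for K
  proof -
    have "(\<lambda>x k. if k \<in> K then - x k else x k) \<in> measurable M (Pi\<^sub>M UNIV (\<lambda>_. borel :: real measure))"
      by (rule measurable_PiM_single') auto
    then show ?thesis using M measurable_cong_sets by blast
  qed
  have fin: "finite I" by simp
  then show ?thesis
  proof (induction I rule: finite_induct)
    case empty
    have "?E {} = ?F" by (auto simp: vec_eq_iff[symmetric])
    then show ?case by simp
  next
    case (insert j I)
    \<comment> \<open>The length m in the new direction j plays the role of time; at the final time
      \<open>L $ j\<close> only directions in I remain free, which is the event of the induction
      hypothesis.\<close>
    define E where "E m = {x \<in> space M. \<exists>n\<le>L. (\<forall>i. i \<notin> insert j I \<longrightarrow> n $ i = L $ i) \<and>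
      n $ j = m \<and> \<bar>\<Sum>k\<in>{..n}. x k\<bar> > \<epsilon>}" for m
    \<comment> \<open>Signs change only beyond the hyperplane of height m, so rectangles whose j-th
      side is at most m keep their sums.\<close>
    define T where "T m x k = (if k \<in> {k. k $ j > m} then - x k else x k)"
      for m and x :: "nat ^ 'd \<Rightarrow> real" and k
    have fl: "finite {n. n \<le> L}" using finite_atMost_nat_vec[of L] by (simp add: atMost_def)
    have EI: "?E (insert j I) = (\<Union>m\<le>L $ j. E m)"
      unfolding E_def by (auto simp: less_eq_vec_def)
    have "(\<forall>i. i \<notin> insert j I \<longrightarrow> n $ i = L $ i) \<and> n $ j = L $ j \<longleftrightarrow>
        (\<forall>i. i \<notin> I \<longrightarrow> n $ i = L $ i)" for n :: "nat ^ 'd"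
      using \<open>j \<notin> I\<close> by (metis insert_iff)
    then have EL: "E (L $ j) = ?E I"
      unfolding E_def by blast
    have "prob (\<Union>m\<le>L $ j. E m) \<le> 2 * prob (E (L $ j))"
    proof (rule prob_Union_reflection_le[where T = T])
      show "E m \<in> events" for m
      proof -
        have "E m = (\<Union>n\<in>{n. n \<le> L \<and> (\<forall>i. i \<notin> insert j I \<longrightarrow> n $ i = L $ i) \<and> n $ j = m}.
            {x \<in> space M. \<bar>\<Sum>k\<in>{..n}. x k\<bar> > \<epsilon>})"
          unfolding E_def by auto
        also have "\<dots> \<in> events"
          using fl by (intro sets.finite_UN) auto
        finally show ?thesis .
      qed
      show "T m \<in> measurable M M" for m
        unfolding T_def by (rule flip_meas)
      show "distr M M (T m) = M" for m
        using flip[of "{k. k $ j > m}"] by (simp add: T_def[abs_def])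
      show "T m x \<in> E l \<longleftrightarrow> x \<in> E l" if "l \<le> m" for l m x
      proof -
        have "(\<Sum>k\<in>{..n}. T m x k) = (\<Sum>k\<in>{..n}. x k)" if "n $ j = l" for n
          using that \<open>l \<le> m\<close> by (intro sum.cong) (auto simp: T_def less_eq_vec_def dest!: spec[of _ j])
        then show ?thesis unfolding E_def by (auto simp: sp)
      qed
      fix m x assume m: "m \<le> L $ j" and "x \<in> E m"
      then obtain n where n: "n \<le> L" "\<And>i. i \<notin> insert j I \<Longrightarrow> n $ i = L $ i" "n $ j = m"
        and gt: "\<bar>\<Sum>k\<in>{..n}. x k\<bar> > \<epsilon>" unfolding E_def by auto
      \<comment> \<open>Extend the rectangle to full length in direction j. Its sums before and
        after reflection average to the sum over \<open>{..n}\<close>, so one of the two exceeds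
        \<epsilon> in absolute value.\<close>
      define n' where "n' = (\<chi> i. if i = j then L $ j else n $ i)"
      have split: "{..n'} = {..n} \<union> {k \<in> {..n'}. k $ j > m}"
      proof (rule set_eqI)
        fix k
        have "k \<le> n" if "k \<le> n'" "\<not> k $ j > m"
          unfolding less_eq_vec_def
        proof
          fix i show "k $ i \<le> n $ i"
            using that(2) n(3) spec[OF that(1)[unfolded less_eq_vec_def], of i]
            by (cases "i = j") (auto simp: n'_def)
        qed
        moreover have "k \<le> n'" if "k \<le> n"
          unfolding less_eq_vec_def
        proof
          fix i show "k $ i \<le> n' $ i"
            using spec[OF that[unfolded less_eq_vec_def], of i] n(3) m
            by (auto simp: n'_def)
        qed
        ultimately show "k \<in> {..n'} \<longleftrightarrow> k \<in> {..n} \<union> {k \<in> {..n'}. k $ j > m}" by auto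
      qed
      have disj: "{..n} \<inter> {k \<in> {..n'}. k $ j > m} = {}"
        using n(3) by (auto simp: less_eq_vec_def dest!: spec[of _ j])
      have dec: "(\<Sum>k\<in>{..n'}. y k) = (\<Sum>k\<in>{..n}. y k) + (\<Sum>k\<in>{k \<in> {..n'}. k $ j > m}. y k)" for y :: "_ \<Rightarrow> real"
        by (subst split, rule sum.union_disjoint[OF _ _ disj])
           (auto intro: finite_subset[of _ "{..n'}"])
      have "(\<Sum>k\<in>{..n'}. T m x k) = (\<Sum>k\<in>{..n}. x k) - (\<Sum>k\<in>{k \<in> {..n'}. k $ j > m}. x k)"
      proof -
        have "(\<Sum>k\<in>{..n}. T m x k) = (\<Sum>k\<in>{..n}. x k)"
          using n(3) by (intro sum.cong) (auto simp: T_def less_eq_vec_def dest!: spec[of _ j])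
        moreover have "(\<Sum>k\<in>{k \<in> {..n'}. k $ j > m}. T m x k) = - (\<Sum>k\<in>{k \<in> {..n'}. k $ j > m}. x k)"
          by (subst sum_negf[symmetric], intro sum.cong) (auto simp: T_def)
        ultimately show ?thesis by (simp add: dec)
      qed
      then have "\<bar>\<Sum>k\<in>{..n'}. x k\<bar> > \<epsilon> \<or> \<bar>\<Sum>k\<in>{..n'}. T m x k\<bar> > \<epsilon>"
        using dec[of x] gt by linarith
      moreover have "n' \<le> L" using n(1) by (auto simp: n'_def less_eq_vec_def)
      moreover have "n' $ i = L $ i" if "i \<notin> insert j I" for i using n(2) that by (auto simp: n'_def)
      moreover have "n' $ j = L $ j" by (simp add: n'_def)
      ultimately show "x \<in> E (L $ j) \<or> T m x \<in> E (L $ j)"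
        unfolding E_def by (auto simp: sp)
    qed
    also have "\<dots> \<le> 2 * (2 ^ card I * prob ?F)"
      using insert.IH unfolding EL by simp
    finally show ?case using insert.hyps unfolding EI by (simp add: mult.assoc)
  qed
qed

section \<open>An averaged cosine\<close>

text \<open>The function 1 - sin y / y. The integral gives the correct value 0 at y = 0, where the
  closed formula would yield 1 under the convention \<open>0 / 0 = 0\<close>.\<close>

definition sinc_gap :: "real \<Rightarrow> real" where
  "sinc_gap y = (LBINT s=0..1. 1 - cos (s * y))"

lemma sinc_gap_eq: "y \<noteq> 0 \<Longrightarrow> sinc_gap y = 1 - sin y / y"
proof -
  assume y: "y \<noteq> 0"
  have "(LBINT s=0..1. 1 - cos (s * y)) = (1 - sin (1 * y) / y) - (0 - sin (0 * y) / y)"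
    unfolding zero_ereal_def one_ereal_def
    by (rule interval_integral_FTC_finite)
       (use y in \<open>auto intro!: continuous_intros derivative_eq_intros simp: has_real_derivative_iff_has_vector_derivative[symmetric]\<close>)
  then show ?thesis by (simp add: sinc_gap_def)
qed

lemma sinc_gap_0: "sinc_gap 0 = 0"
  by (simp add: sinc_gap_def)

lemma sinc_gap_minus [simp]: "sinc_gap (- y) = sinc_gap y"
  by (cases "y = 0") (simp_all add: sinc_gap_eq)

text \<open>Turns an averaged characteristic function into a truncated second moment. For 0 < y
  \<le> 2 the Taylor expansion leaves at least (1/6 - 4/120) y^2 = 2/15 y^2, and 2/15 exceeds 1/8;
  for y > 2 the quotient sin y / y is at most 1/2.\<close>

lemma sinc_gap_lower: "sinc_gap y \<ge> min 1 (y\<^sup>2) / 8"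
proof -
  have pos: "sinc_gap y \<ge> min 1 (y\<^sup>2) / 8" if y: "y > 0" for y
  proof (cases "y \<le> 2")
    case True
    have "\<bar>sin y - (\<Sum>m<5. sin_coeff m * y ^ m)\<bar> \<le> inverse (fact 5) * \<bar>y\<bar> ^ 5"
      by (rule Maclaurin_sin_bound)
    moreover have "(\<Sum>m<5. sin_coeff m * y ^ m) = y - y ^ 3 / 6"
    proof -
      have "{..<5::nat} = {0, 1, 2, 3, 4}" by auto
      then show ?thesis by (simp add: sin_coeff_def fact_numeral)
    qed
    moreover have "inverse (fact 5) * \<bar>y\<bar> ^ 5 = y ^ 5 / 120"
      using y by (simp add: fact_numeral field_simps)
    ultimately have "sin y \<le> y - y ^ 3 / 6 + y ^ 5 / 120" by linarith
    also have "\<dots> = y * (1 - y\<^sup>2 / 6 + y\<^sup>2 * y\<^sup>2 / 120)"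
      by (simp add: power_numeral_reduce field_simps)
    finally have "sin y / y \<le> 1 - y\<^sup>2 / 6 + y\<^sup>2 * y\<^sup>2 / 120"
      using y by (simp add: field_simps)
    moreover have "y\<^sup>2 * y\<^sup>2 \<le> y\<^sup>2 * 4"
      using power_mono[of y 2 2] True y by (intro mult_left_mono) auto
    ultimately have "sin y / y \<le> 1 - y\<^sup>2 * (2/15)" by linarith
    moreover have "min 1 (y\<^sup>2) \<le> y\<^sup>2" "0 \<le> y\<^sup>2" by auto
    moreover have "sinc_gap y = 1 - sin y / y" using y by (simp add: sinc_gap_eq)
    ultimately show ?thesis by linarith
  next
    case False
    then have "sin y * 2 \<le> y"
      using sin_le_one[of y] by linarith
    then have "sin y / y \<le> 1 / 2"
      using y by (simp add: field_simps)
    moreover have "min 1 (y\<^sup>2) \<le> 1" by auto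
    moreover have "sinc_gap y = 1 - sin y / y" using y by (simp add: sinc_gap_eq)
    ultimately show ?thesis by linarith
  qed
  consider "y = 0" | "y > 0" | "- y > 0" by linarith
  then show ?thesis
    using pos[of y] pos[of "- y"] by cases (auto simp: sinc_gap_0)
qed

lemma sinc_gap_nonneg: "sinc_gap y \<ge> 0"
  using sinc_gap_lower[of y] by (smt (verit) min_def zero_le_power2 divide_nonneg_nonneg)

lemma sinc_gap_le: "sinc_gap y \<le> 2"
proof (cases "y = 0")
  case False
  have "\<bar>sin y / y\<bar> \<le> 1" using abs_sin_x_le_abs_x[of y] False by (simp add: field_simps abs_divide)
  then show ?thesis using sinc_gap_eq[OF False] by linarith
qed (simp add: sinc_gap_0)

lemma sinc_gap_measurable [measurable]: "sinc_gap \<in> borel_measurable borel"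
proof -
  have eq: "sinc_gap = (\<lambda>y. if y = 0 then 0 else 1 - sin y / y)"
    by (auto simp: sinc_gap_eq sinc_gap_0)
  show ?thesis unfolding eq by measurable
qed

abbreviation unit_interval :: "real measure" where
  "unit_interval \<equiv> restrict_space lborel {0..1}"

lemma prob_space_unit_interval: "prob_space unit_interval"
  by (rule prob_spaceI) (simp add: emeasure_restrict_space space_restrict_space)

text \<open>Fubini for a bounded integrand on a product of two probability spaces. Averaging over
  frequencies replaces an oscillating cosine by the nonnegative function \<open>sinc_gap\<close>,
  whose expectation can be compared with moments and tail probabilities.\<close>

lemma (in prob_space)
  fixes X :: "'a \<Rightarrow> real"
  assumes [measurable]: "X \<in> borel_measurable M"
  shows integral_one_minus_cos: "(LINT s|unit_interval. 1 - expectation (\<lambda>\<omega>. cos (s * X \<omega>))) =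
      expectation (\<lambda>\<omega>. sinc_gap (X \<omega>))"
    and integrable_one_minus_cos: "integrable unit_interval (\<lambda>s. 1 - expectation (\<lambda>\<omega>. cos (s * X \<omega>)))"
proof -
  interpret R: prob_space unit_interval by (rule prob_space_unit_interval)
  interpret P: pair_prob_space unit_interval M ..
  have [measurable]: "fst \<in> borel_measurable (unit_interval \<Otimes>\<^sub>M M)"
  proof -
    have id: "(\<lambda>s. s) \<in> borel_measurable unit_interval" by (intro measurable_restrict_space1) simp
    show ?thesis by (rule measurable_compose[OF measurable_fst id])
  qed
  have int: "integrable (unit_interval \<Otimes>\<^sub>M M) (\<lambda>(s, \<omega>). 1 - cos (s * X \<omega>))"
    by (rule P.P.integrable_const_bound[where B = 2])
       (auto simp: split_beta abs_le_iff intro!: AE_I2 intro: order.trans[OF cos_le_one])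
  have eq: "1 - expectation (\<lambda>\<omega>. cos (s * X \<omega>)) = expectation (\<lambda>\<omega>. 1 - cos (s * X \<omega>))" for s
  proof -
    have "integrable M (\<lambda>\<omega>. cos (s * X \<omega>))"
      by (rule integrable_const_bound[where B = 1]) auto
    then show ?thesis by (simp add: prob_space)
  qed
  show "integrable unit_interval (\<lambda>s. 1 - expectation (\<lambda>\<omega>. cos (s * X \<omega>)))"
    unfolding eq using P.integrable_fst[OF int] by simp
  have "(LINT s|unit_interval. expectation (\<lambda>\<omega>. 1 - cos (s * X \<omega>))) =
      expectation (\<lambda>\<omega>. LINT s|unit_interval. 1 - cos (s * X \<omega>))"
    using P.Fubini_integral[OF int] by simp
  also have "\<dots> = expectation (\<lambda>\<omega>. sinc_gap (X \<omega>))"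
    by (simp add: sinc_gap_def interval_integral_Icc zero_ereal_def one_ereal_def
        set_lebesgue_integral_def integral_restrict_space)
  finally show "(LINT s|unit_interval. 1 - expectation (\<lambda>\<omega>. cos (s * X \<omega>))) =
      expectation (\<lambda>\<omega>. sinc_gap (X \<omega>))" unfolding eq .
qed

section \<open>Sigma-algebras generated by subfamilies\<close>

text \<open>Extends the construction of \<open>past_sigma\<close> to arbitrary index sets and value
  spaces: remainders need the complement of a rectangle as index set, and the unsymmetric case needs
  pairs as values.\<close>

definition gen_sigma :: "'b measure \<Rightarrow> 'c measure \<Rightarrow> ('i \<Rightarrow> 'b \<Rightarrow> 'c) \<Rightarrow> 'i set \<Rightarrow> 'b measure" where
  "gen_sigma N K W I = sigma (space N) (\<Union>i\<in>I. {W i -` A \<inter> space N | A. A \<in> sets K})"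

lemma past_sigma_eq: "past_sigma M Z t = gen_sigma M borel Z {..t}"
  by (simp add: past_sigma_def gen_sigma_def atMost_def)

lemma space_gen_sigma [simp]: "space (gen_sigma N K W I) = space N"
  by (simp add: gen_sigma_def space_measure_of_conv)

lemma sets_gen_sigma:
  "sets (gen_sigma N K W I) = sigma_sets (space N) (\<Union>i\<in>I. {W i -` A \<inter> space N | A. A \<in> sets K})"
  unfolding gen_sigma_def by (rule sets_measure_of) auto

lemma gen_sigma_reindex: "gen_sigma N K (\<lambda>k. W (h k)) I = gen_sigma N K W (h ` I)"
  by (simp add: gen_sigma_def)

lemma sets_gen_sigma_mono: "I \<subseteq> J \<Longrightarrow> sets (gen_sigma N K W I) \<subseteq> sets (gen_sigma N K W J)"
  unfolding sets_gen_sigma by (rule sigma_sets_mono') auto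

lemma measurable_gen_sigma_mono:
  "f \<in> measurable (gen_sigma N K W I) L \<Longrightarrow> I \<subseteq> J \<Longrightarrow> f \<in> measurable (gen_sigma N K W J) L"
  using measurable_mono[of L L "gen_sigma N K W I" "gen_sigma N K W J"] sets_gen_sigma_mono[of I J N K W]
  by auto

lemma sets_gen_sigma_subset:
  assumes "\<And>i. i \<in> I \<Longrightarrow> W i \<in> measurable N K"
  shows "sets (gen_sigma N K W I) \<subseteq> sets N"
  unfolding sets_gen_sigma using assms by (intro sets.sigma_sets_subset) auto

lemma measurable_gen_sigma_imp:
  assumes "\<And>i. i \<in> I \<Longrightarrow> W i \<in> measurable N K" "f \<in> measurable (gen_sigma N K W I) L"
  shows "f \<in> measurable N L"
proof -
  have "sets (gen_sigma N K W I) \<subseteq> sets N" by (rule sets_gen_sigma_subset) (use assms in auto)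
  then show ?thesis using measurable_mono[of L L "gen_sigma N K W I" N] assms(2) by auto
qed

lemma gen_sigma_component:
  assumes "W i \<in> measurable N K" "i \<in> I"
  shows "W i \<in> measurable (gen_sigma N K W I) K"
proof (rule measurableI)
  show "W i x \<in> space K" if "x \<in> space (gen_sigma N K W I)" for x
    using that assms(1) by (auto dest: measurable_space)
  show "W i -` A \<inter> space (gen_sigma N K W I) \<in> sets (gen_sigma N K W I)" if "A \<in> sets K" for A
    unfolding sets_gen_sigma using that assms(2) by (auto intro!: sigma_sets.Basic)
qed

lemma Int_stable_vimage: "Int_stable {f -` A \<inter> X | A. A \<in> sets L}"
proof (rule Int_stableI)
  fix a b assume "a \<in> {f -` A \<inter> X | A. A \<in> sets L}" "b \<in> {f -` A \<inter> X | A. A \<in> sets L}"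
  then obtain A B where "a = f -` A \<inter> X" "b = f -` B \<inter> X" "A \<in> sets L" "B \<in> sets L"
    by auto
  then show "a \<inter> b \<in> {f -` A \<inter> X | A. A \<in> sets L}"
    by (intro CollectI exI[of _ "A \<inter> B"]) auto
qed

text \<open>Grouping of independent families at the level of sigma-algebras: disjoint index sets
  generate independent sigma-algebras because the generators are closed under intersection. This
  separates a partial sum from its remainder.\<close>

lemma (in prob_space) indep_var_gen_sigma:
  assumes W: "indep_vars (\<lambda>_. K) W A" and IJ: "I \<union> J \<subseteq> A" "I \<inter> J = {}"
    and f: "f \<in> measurable (gen_sigma M K W I) L1" and g: "g \<in> measurable (gen_sigma M K W J) L2"
  shows "indep_var L1 f L2 g"
proof -
  let ?E = "\<lambda>i. {W i -` A \<inter> space M | A. A \<in> sets K}"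
  have Wm: "W i \<in> measurable M K" if "i \<in> I \<union> J" for i
    using W IJ that by (auto simp: indep_vars_def)
  have E: "indep_sets ?E (I \<union> J)"
    using W unfolding indep_vars_def2 by (intro indep_sets_mono_index[OF IJ(1)]) auto
  have "indep_sets (\<lambda>b. sigma_sets (space M) (\<Union>i\<in>case_bool I J b. ?E i)) UNIV"
  proof (rule indep_sets_collect_sigma)
    show "indep_sets ?E (\<Union>b\<in>UNIV. case_bool I J b)" using E by (simp add: UNIV_bool Un_commute)
    show "disjoint_family_on (case_bool I J) UNIV"
      using IJ by (auto simp: disjoint_family_on_def split: bool.split)
    show "Int_stable (?E i)" for i
      by (rule Int_stable_vimage)
  qed
  then have ind: "indep_set (sets (gen_sigma M K W I)) (sets (gen_sigma M K W J))"
    unfolding indep_set_def sets_gen_sigma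
  proof (rule indep_sets_mono_sets)
    fix b :: bool
    show "(case b of True \<Rightarrow> sigma_sets (space M) (\<Union>i\<in>I. ?E i) | False \<Rightarrow> sigma_sets (space M) (\<Union>i\<in>J. ?E i))
      \<subseteq> sigma_sets (space M) (\<Union>i\<in>case_bool I J b. ?E i)"
      by (simp split: bool.split)
  qed
  have fm: "f \<in> measurable M L1" and gm: "g \<in> measurable M L2"
    by (rule measurable_gen_sigma_imp[OF Wm f], simp, rule measurable_gen_sigma_imp[OF Wm g], simp)
  have "indep_set {f -` A \<inter> space M | A. A \<in> sets L1} {g -` A \<inter> space M | A. A \<in> sets L2}"
    using ind unfolding indep_set_def
  proof (rule indep_sets_mono_sets)
    fix b :: bool
    show "(case b of True \<Rightarrow> {f -` A \<inter> space M | A. A \<in> sets L1}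
        | False \<Rightarrow> {g -` A \<inter> space M | A. A \<in> sets L2})
       \<subseteq> (case b of True \<Rightarrow> sets (gen_sigma M K W I) | False \<Rightarrow> sets (gen_sigma M K W J))"
      using measurable_sets[OF f] measurable_sets[OF g] by (auto split: bool.split)
  qed
  then have "indep_set (sigma_sets (space M) {f -` A \<inter> space M | A. A \<in> sets L1})
      (sigma_sets (space M) {g -` A \<inter> space M | A. A \<in> sets L2})"
    by (intro indep_set_sigma_sets Int_stable_vimage)
  then show ?thesis using fm gm by (simp add: indep_var_eq)
qed

section \<open>Sums of independent symmetric variables\<close>

lemma finite_subset_atMost_nat_vec:
  assumes "finite (F :: (nat ^ 'd) set)"
  shows "\<exists>n. F \<subseteq> {..n}"
proof -
  have "k $ i \<le> (\<Sum>k\<in>F. k $ i)" if "k \<in> F" for k i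
    using assms that by (intro member_le_sum) auto
  then have "F \<subseteq> {..\<chi> i. \<Sum>k\<in>F. k $ i}" by (auto simp: less_eq_vec_def)
  then show ?thesis by blast
qed

lemma (in prob_space) abs_expectation_cos_le_1:
  "\<bar>expectation (\<lambda>\<omega>. cos (X \<omega> :: real))\<bar> \<le> 1"
proof (cases "integrable M (\<lambda>\<omega>. cos (X \<omega>))")
  case True
  have "\<bar>expectation (\<lambda>\<omega>. cos (X \<omega>))\<bar> \<le> expectation (\<lambda>\<omega>. \<bar>cos (X \<omega>)\<bar>)"
    by (rule integral_abs_bound)
  also have "\<dots> \<le> expectation (\<lambda>\<omega>. 1)"
    using True by (intro integral_mono) auto
  finally show ?thesis by (simp add: prob_space)
qed (simp add: not_integrable_integral_eq)

text \<open>The sine part is odd and therefore integrates to zero. Real-valuedness is what later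
  permits sign and intermediate value arguments.\<close>

lemma (in prob_space) char_symmetric:
  fixes X :: "'a \<Rightarrow> real"
  assumes [measurable]: "X \<in> borel_measurable M"
    and sym: "distr M borel X = distr M borel (\<lambda>\<omega>. - X \<omega>)"
  shows "char (distr M borel X) s = of_real (expectation (\<lambda>\<omega>. cos (s * X \<omega>)))"
proof -
  have "expectation (\<lambda>\<omega>. sin (s * X \<omega>)) = (\<integral>x. sin (s * x) \<partial>distr M borel X)"
    by (subst integral_distr) auto
  also have "\<dots> = (\<integral>x. sin (s * x) \<partial>distr M borel (\<lambda>\<omega>. - X \<omega>))" by (simp add: sym)
  also have "\<dots> = expectation (\<lambda>\<omega>. - sin (s * X \<omega>))" by (subst integral_distr) auto
  finally have sin0: "expectation (\<lambda>\<omega>. sin (s * X \<omega>)) = 0" by simp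
  have ic: "integrable M (\<lambda>\<omega>. complex_of_real (cos (s * X \<omega>)))"
    and ii: "integrable M (\<lambda>\<omega>. \<i> * complex_of_real (sin (s * X \<omega>)))"
    by (rule integrable_const_bound[where B = 1]; auto simp: norm_mult)+
  have "char (distr M borel X) s = expectation (\<lambda>\<omega>. iexp (s * X \<omega>))"
    unfolding char_def by (subst integral_distr) auto
  also have "\<dots> = expectation (\<lambda>\<omega>. of_real (cos (s * X \<omega>)) + \<i> * of_real (sin (s * X \<omega>)))"
    by (intro Bochner_Integration.integral_cong refl)
       (simp only: cis_conv_exp[symmetric], simp add: complex_eq_iff)
  also have "\<dots> = of_real (expectation (\<lambda>\<omega>. cos (s * X \<omega>))) + \<i> * of_real (expectation (\<lambda>\<omega>. sin (s * X \<omega>)))"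
    using ic ii by simp
  finally show ?thesis using sin0 by simp
qed

text \<open>The real-valued core of the argument. Symmetry is required of the terms
  \<open>g k (W k)\<close>, whereas V and the remainders need only be measurable with respect to the
  W; so W may be a pair (Z, Z') of which g sees the difference.\<close>

locale symmetric_decomposition = prob_space N for N :: "'b measure" +
  fixes K :: "'c measure" and W :: "nat ^ 'd \<Rightarrow> 'b \<Rightarrow> 'c" and g :: "nat ^ 'd \<Rightarrow> 'c \<Rightarrow> real"
    and V :: "'b \<Rightarrow> real" and B :: "nat ^ 'd \<Rightarrow> 'b \<Rightarrow> real"
  assumes indep_W: "indep_vars (\<lambda>_. K) W UNIV"
    and g_meas: "\<And>k. g k \<in> borel_measurable K"
    and U_sym: "\<And>k. distr N borel (\<lambda>\<omega>. g k (W k \<omega>)) = distr N borel (\<lambda>\<omega>. - g k (W k \<omega>))"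
    and V_meas: "V \<in> borel_measurable (gen_sigma N K W UNIV)"
    and V_sym: "distr N borel V = distr N borel (\<lambda>\<omega>. - V \<omega>)"
    and B_meas: "\<And>n. B n \<in> borel_measurable (gen_sigma N K W (- {..n}))"
    and decomp: "\<And>n. AE \<omega> in N. V \<omega> = (\<Sum>k\<in>{..n}. g k (W k \<omega>)) + B n \<omega>"
begin

definition U :: "nat ^ 'd \<Rightarrow> 'b \<Rightarrow> real" where "U k \<omega> = g k (W k \<omega>)"

definition S :: "nat ^ 'd \<Rightarrow> 'b \<Rightarrow> real" where "S n \<omega> = (\<Sum>k\<in>{..n}. U k \<omega>)"

definition cosU :: "nat ^ 'd \<Rightarrow> real \<Rightarrow> real" where "cosU k s = expectation (\<lambda>\<omega>. cos (s * U k \<omega>))"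

lemma W_meas [measurable]: "W k \<in> measurable N K"
  using indep_W by (auto simp: indep_vars_def)

lemma U_gen: "k \<in> I \<Longrightarrow> U k \<in> borel_measurable (gen_sigma N K W I)"
  unfolding U_def[abs_def] by (rule measurable_compose[OF gen_sigma_component[OF W_meas] g_meas])

lemma U_meas [measurable]: "U k \<in> borel_measurable N"
  unfolding U_def[abs_def] by (rule measurable_compose[OF W_meas g_meas])

lemma S_gen: "{..n} \<subseteq> I \<Longrightarrow> S n \<in> borel_measurable (gen_sigma N K W I)"
  unfolding S_def[abs_def] by (intro borel_measurable_sum U_gen) auto

lemma S_meas [measurable]: "S n \<in> borel_measurable N"
  unfolding S_def[abs_def] by measurable

lemma V_meas' [measurable]: "V \<in> borel_measurable N"
  by (rule measurable_gen_sigma_imp[OF _ V_meas]) simp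

lemma B_meas' [measurable]: "B n \<in> borel_measurable N"
  by (rule measurable_gen_sigma_imp[OF _ B_meas]) simp

lemma indep_U: "indep_vars (\<lambda>_. borel) U UNIV"
  unfolding U_def[abs_def] using indep_W g_meas by (rule indep_vars_compose2)

lemma U_symmetric: "distr N borel (U k) = distr N borel (\<lambda>\<omega>. - U k \<omega>)"
  using U_sym unfolding U_def[abs_def] .

lemma char_U: "char (distr N borel (U k)) s = of_real (cosU k s)"
  unfolding cosU_def by (rule char_symmetric[OF U_meas U_symmetric])

lemma char_sum_U: "char (distr N borel (\<lambda>\<omega>. \<Sum>k\<in>F. U k \<omega>)) s = of_real (\<Prod>k\<in>F. cosU k s)"
  by (subst char_distr_sum) (auto simp: char_U intro: indep_vars_subset[OF indep_U])

lemma char_S: "char (distr N borel (S n)) s = of_real (\<Prod>k\<in>{..n}. cosU k s)"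
  using char_sum_U[of "{..n}" s] by (simp add: S_def[abs_def])

lemma expectation_cos_sum_U: "expectation (\<lambda>\<omega>. cos (s * (\<Sum>k\<in>F. U k \<omega>))) = (\<Prod>k\<in>F. cosU k s)"
proof -
  have "expectation (\<lambda>\<omega>. cos (s * (\<Sum>k\<in>F. U k \<omega>))) = Re (char (distr N borel (\<lambda>\<omega>. \<Sum>k\<in>F. U k \<omega>)) s)"
  proof -
    have "char (distr N borel (\<lambda>\<omega>. \<Sum>k\<in>F. U k \<omega>)) s = expectation (\<lambda>\<omega>. iexp (s * (\<Sum>k\<in>F. U k \<omega>)))"
      unfolding char_def by (subst integral_distr) auto
    also have "Re \<dots> = expectation (\<lambda>\<omega>. Re (iexp (s * (\<Sum>k\<in>F. U k \<omega>))))"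
      by (rule integral_Re[symmetric], rule integrable_iexp; simp)
    finally show ?thesis by (simp only: cis_conv_exp[symmetric] cis.sel)
  qed
  then show ?thesis by (simp add: char_sum_U del: of_real_prod)
qed

lemma cosU_le_1: "\<bar>cosU k s\<bar> \<le> 1"
  unfolding cosU_def by (rule abs_expectation_cos_le_1)

text \<open>The sum uses innovations inside the rectangle and the remainder those outside, so their
  characteristic functions multiply. Domination of V by its partial sums rests on this
  factorization.\<close>

lemma char_V: "char (distr N borel V) s = char (distr N borel (S n)) s * char (distr N borel (B n)) s"
proof -
  have "distr N borel V = distr N borel (\<lambda>\<omega>. S n \<omega> + B n \<omega>)"
  proof (rule distr_cong_AE)
    show "AE \<omega> in N. V \<omega> = S n \<omega> + B n \<omega>" using decomp[of n] by (simp add: S_def U_def)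
  qed auto
  moreover have "indep_var borel (S n) borel (B n)"
    by (rule indep_var_gen_sigma[OF indep_W _ _ S_gen[OF order_refl] B_meas]) auto
  ultimately show ?thesis using char_distr_add[of "S n" "B n" s] by simp
qed

text \<open>A frequency range on which the characteristic function of V, real by symmetry, stays
  away from 0. Continuity at the origin supplies one; the level 1/2 is a convenient choice.\<close>

definition good_radius :: "real \<Rightarrow> bool" where
  "good_radius \<delta> \<longleftrightarrow> \<delta> > 0 \<and> (\<forall>s. \<bar>s\<bar> \<le> \<delta> \<longrightarrow> expectation (\<lambda>\<omega>. cos (s * V \<omega>)) \<ge> 1 / 2)"

lemma ex_good_radius: "\<exists>\<delta>. good_radius \<delta>"
proof -
  interpret D: real_distribution "distr N borel V" by simp
  have "isCont (\<lambda>s. Re (char (distr N borel V) s)) 0"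
    by (intro isCont_Re D.isCont_char)
  then have c: "isCont (\<lambda>s. expectation (\<lambda>\<omega>. cos (s * V \<omega>))) 0"
    by (simp add: char_symmetric[OF V_meas' V_sym])
  then have "\<exists>d>0. \<forall>s. \<bar>s\<bar> < d \<longrightarrow> \<bar>expectation (\<lambda>\<omega>. cos (s * V \<omega>)) - 1\<bar> < 1 / 2"
    unfolding continuous_at_eps_delta
    by (elim allE[of _ "1 / 2"]) (simp add: dist_real_def prob_space)
  then obtain d where d: "d > 0" "\<And>s. \<bar>s\<bar> < d \<Longrightarrow> \<bar>expectation (\<lambda>\<omega>. cos (s * V \<omega>)) - 1\<bar> < 1 / 2"
    by blast
  show ?thesis unfolding good_radius_def
  proof (intro exI[of _ "d / 2"] conjI allI impI)
    fix s assume "\<bar>s\<bar> \<le> d / 2"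
    then have "\<bar>s\<bar> < d" using d(1) by linarith
    from d(2)[OF this] show "expectation (\<lambda>\<omega>. cos (s * V \<omega>)) \<ge> 1 / 2" by linarith
  qed (use d in simp)
qed

context
  fixes \<delta> s :: real
  assumes gr: "good_radius \<delta>" and s: "\<bar>s\<bar> \<le> \<delta>"
begin

text \<open>Enclose F in a rectangle, drop the remainder factor of modulus at most 1, then drop the
  factors outside F. The frequency r is separate from s because \<open>cosU_ge\<close> needs the
  bound along the whole segment from 0 to s.\<close>

lemma prod_cosU_ge_abs:
  assumes "\<bar>r\<bar> \<le> \<delta>" "finite F"
  shows "(\<Prod>k\<in>F. \<bar>cosU k r\<bar>) \<ge> 1 / 2"
proof -
  obtain n where n: "F \<subseteq> {..n}" using finite_subset_atMost_nat_vec[OF \<open>finite F\<close>] by auto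
  interpret D: real_distribution "distr N borel (B n)" by simp
  have "1 / 2 \<le> cmod (char (distr N borel V) r)"
    using gr assms(1) by (auto simp: good_radius_def char_symmetric[OF V_meas' V_sym] intro: order.trans)
  also have "\<dots> = (\<Prod>k\<in>{..n}. \<bar>cosU k r\<bar>) * cmod (char (distr N borel (B n)) r)"
    by (simp only: char_V[of r n] char_S norm_mult norm_of_real abs_prod)
  also have "\<dots> \<le> (\<Prod>k\<in>{..n}. \<bar>cosU k r\<bar>) * 1"
    by (intro mult_left_mono D.cmod_char_le_1 prod_nonneg) auto
  also have "\<dots> = (\<Prod>k\<in>F. \<bar>cosU k r\<bar>) * (\<Prod>k\<in>{..n} - F. \<bar>cosU k r\<bar>)"
    by (subst prod.subset_diff[OF n]) (auto simp: mult.commute)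
  also have "\<dots> \<le> (\<Prod>k\<in>F. \<bar>cosU k r\<bar>) * 1"
    by (intro mult_left_mono prod_le_1 prod_nonneg) (auto simp: cosU_le_1)
  finally show ?thesis by simp
qed

text \<open>Only the absolute value is bounded below so far. A negative value at s would force, by
  the intermediate value theorem between 0 and s, a zero at a frequency where the absolute value is
  at least 1/2.\<close>

lemma cosU_ge: "cosU k s \<ge> 1 / 2"
proof (rule ccontr)
  assume "\<not> cosU k s \<ge> 1 / 2"
  moreover have abs: "\<bar>cosU k r\<bar> \<ge> 1 / 2" if "\<bar>r\<bar> \<le> \<delta>" for r
    using prod_cosU_ge_abs[OF that, of "{k}"] by simp
  ultimately have neg: "cosU k s \<le> 0" using abs[OF s] by linarith
  interpret D: real_distribution "distr N borel (U k)" by simp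
  have cont: "isCont (cosU k) r" for r
  proof -
    have "isCont (\<lambda>r. Re (char (distr N borel (U k)) r)) r"
      by (intro isCont_Re D.isCont_char)
    then show ?thesis by (simp add: char_U)
  qed
  have "continuous_on {0..1} (\<lambda>t. cosU k (t * s))"
    by (intro continuous_at_imp_continuous_on ballI isCont_o2[OF _ cont] continuous_intros)
  moreover have "cosU k (0 * s) \<ge> 0" by (simp add: cosU_def)
  ultimately obtain t where t: "t \<ge> 0" "t \<le> 1" "cosU k (t * s) = 0"
    using IVT2'[of "\<lambda>t. cosU k (t * s)" 1 0 0] neg by auto
  have "\<bar>t * s\<bar> \<le> 1 * \<delta>" unfolding abs_mult using t s by (intro mult_mono) auto
  then show False using abs[of "t * s"] t(3) by simp
qed

lemma prod_cosU_ge: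
  assumes "finite F" shows "(\<Prod>k\<in>F. cosU k s) \<ge> 1 / 2"
proof -
  have "\<bar>cosU k s\<bar> = cosU k s" for k using cosU_ge[of k] by simp
  then show ?thesis using prod_cosU_ge_abs[OF s assms] by simp
qed

text \<open>From x \<le> exp (-(1 - x)) the product bound 1/2 yields exp of the sum at most 2; then
  1 + y \<le> exp y gives the bound 1, uniformly in F.\<close>

lemma sum_one_minus_cosU_le:
  assumes "finite F" shows "(\<Sum>k\<in>F. 1 - cosU k s) \<le> 1"
proof -
  have "1 / 2 \<le> (\<Prod>k\<in>F. cosU k s)" by (rule prod_cosU_ge[OF assms])
  also have "\<dots> \<le> (\<Prod>k\<in>F. exp (- (1 - cosU k s)))"
  proof (intro prod_mono conjI)
    fix k
    show "0 \<le> cosU k s" using cosU_ge[of k] by simp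
    show "cosU k s \<le> exp (- (1 - cosU k s))" using exp_ge_add_one_self[of "- (1 - cosU k s)"] by simp
  qed
  also have "\<dots> = exp (- (\<Sum>k\<in>F. 1 - cosU k s))"
    using assms by (simp add: exp_sum[symmetric] sum_negf[symmetric])
  finally have "exp (\<Sum>k\<in>F. 1 - cosU k s) \<le> 2" by (simp add: exp_minus field_simps)
  then show ?thesis using exp_ge_add_one_self[of "\<Sum>k\<in>F. 1 - cosU k s"] by linarith
qed

text \<open>Bernoulli's inequality for factors in [0,1]; it goes in the opposite direction to the
  previous bound, from single terms back to a finite sum. The induction also carries that the
  product is at most 1.\<close>

lemma one_minus_prod_cosU_le:
  assumes "finite F" shows "1 - (\<Prod>k\<in>F. cosU k s) \<le> (\<Sum>k\<in>F. 1 - cosU k s)"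
proof -
  have "1 - (\<Prod>k\<in>F. cosU k s) \<le> (\<Sum>k\<in>F. 1 - cosU k s) \<and> (\<Prod>k\<in>F. cosU k s) \<le> 1"
    using assms
  proof (induction F rule: finite_induct)
    case (insert k F)
    have c: "0 \<le> cosU k s" "cosU k s \<le> 1" using cosU_ge[of k] cosU_le_1[of k s] by auto
    have p: "(\<Prod>k\<in>F. cosU k s) \<ge> 0" using prod_cosU_ge[OF insert.hyps(1)] by linarith
    have "cosU k s * (1 - (\<Prod>k\<in>F. cosU k s)) \<le> 1 * (1 - (\<Prod>k\<in>F. cosU k s))"
      using c insert.IH by (intro mult_right_mono) auto
    moreover have "cosU k s * (\<Prod>k\<in>F. cosU k s) \<le> 1 * 1"
      using c insert.IH p by (intro mult_mono) auto
    ultimately show ?case using insert by (simp add: algebra_simps)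
  qed simp
  then show ?thesis ..
qed

end

end

text \<open>The sets over which h integrates to zero form a Dynkin system, so they include the whole
  generated sigma-algebra, in particular the sets where h is positive and where h is
  negative.\<close>

lemma (in prob_space) AE_zero_if_integrals_zero:
  fixes h :: "'a \<Rightarrow> real"
  assumes E: "Int_stable E" "space M \<in> E" "E \<subseteq> events"
    and h: "h \<in> borel_measurable (sigma (space M) E)" "integrable M h"
    and zero: "\<And>F. F \<in> E \<Longrightarrow> expectation (\<lambda>\<omega>. indicator F \<omega> * h \<omega>) = 0"
  shows "AE \<omega> in M. h \<omega> = 0"
proof -
  have Pow: "E \<subseteq> Pow (space M)" using E(3) sets.sets_into_space by auto
  have sub: "sigma_sets (space M) E \<subseteq> events" using E(3) by (rule sets.sigma_sets_subset)
  have int: "integrable M (\<lambda>\<omega>. indicator F \<omega> * h \<omega>)" if "F \<in> events" for F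
    using integrable_real_mult_indicator[OF that h(2)] by (simp add: mult.commute)
  have *: "expectation (\<lambda>\<omega>. indicator F \<omega> * h \<omega>) = 0" if F: "F \<in> sigma_sets (space M) E" for F
    using E(1) Pow F
  proof (induction rule: sigma_sets_induct_disjoint)
    case (basic A) then show ?case by (rule zero)
  next
    case empty show ?case by simp
  next
    case (compl A)
    then have A: "A \<in> events" using sub by auto
    have "expectation (\<lambda>\<omega>. indicator (space M - A) \<omega> * h \<omega>) =
        expectation (\<lambda>\<omega>. indicator (space M) \<omega> * h \<omega> - indicator A \<omega> * h \<omega>)"
      by (intro Bochner_Integration.integral_cong) (auto simp: indicator_def)
    then show ?case using compl zero[OF E(2)] int[OF A] int[OF sets.top] by simp
  next
    case (union A)
    then have A: "A i \<in> events" for i using sub by auto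
    have "set_lebesgue_integral M (\<Union>i. A i) h = (\<Sum>i. set_lebesgue_integral M (A i) h)"
    proof (rule lebesgue_integral_countable_add)
      show "set_integrable M (\<Union>i. A i) h"
        unfolding set_integrable_def using A h(2) by (intro integrable_mult_indicator) auto
    qed (use union A in \<open>auto simp: disjoint_family_on_def\<close>)
    then show ?case using union.IH by (simp add: set_lebesgue_integral_def)
  qed
  have h_set: "{\<omega> \<in> space M. h \<omega> > 0} \<in> sigma_sets (space M) E" "{\<omega> \<in> space M. h \<omega> < 0} \<in> sigma_sets (space M) E"
  proof -
    have "{\<omega> \<in> space (sigma (space M) E). h \<omega> > 0} \<in> sets (sigma (space M) E)"
      "{\<omega> \<in> space (sigma (space M) E). h \<omega> < 0} \<in> sets (sigma (space M) E)" using h(1) by measurable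
    then show "{\<omega> \<in> space M. h \<omega> > 0} \<in> sigma_sets (space M) E" "{\<omega> \<in> space M. h \<omega> < 0} \<in> sigma_sets (space M) E"
      using Pow by (simp_all add: space_measure_of_conv)
  qed
  have "AE \<omega> in M. indicator {\<omega> \<in> space M. h \<omega> > 0} \<omega> * h \<omega> = 0"
  proof (subst integral_nonneg_eq_0_iff_AE[symmetric])
    show "integrable M (\<lambda>\<omega>. indicator {\<omega> \<in> space M. h \<omega> > 0} \<omega> * h \<omega>)"
      using int[of "{\<omega> \<in> space M. h \<omega> > 0}"] h_set(1) sub by auto
  qed (use *[OF h_set(1)] in \<open>auto simp: indicator_def\<close>)
  moreover have "AE \<omega> in M. indicator {\<omega> \<in> space M. h \<omega> < 0} \<omega> * - h \<omega> = 0"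
  proof (subst integral_nonneg_eq_0_iff_AE[symmetric])
    show "integrable M (\<lambda>\<omega>. indicator {\<omega> \<in> space M. h \<omega> < 0} \<omega> * - h \<omega>)"
      using int[of "{\<omega> \<in> space M. h \<omega> < 0}"] h_set(2) sub by (auto simp del: integrable_mult_indicator)
  qed (use *[OF h_set(2)] in \<open>auto simp: indicator_def\<close>)
  ultimately show ?thesis
    using AE_space by eventually_elim (auto simp: indicator_def split: if_splits)
qed

text \<open>Countably many small frequencies separate points, which allows the exceptional null sets
  to be united. If a and b differ and j + 1 exceeds \<delta> times their distance, the phase
  difference has absolute value strictly between 0 and 1, where the sine does not vanish.\<close>

lemma iexp_eq_imp_eq:
  fixes a b \<delta> :: real
  assumes "\<delta> > 0" and eq: "\<And>j :: nat. iexp (\<delta> / real (Suc j) * a) = iexp (\<delta> / real (Suc j) * b)"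
  shows "a = b"
proof (rule ccontr)
  assume "a \<noteq> b"
  define t where "t = \<delta> * \<bar>a - b\<bar>"
  have t: "t > 0" using \<open>a \<noteq> b\<close> assms(1) by (simp add: t_def)
  obtain j :: nat where j: "t < real (Suc j)" using reals_Archimedean2[of t] by (metis less_trans lessI of_nat_less_iff)
  define u where "u = \<delta> / real (Suc j) * a - \<delta> / real (Suc j) * b"
  have "iexp u = 1"
    using eq[of j] by (simp only: u_def of_real_diff right_diff_distrib exp_diff) simp
  then have "sin u = 0" by (simp only: cis_conv_exp[symmetric]) (simp add: complex_eq_iff)
  then have "sin \<bar>u\<bar> = 0" by (auto simp: abs_if)
  moreover have u: "\<bar>u\<bar> = t / real (Suc j)"
  proof -
    have u': "u = \<delta> / real (Suc j) * (a - b)" by (simp add: u_def right_diff_distrib)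
    have "\<bar>u\<bar> = \<bar>\<delta> / real (Suc j)\<bar> * \<bar>a - b\<bar>" by (simp only: u' abs_mult)
    also have "\<bar>\<delta> / real (Suc j)\<bar> = \<delta> / real (Suc j)" using assms(1) by simp
    finally show ?thesis by (simp only: t_def times_divide_eq_left)
  qed
  have "0 < \<bar>u\<bar>" "\<bar>u\<bar> < 1" using t j unfolding u by (auto simp: field_simps simp del: of_nat_Suc)
  then have "sin \<bar>u\<bar> > 0" using pi_gt3 by (intro sin_gt_zero) auto
  ultimately show False by simp
qed

text \<open>The joint law is the product of the marginals, and each marginal is invariant under a
  change of sign. This supplies the invariance hypothesis of the rectangular Levy
  inequality.\<close>

lemma (in prob_space) distr_flip_eq:
  fixes X :: "'i \<Rightarrow> 'a \<Rightarrow> real"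
  assumes ind: "indep_vars (\<lambda>_. borel) X UNIV"
    and sym: "\<And>k. distr M borel (X k) = distr M borel (\<lambda>\<omega>. - X k \<omega>)"
  shows "distr (distr M (Pi\<^sub>M UNIV (\<lambda>_. borel)) (\<lambda>\<omega> k. X k \<omega>)) (distr M (Pi\<^sub>M UNIV (\<lambda>_. borel)) (\<lambda>\<omega> k. X k \<omega>))
      (\<lambda>x k. if k \<in> F then - x k else x k) = distr M (Pi\<^sub>M UNIV (\<lambda>_. borel)) (\<lambda>\<omega> k. X k \<omega>)"
    (is "distr ?D ?D ?T = ?D")
proof -
  let ?P = "Pi\<^sub>M UNIV (\<lambda>_. borel) :: ('i \<Rightarrow> real) measure"
  let ?Y = "\<lambda>k \<omega>. if k \<in> F then - X k \<omega> else X k \<omega>"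
  have [measurable]: "X k \<in> borel_measurable M" for k using ind by (auto simp: indep_vars_def)
  have indY: "indep_vars (\<lambda>_. borel) ?Y UNIV"
  proof -
    have "indep_vars (\<lambda>_. borel) (\<lambda>k \<omega>. (if k \<in> F then uminus else id) (X k \<omega>)) UNIV"
      using ind by (rule indep_vars_compose2) auto
    moreover have "(\<lambda>k \<omega>. (if k \<in> F then uminus else id) (X k \<omega>)) = ?Y" by (auto simp: fun_eq_iff)
    ultimately show ?thesis by simp
  qed
  have Ym[measurable]: "?Y k \<in> borel_measurable M" for k by (cases "k \<in> F") auto
  have DX: "?D = Pi\<^sub>M UNIV (\<lambda>k. distr M borel (X k))"
    using ind indep_vars_iff_distr_eq_PiM'[of UNIV X "\<lambda>_. borel"] by (simp add: restrict_UNIV)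
  have DY: "distr M ?P (\<lambda>\<omega> k. ?Y k \<omega>) = Pi\<^sub>M UNIV (\<lambda>k. distr M borel (?Y k))"
    using indY indep_vars_iff_distr_eq_PiM'[of UNIV ?Y "\<lambda>_. borel"] Ym by (simp add: restrict_UNIV)
  have marg: "distr M borel (?Y k) = distr M borel (X k)" for k
    using sym[of k] by (cases "k \<in> F") auto
  have Xm: "(\<lambda>\<omega> k. X k \<omega>) \<in> measurable M ?P" by (rule measurable_PiM_single') auto
  have Tm: "?T \<in> measurable ?P ?P" by (rule measurable_PiM_single') auto
  have "distr ?D ?D ?T = distr ?D ?P ?T" by (rule distr_cong) auto
  also have "\<dots> = distr M ?P (?T \<circ> (\<lambda>\<omega> k. X k \<omega>))" by (rule distr_distr[OF Tm Xm])
  also have "?T \<circ> (\<lambda>\<omega> k. X k \<omega>) = (\<lambda>\<omega> k. ?Y k \<omega>)" by (auto simp: fun_eq_iff)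
  finally show ?thesis unfolding DY marg DX .
qed

section \<open>Averaged gaps as a substitute for variances\<close>

context symmetric_decomposition
begin

definition gap :: "real \<Rightarrow> nat ^ 'd \<Rightarrow> real" where
  "gap \<delta> k = expectation (\<lambda>\<omega>. sinc_gap (\<delta> * U k \<omega>))"

text \<open>Integrate the inequalities for \<open>1 - cosU\<close> over the frequencies s * \<delta>
  with s in [0,1], all of which lie in the good range. The first bound makes the gaps summable; the
  second lets them control sums of the terms, as variances would.\<close>

lemma
  assumes gr: "good_radius \<delta>" and F: "finite F"
  shows sum_gap_le_1: "(\<Sum>k\<in>F. gap \<delta> k) \<le> 1"
    and gap_sum_le: "expectation (\<lambda>\<omega>. sinc_gap (\<delta> * (\<Sum>k\<in>F. U k \<omega>))) \<le> (\<Sum>k\<in>F. gap \<delta> k)"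
proof -
  interpret R: prob_space unit_interval by (rule prob_space_unit_interval)
  have eq: "expectation (\<lambda>\<omega>. cos (s * (\<delta> * U k \<omega>))) = cosU k (s * \<delta>)" for s k
    by (simp add: cosU_def mult.assoc)
  have eqs: "expectation (\<lambda>\<omega>. cos (s * (\<delta> * (\<Sum>k\<in>F. U k \<omega>)))) = (\<Prod>k\<in>F. cosU k (s * \<delta>))" for s
    using expectation_cos_sum_U[of "s * \<delta>" F] by (simp add: mult.assoc)
  have small: "\<bar>s * \<delta>\<bar> \<le> \<delta>" if "s \<in> space unit_interval" for s
    using that gr by (auto simp: space_restrict_space abs_mult good_radius_def intro: mult_left_le_one_le)
  have int: "integrable unit_interval (\<lambda>s. 1 - cosU k (s * \<delta>))" for k
    using integrable_one_minus_cos[of "\<lambda>\<omega>. \<delta> * U k \<omega>"] by (simp add: eq)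
  have gap: "gap \<delta> k = (LINT s|unit_interval. 1 - cosU k (s * \<delta>))" for k
    using integral_one_minus_cos[of "\<lambda>\<omega>. \<delta> * U k \<omega>"] by (simp add: eq gap_def)
  have sum_gap: "(\<Sum>k\<in>F. gap \<delta> k) = (LINT s|unit_interval. (\<Sum>k\<in>F. 1 - cosU k (s * \<delta>)))"
    unfolding gap using int by (intro Bochner_Integration.integral_sum[symmetric]) auto
  also have "\<dots> \<le> (LINT s|unit_interval. 1)"
    using int F by (intro integral_mono sum_one_minus_cosU_le[OF gr small]) auto
  finally show "(\<Sum>k\<in>F. gap \<delta> k) \<le> 1" using R.prob_space by simp
  have "expectation (\<lambda>\<omega>. sinc_gap (\<delta> * (\<Sum>k\<in>F. U k \<omega>))) =
      (LINT s|unit_interval. 1 - (\<Prod>k\<in>F. cosU k (s * \<delta>)))"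
    using integral_one_minus_cos[of "\<lambda>\<omega>. \<delta> * (\<Sum>k\<in>F. U k \<omega>)"] by (simp add: eqs)
  also have "\<dots> \<le> (LINT s|unit_interval. (\<Sum>k\<in>F. 1 - cosU k (s * \<delta>)))"
  proof (rule integral_mono)
    show "integrable unit_interval (\<lambda>s. 1 - (\<Prod>k\<in>F. cosU k (s * \<delta>)))"
      using integrable_one_minus_cos[of "\<lambda>\<omega>. \<delta> * (\<Sum>k\<in>F. U k \<omega>)"] by (simp add: eqs)
  qed (use int F in \<open>auto intro!: one_minus_prod_cosU_le[OF gr small]\<close>)
  finally show "expectation (\<lambda>\<omega>. sinc_gap (\<delta> * (\<Sum>k\<in>F. U k \<omega>))) \<le> (\<Sum>k\<in>F. gap \<delta> k)"
    unfolding sum_gap .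
qed

text \<open>Chebyshev's inequality with \<open>sinc_gap\<close> in place of the square. The factor 8
  and the minimum come from the lower bound on \<open>sinc_gap\<close>.\<close>

lemma prob_sum_U_gt_le:
  assumes gr: "good_radius \<delta>" and F: "finite F" and \<epsilon>: "\<epsilon> > 0"
  shows "prob {\<omega> \<in> space N. \<bar>\<Sum>k\<in>F. U k \<omega>\<bar> > \<epsilon>} \<le> 8 / min 1 ((\<delta> * \<epsilon>)\<^sup>2) * (\<Sum>k\<in>F. gap \<delta> k)"
proof -
  define \<kappa> where "\<kappa> = min 1 ((\<delta> * \<epsilon>)\<^sup>2) / 8"
  have \<delta>: "\<delta> > 0" using gr by (simp add: good_radius_def)
  have \<kappa>: "\<kappa> > 0" using \<delta> \<epsilon> by (simp add: \<kappa>_def)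
  let ?E = "{\<omega> \<in> space N. \<bar>\<Sum>k\<in>F. U k \<omega>\<bar> > \<epsilon>}"
  have "prob ?E * \<kappa> = expectation (\<lambda>\<omega>. indicator ?E \<omega> * \<kappa>)" by simp
  also have "\<dots> \<le> expectation (\<lambda>\<omega>. sinc_gap (\<delta> * (\<Sum>k\<in>F. U k \<omega>)))"
  proof (rule integral_mono)
    show "integrable N (\<lambda>\<omega>. indicator ?E \<omega> * \<kappa>)"
      by (rule integrable_const_bound[where B = \<kappa>]) (use \<kappa> in \<open>auto simp: indicator_def\<close>)
    show "integrable N (\<lambda>\<omega>. sinc_gap (\<delta> * (\<Sum>k\<in>F. U k \<omega>)))"
      by (rule integrable_const_bound[where B = 2]) (auto simp: sinc_gap_nonneg sinc_gap_le)
    fix \<omega> assume "\<omega> \<in> space N"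
    show "indicator ?E \<omega> * \<kappa> \<le> sinc_gap (\<delta> * (\<Sum>k\<in>F. U k \<omega>))"
    proof (cases "\<omega> \<in> ?E")
      case True
      then have "\<epsilon> \<le> \<bar>\<Sum>k\<in>F. U k \<omega>\<bar>" by simp
      then have "\<delta> * \<epsilon> \<le> \<bar>\<delta> * (\<Sum>k\<in>F. U k \<omega>)\<bar>" using \<delta> by (simp add: abs_mult)
      then have "(\<delta> * \<epsilon>)\<^sup>2 \<le> (\<delta> * (\<Sum>k\<in>F. U k \<omega>))\<^sup>2"
        using \<delta> \<epsilon> by (metis abs_le_square_iff abs_of_pos mult_pos_pos)
      then have "min 1 ((\<delta> * \<epsilon>)\<^sup>2) \<le> min 1 ((\<delta> * (\<Sum>k\<in>F. U k \<omega>))\<^sup>2)" by (rule min.mono[OF order_refl])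
      then have "\<kappa> \<le> sinc_gap (\<delta> * (\<Sum>k\<in>F. U k \<omega>))"
        using sinc_gap_lower[of "\<delta> * (\<Sum>k\<in>F. U k \<omega>)"] unfolding \<kappa>_def by linarith
      then show ?thesis using True by simp
    qed (simp add: sinc_gap_nonneg)
  qed
  also have "\<dots> \<le> (\<Sum>k\<in>F. gap \<delta> k)" by (rule gap_sum_le[OF gr F])
  finally show ?thesis using \<kappa> by (simp add: \<kappa>_def field_simps)
qed

text \<open>A difference of two rectangles need not be a rectangle. Replacing the terms inside
  \<open>{..m}\<close> by 0 preserves independence and symmetry and turns the sum into one over a
  full rectangle; with all coordinates free, Levy's inequality contributes 2 to the
  dimension.\<close>

lemma levy_tail:
  "prob {\<omega> \<in> space N. \<exists>n\<le>L. \<bar>\<Sum>k\<in>{..n} - {..m}. U k \<omega>\<bar> > \<epsilon>}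
    \<le> 2 ^ CARD('d) * prob {\<omega> \<in> space N. \<bar>\<Sum>k\<in>{..L} - {..m}. U k \<omega>\<bar> > \<epsilon>}"
proof -
  define X where "X k \<omega> = (if k \<in> {..m} then 0 else U k \<omega>)" for k \<omega>
  let ?P = "Pi\<^sub>M UNIV (\<lambda>_. borel) :: (nat ^ 'd \<Rightarrow> real) measure"
  let ?D = "distr N ?P (\<lambda>\<omega> k. X k \<omega>)"
  have indX: "indep_vars (\<lambda>_. borel) X UNIV"
  proof -
    have "indep_vars (\<lambda>_. borel) (\<lambda>k \<omega>. (if k \<in> {..m} then (\<lambda>_. 0) else id) (U k \<omega>)) UNIV"
      using indep_U by (rule indep_vars_compose2) auto
    moreover have "(\<lambda>k \<omega>. (if k \<in> {..m} then (\<lambda>_. 0) else id) (U k \<omega>)) = X" by (auto simp: fun_eq_iff X_def)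
    ultimately show ?thesis by simp
  qed
  have symX: "distr N borel (X k) = distr N borel (\<lambda>\<omega>. - X k \<omega>)" for k
    using U_symmetric[of k] by (cases "k \<in> {..m}") (auto simp: X_def[abs_def])
  have [measurable]: "X k \<in> borel_measurable N" for k using indX by (auto simp: indep_vars_def)
  have Xm[measurable]: "(\<lambda>\<omega> k. X k \<omega>) \<in> measurable N ?P" by (rule measurable_PiM_single') auto
  have sumX: "(\<Sum>k\<in>{..n}. X k \<omega>) = (\<Sum>k\<in>{..n} - {..m}. U k \<omega>)" for n \<omega>
    by (intro sum.mono_neutral_cong_right) (auto simp: X_def)
  have fl: "finite {n. n \<le> L}" using finite_atMost_nat_vec[of L] by (simp add: atMost_def)
  have "measure ?D {x \<in> space ?D. \<exists>n\<le>L. (\<forall>i. i \<notin> (UNIV :: 'd set) \<longrightarrow> n $ i = L $ i) \<and> \<bar>\<Sum>k\<in>{..n}. x k\<bar> > \<epsilon>}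
      \<le> 2 ^ CARD('d) * measure ?D {x \<in> space ?D. \<bar>\<Sum>k\<in>{..L}. x k\<bar> > \<epsilon>}"
    by (rule levy_maximal_inequality_rectangular)
       (auto intro: prob_space_distr distr_flip_eq[OF indX symX])
  moreover have "measure ?D {x \<in> space ?D. \<exists>n\<le>L. (\<forall>i. i \<notin> (UNIV :: 'd set) \<longrightarrow> n $ i = L $ i) \<and> \<bar>\<Sum>k\<in>{..n}. x k\<bar> > \<epsilon>}
      = prob {\<omega> \<in> space N. \<exists>n\<le>L. \<bar>\<Sum>k\<in>{..n} - {..m}. U k \<omega>\<bar> > \<epsilon>}"
  proof -
    have "{x \<in> space ?P. \<exists>n\<le>L. \<bar>\<Sum>k\<in>{..n}. x k\<bar> > \<epsilon>} =
        (\<Union>n\<in>{n. n \<le> L}. {x \<in> space ?P. \<bar>\<Sum>k\<in>{..n}. x k\<bar> > \<epsilon>})" by auto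
    also have "\<dots> \<in> sets ?P" using fl by (intro sets.finite_UN) auto
    finally have "{x \<in> space ?P. \<exists>n\<le>L. \<bar>\<Sum>k\<in>{..n}. x k\<bar> > \<epsilon>} \<in> sets ?P" .
    then show ?thesis
      by (simp, subst measure_distr) (auto simp: sumX space_PiM intro!: arg_cong[where f = prob])
  qed
  moreover have "measure ?D {x \<in> space ?D. \<bar>\<Sum>k\<in>{..L}. x k\<bar> > \<epsilon>}
      = prob {\<omega> \<in> space N. \<bar>\<Sum>k\<in>{..L} - {..m}. U k \<omega>\<bar> > \<epsilon>}"
  proof -
    have "{x \<in> space ?P. \<bar>\<Sum>k\<in>{..L}. x k\<bar> > \<epsilon>} \<in> sets ?P" by measurable
    then show ?thesis
      by (simp, subst measure_distr) (auto simp: sumX space_PiM intro!: arg_cong[where f = prob])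
  qed
  ultimately show ?thesis by simp
qed

end

section \<open>Almost sure convergence along rectangles\<close>

definition diag_vec :: "nat \<Rightarrow> nat ^ 'd" where "diag_vec j = (\<chi> i. j)"

lemma diag_vec_mono: "i \<le> j \<Longrightarrow> diag_vec i \<le> diag_vec j"
  by (simp add: diag_vec_def less_eq_vec_def)

text \<open>Cubes are cofinal among multi-indices, so a single increasing sequence can replace the
  directed set of all rectangles.\<close>

lemma ex_le_diag_vec: "\<exists>j. m \<le> diag_vec j"
proof -
  have "m $ i \<le> Max (range (\<lambda>i. m $ i))" for i by (intro Max_ge) auto
  then show ?thesis
    by (intro exI[of _ "Max (range (\<lambda>i. m $ i))"]) (simp add: diag_vec_def less_eq_vec_def)
qed

lemma eventually_ge_if_Min_tendsto:
  fixes N :: "nat \<Rightarrow> nat ^ 'd"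
  assumes "filterlim (\<lambda>k. Min (range (\<lambda>i. N k $ i))) at_top sequentially"
  shows "eventually (\<lambda>k. m \<le> N k) sequentially"
proof -
  obtain j where j: "m \<le> diag_vec j" using ex_le_diag_vec by blast
  have "eventually (\<lambda>k. j \<le> Min (range (\<lambda>i. N k $ i))) sequentially"
    using assms by (simp add: filterlim_at_top)
  then show ?thesis
  proof eventually_elim
    case (elim k)
    then have "diag_vec j \<le> N k" by (auto simp: diag_vec_def less_eq_vec_def)
    with j show ?case by (rule order.trans)
  qed
qed

lemma Min_diag_vec_tendsto:
  "filterlim (\<lambda>k. Min (range (\<lambda>i. (diag_vec k :: nat ^ 'd) $ i))) at_top sequentially"
  by (simp add: diag_vec_def filterlim_ident)

context symmetric_decomposition
begin

text \<open>Choose a finite F0 whose gap sum is within \<eta> of the supremum over all finite sets.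
  A set disjoint from a cube containing F0 can only add less than \<eta>.\<close>

lemma tail_gap_small:
  assumes gr: "good_radius \<delta>" and \<eta>: "\<eta> > 0"
  shows "\<exists>j. \<forall>F. finite F \<longrightarrow> F \<inter> {..diag_vec j} = {} \<longrightarrow> (\<Sum>k\<in>F. gap \<delta> k) < \<eta>"
proof -
  let ?T = "SUP F\<in>Collect finite. (\<Sum>k\<in>F. gap \<delta> k)"
  have bdd: "bdd_above ((\<lambda>F. \<Sum>k\<in>F. gap \<delta> k) ` Collect finite)"
    using sum_gap_le_1[OF gr] by (intro bdd_aboveI2[where M = 1]) auto
  have "?T - \<eta> < ?T" using \<eta> by simp
  then obtain F0 where F0: "finite F0" "?T - \<eta> < (\<Sum>k\<in>F0. gap \<delta> k)"
    by (subst (asm) less_cSUP_iff[OF _ bdd]) auto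
  obtain m where m: "F0 \<subseteq> {..m}" using finite_subset_atMost_nat_vec[OF F0(1)] by auto
  obtain j where j: "m \<le> diag_vec j" using ex_le_diag_vec by blast
  show ?thesis
  proof (intro exI[of _ j] allI impI)
    fix F :: "(nat ^ 'd) set" assume F: "finite F" "F \<inter> {..diag_vec j} = {}"
    then have "F \<inter> F0 = {}" using m j by (auto intro: order.trans)
    then have "(\<Sum>k\<in>F. gap \<delta> k) + (\<Sum>k\<in>F0. gap \<delta> k) = (\<Sum>k\<in>F \<union> F0. gap \<delta> k)"
      using F F0 by (intro sum.union_disjoint[symmetric]) auto
    also have "\<dots> \<le> ?T" using F F0 by (intro cSUP_upper[OF _ bdd]) auto
    finally show "(\<Sum>k\<in>F. gap \<delta> k) < \<eta>" using F0 by linarith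
  qed
qed

lemma AE_rect_Cauchy:
  assumes \<epsilon>: "\<epsilon> > 0"
  shows "AE \<omega> in N. \<exists>j. \<forall>n\<ge>diag_vec j. \<bar>S n \<omega> - S (diag_vec j) \<omega>\<bar> \<le> \<epsilon>"
proof -
  obtain \<delta> where gr: "good_radius \<delta>" using ex_good_radius by auto
  \<comment> \<open>The factor from the maximal inequality times the one from the Chebyshev-type
    bound.\<close>
  define C where "C = 2 ^ CARD('d) * (8 / min 1 ((\<delta> * \<epsilon>)\<^sup>2))"
  have \<delta>: "\<delta> > 0" using gr by (simp add: good_radius_def)
  have C: "C > 0" using \<delta> \<epsilon> by (simp add: C_def)
  \<comment> \<open>Oscillation beyond the cube j, seen inside the cube L. Levy's inequality
    requires a bounded range; the bound is uniform in L and survives the increasing union.\<close>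
  define D where "D j L = {\<omega> \<in> space N. \<exists>n\<le>diag_vec L. \<bar>\<Sum>k\<in>{..n} - {..diag_vec j}. U k \<omega>\<bar> > \<epsilon>}" for j L :: nat
  have D_meas: "D j L \<in> events" for j L
  proof -
    have "D j L = (\<Union>n\<in>{..diag_vec L}. {\<omega> \<in> space N. \<bar>\<Sum>k\<in>{..n} - {..diag_vec j}. U k \<omega>\<bar> > \<epsilon>})"
      unfolding D_def by auto
    also have "\<dots> \<in> events" by (intro sets.finite_UN) auto
    finally show ?thesis .
  qed
  have D_prob: "prob (\<Union>L. D j L) \<le> C * \<eta>"
    if "\<And>F. finite F \<Longrightarrow> F \<inter> {..diag_vec j} = {} \<Longrightarrow> (\<Sum>k\<in>F. gap \<delta> k) < \<eta>" for j \<eta>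
  proof (rule LIMSEQ_le_const2)
    show "(\<lambda>L. prob (D j L)) \<longlonglongrightarrow> prob (\<Union>L. D j L)"
    proof (rule finite_Lim_measure_incseq)
      show "incseq (D j)" unfolding D_def incseq_def using diag_vec_mono by (auto intro: order.trans)
    qed (use D_meas in auto)
    have "prob (D j L) \<le> C * \<eta>" for L
    proof -
      have "prob (D j L) \<le> 2 ^ CARD('d) *
          prob {\<omega> \<in> space N. \<bar>\<Sum>k\<in>{..diag_vec L} - {..diag_vec j}. U k \<omega>\<bar> > \<epsilon>}"
        unfolding D_def by (rule levy_tail)
      also have "\<dots> \<le> 2 ^ CARD('d) * (8 / min 1 ((\<delta> * \<epsilon>)\<^sup>2) * (\<Sum>k\<in>{..diag_vec L} - {..diag_vec j}. gap \<delta> k))"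
        by (intro mult_left_mono prob_sum_U_gt_le[OF gr _ \<epsilon>]) auto
      also have "\<dots> = C * (\<Sum>k\<in>{..diag_vec L} - {..diag_vec j}. gap \<delta> k)" by (simp add: C_def)
      also have "\<dots> \<le> C * \<eta>"
        using C by (intro mult_left_mono less_imp_le[OF that]) auto
      finally show ?thesis .
    qed
    then show "\<exists>N0. \<forall>n\<ge>N0. prob (D j n) \<le> C * \<eta>" by blast
  qed
  \<comment> \<open>The event that oscillations larger than \<epsilon> occur beyond every
    cube.\<close>
  define Z where "Z = (\<Inter>j. \<Union>L. D j L)"
  have Z_meas: "Z \<in> events" unfolding Z_def using D_meas by auto
  have "prob Z \<le> 0"
  proof (rule field_le_epsilon)
    fix e :: real assume "e > 0"
    then obtain j where "\<And>F. finite F \<Longrightarrow> F \<inter> {..diag_vec j} = {} \<Longrightarrow> (\<Sum>k\<in>F. gap \<delta> k) < e / C"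
      using tail_gap_small[OF gr, of "e / C"] C by auto
    then have "prob (\<Union>L. D j L) \<le> C * (e / C)" by (rule D_prob)
    moreover have "prob Z \<le> prob (\<Union>L. D j L)"
      using D_meas by (intro finite_measure_mono) (auto simp: Z_def)
    ultimately show "prob Z \<le> 0 + e" using C by simp
  qed
  then have "Z \<in> null_sets N"
    using Z_meas by (auto simp: emeasure_eq_measure null_sets_def measure_le_0_iff)
  then have "AE \<omega> in N. \<omega> \<notin> Z" by (rule AE_not_in)
  then show ?thesis
    using AE_space
  proof eventually_elim
    case (elim \<omega>)
    then obtain j where j: "\<And>L. \<omega> \<notin> D j L" by (auto simp: Z_def)
    show ?case
    proof (intro exI[of _ j] allI impI)
      fix n :: "nat ^ 'd" assume n: "diag_vec j \<le> n"
      obtain L where "n \<le> diag_vec L" using ex_le_diag_vec by blast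
      then have "\<bar>\<Sum>k\<in>{..n} - {..diag_vec j}. U k \<omega>\<bar> \<le> \<epsilon>"
        using j[of L] elim(2) unfolding D_def by force
      moreover have "S n \<omega> - S (diag_vec j) \<omega> = (\<Sum>k\<in>{..n} - {..diag_vec j}. U k \<omega>)"
        unfolding S_def using n by (subst sum_diff) (auto intro: order.trans)
      ultimately show "\<bar>S n \<omega> - S (diag_vec j) \<omega>\<bar> \<le> \<epsilon>" by simp
    qed
  qed
qed

text \<open>With \<open>lim\<close> along cubes X is a total function measurable with respect to the
  innovations themselves; no modification on a null set enters.\<close>

definition X :: "'b \<Rightarrow> real" where "X \<omega> = lim (\<lambda>j. S (diag_vec j) \<omega>)"

text \<open>One null set serves uncountably many sequences of rectangles: it is chosen for the
  tolerances 1/(i+1), and the Cauchy property beyond a cube compares every admissible sequence with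
  the cubes.\<close>

lemma AE_rect_tendsto_X:
  "AE \<omega> in N. \<forall>n. filterlim (\<lambda>k. Min (range (\<lambda>i. n k $ i))) at_top sequentially \<longrightarrow>
     (\<lambda>k. S (n k) \<omega>) \<longlonglongrightarrow> X \<omega>"
proof -
  have "AE \<omega> in N. \<forall>i :: nat. \<exists>j. \<forall>n\<ge>diag_vec j. \<bar>S n \<omega> - S (diag_vec j) \<omega>\<bar> \<le> 1 / real (Suc i)"
    unfolding AE_all_countable by (intro allI AE_rect_Cauchy) simp
  then show ?thesis
  proof eventually_elim
    case (elim \<omega>)
    have small: "\<exists>j. \<forall>m\<ge>diag_vec j. \<forall>n\<ge>diag_vec j. \<bar>S m \<omega> - S n \<omega>\<bar> < e" if "e > 0" for e
    proof -
      have "e / 2 > 0" using that by simp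
      then obtain i :: nat where i: "1 / real (Suc i) < e / 2" by (rule nat_approx_posE)
      obtain j where j: "\<And>n. n \<ge> diag_vec j \<Longrightarrow> \<bar>S n \<omega> - S (diag_vec j) \<omega>\<bar> \<le> 1 / real (Suc i)"
        using elim by blast
      have "\<bar>S m \<omega> - S n \<omega>\<bar> < e" if "m \<ge> diag_vec j" "n \<ge> diag_vec j" for m n
        using j[OF that(1)] j[OF that(2)] i by linarith
      then show ?thesis by blast
    qed
    have "Cauchy (\<lambda>j. S (diag_vec j) \<omega>)"
      unfolding Cauchy_def dist_real_def using small diag_vec_mono by meson
    then have lim: "(\<lambda>j. S (diag_vec j) \<omega>) \<longlonglongrightarrow> X \<omega>"
      unfolding X_def by (simp add: Cauchy_convergent_iff convergent_LIMSEQ_iff)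
    show ?case
    proof (intro allI impI)
      fix n :: "nat \<Rightarrow> nat ^ 'd"
      assume n: "filterlim (\<lambda>k. Min (range (\<lambda>i. n k $ i))) at_top sequentially"
      have "(\<lambda>k. S (n k) \<omega> - S (diag_vec k) \<omega>) \<longlonglongrightarrow> 0"
      proof (rule tendstoI)
        fix e :: real assume "e > 0"
        then obtain j where j: "\<And>m n. m \<ge> diag_vec j \<Longrightarrow> n \<ge> diag_vec j \<Longrightarrow> \<bar>S m \<omega> - S n \<omega>\<bar> < e"
          using small by blast
        show "eventually (\<lambda>k. dist (S (n k) \<omega> - S (diag_vec k) \<omega>) 0 < e) sequentially"
          using eventually_ge_if_Min_tendsto[OF n, of "diag_vec j"]
            eventually_ge_if_Min_tendsto[OF Min_diag_vec_tendsto, of "diag_vec j"]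
          by eventually_elim (simp, rule j)
      qed
      from tendsto_add[OF this lim] show "(\<lambda>k. S (n k) \<omega>) \<longlonglongrightarrow> X \<omega>" by simp
    qed
  qed
qed

section \<open>Identification of the rectangular limit\<close>

lemma X_gen: "X \<in> borel_measurable (gen_sigma N K W UNIV)"
  unfolding X_def[abs_def] by (intro borel_measurable_lim_metric S_gen) auto

lemma X_meas [measurable]: "X \<in> borel_measurable N"
  by (rule measurable_gen_sigma_imp[OF _ X_gen]) simp

lemma AE_diag_tendsto_X: "AE \<omega> in N. (\<lambda>j. S (diag_vec j) \<omega>) \<longlonglongrightarrow> X \<omega>"
  using AE_rect_tendsto_X by eventually_elim (use Min_diag_vec_tendsto in blast)

lemma integrable_bounded_mult_iexp [simp]:
  "F \<in> events \<Longrightarrow> f \<in> borel_measurable N \<Longrightarrow> integrable N (\<lambda>\<omega>. indicator F \<omega> * iexp (s * f \<omega>))"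
  by (rule integrable_const_bound[where B = 1]) (auto simp: norm_mult indicator_def)

text \<open>Convergence of the sums leaves open whether the remainders contribute in the limit.
  Their characteristic functions are ratios \<open>v / x j\<close> of real numbers that are at least
  1/2, hence converge to some c > 0; testing against cylinder events shows that c is the only
  possible discrepancy, and comparing moduli gives c = 1.\<close>

lemma iexp_V_eq_iexp_X:
  assumes gr: "good_radius \<delta>" and s: "\<bar>s\<bar> \<le> \<delta>"
  shows "AE \<omega> in N. iexp (s * V \<omega>) = iexp (s * X \<omega>)"
proof -
  define v where "v = expectation (\<lambda>\<omega>. cos (s * V \<omega>))"
  \<comment> \<open>The characteristic function of the partial sum over the cube j at the frequency
    s.\<close>
  define x where "x j = (\<Prod>k\<in>{..diag_vec j}. cosU k s)" for j :: nat
  have v: "v \<ge> 1 / 2" using gr s by (simp add: good_radius_def v_def)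
  have x: "x j \<ge> 1 / 2" for j unfolding x_def by (rule prod_cosU_ge[OF gr s]) simp
  have charV: "char (distr N borel V) s = of_real v"
    unfolding v_def by (rule char_symmetric[OF V_meas' V_sym])
  have iexp_lim: "(\<lambda>j. expectation (\<lambda>\<omega>. indicator F \<omega> * iexp (s * S (diag_vec j) \<omega>))) \<longlonglongrightarrow>
      expectation (\<lambda>\<omega>. indicator F \<omega> * iexp (s * X \<omega>))" if [measurable]: "F \<in> events" for F
  proof (rule integral_dominated_convergence[where w = "\<lambda>_. 1"])
    show "AE \<omega> in N. (\<lambda>j. indicator F \<omega> * iexp (s * S (diag_vec j) \<omega>)) \<longlonglongrightarrow> indicator F \<omega> * iexp (s * X \<omega>)"
      using AE_diag_tendsto_X by eventually_elim (intro tendsto_intros)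
  qed (auto simp: norm_mult indicator_def)
  have chS: "expectation (\<lambda>\<omega>. iexp (s * S (diag_vec j) \<omega>)) = of_real (x j)" for j
  proof -
    have "expectation (\<lambda>\<omega>. iexp (s * S (diag_vec j) \<omega>)) = char (distr N borel (S (diag_vec j))) s"
      unfolding char_def by (subst integral_distr) auto
    then show ?thesis by (simp only: char_S x_def)
  qed
  have "(\<lambda>j. complex_of_real (x j)) \<longlonglongrightarrow> expectation (\<lambda>\<omega>. iexp (s * X \<omega>))"
  proof -
    have top: "expectation (\<lambda>\<omega>. indicator (space N) \<omega> * h \<omega>) = expectation h" for h :: "'b \<Rightarrow> complex"
      by (intro Bochner_Integration.integral_cong) auto
    show ?thesis using iexp_lim[OF sets.top] unfolding top chS .
  qed
  from tendsto_Re[OF this] obtain x0 where x0: "x \<longlonglongrightarrow> x0" by auto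
  have x0_ge: "x0 \<ge> 1 / 2" by (rule LIMSEQ_le_const[OF x0]) (use x in auto)
  define c where "c = v / x0"
  have c: "c > 0" using v x0_ge by (simp add: c_def)
  \<comment> \<open>Events that depend only on innovations in some cube. Nestedness of the cubes
    makes this family stable under intersection, and it generates the sigma-algebra of all
    innovations.\<close>
  let ?G = "\<Union>j. sets (gen_sigma N K W {..diag_vec j})"
  have G_eq: "sigma_sets (space N) ?G = sets (gen_sigma N K W UNIV)"
  proof
    show "sigma_sets (space N) ?G \<subseteq> sets (gen_sigma N K W UNIV)"
    proof -
      have "?G \<subseteq> sets (gen_sigma N K W UNIV)" by (intro UN_least sets_gen_sigma_mono) simp
      from sets.sigma_sets_subset[OF this] show ?thesis by simp
    qed
    show "sets (gen_sigma N K W UNIV) \<subseteq> sigma_sets (space N) ?G"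
      unfolding sets_gen_sigma[of N K W UNIV]
    proof (rule sigma_sets_mono, clarify)
      fix i :: "nat ^ 'd" and A assume A: "A \<in> sets K"
      obtain j where "i \<le> diag_vec j" using ex_le_diag_vec by blast
      then have "W i -` A \<inter> space N \<in> sets (gen_sigma N K W {..diag_vec j})"
        unfolding sets_gen_sigma using A by (intro sigma_sets.Basic) auto
      then show "W i -` A \<inter> space N \<in> sigma_sets (space N) ?G" by (intro sigma_sets.Basic) auto
    qed
  qed
  have G_sub: "sets (gen_sigma N K W I) \<subseteq> events" for I by (rule sets_gen_sigma_subset) simp
  have eqF: "expectation (\<lambda>\<omega>. indicator F \<omega> * iexp (s * V \<omega>)) = of_real c * expectation (\<lambda>\<omega>. indicator F \<omega> * iexp (s * X \<omega>))"
    if F: "F \<in> ?G" for F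
  proof -
    obtain m where m: "F \<in> sets (gen_sigma N K W {..diag_vec m})" using F by auto
    have Fe[measurable]: "F \<in> events" using m G_sub by auto
    have step: "expectation (\<lambda>\<omega>. indicator F \<omega> * iexp (s * V \<omega>)) =
        of_real (v / x j) * expectation (\<lambda>\<omega>. indicator F \<omega> * iexp (s * S (diag_vec j) \<omega>))" if "j \<ge> m" for j
    proof -
      have Fj: "F \<in> sets (gen_sigma N K W {..diag_vec j})"
        using m sets_gen_sigma_mono[of "{..diag_vec m}" "{..diag_vec j}" N K W] diag_vec_mono[OF that]
        by auto
      have [measurable]: "S (diag_vec j) \<in> borel_measurable (gen_sigma N K W {..diag_vec j})"
        by (rule S_gen) simp
      have [measurable]: "B (diag_vec j) \<in> borel_measurable (gen_sigma N K W (- {..diag_vec j}))"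
        by (rule B_meas)
      \<comment> \<open>From stage m on, both F and the partial sum live inside the cube while the
        remainder lives outside, so the expectation factors.\<close>
      have ind: "indep_var borel (\<lambda>\<omega>. indicator F \<omega> * iexp (s * S (diag_vec j) \<omega>))
          borel (\<lambda>\<omega>. iexp (s * B (diag_vec j) \<omega>))"
        by (rule indep_var_gen_sigma[OF indep_W, of "{..diag_vec j}" "- {..diag_vec j}"])
           (use Fj in auto)
      have b: "expectation (\<lambda>\<omega>. iexp (s * B (diag_vec j) \<omega>)) = of_real (v / x j)"
      proof -
        have "expectation (\<lambda>\<omega>. iexp (s * B (diag_vec j) \<omega>)) = char (distr N borel (B (diag_vec j))) s"
          unfolding char_def by (subst integral_distr) auto
        moreover have "of_real v = of_real (x j) * char (distr N borel (B (diag_vec j))) s"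
          using char_V[of s "diag_vec j"] by (simp only: charV char_S x_def)
        ultimately show ?thesis using x[of j] by (auto simp: field_simps)
      qed
      have "AE \<omega> in N. V \<omega> = S (diag_vec j) \<omega> + B (diag_vec j) \<omega>"
        using decomp[of "diag_vec j"] by (simp add: S_def U_def)
      then have "expectation (\<lambda>\<omega>. indicator F \<omega> * iexp (s * V \<omega>)) =
          expectation (\<lambda>\<omega>. indicator F \<omega> * iexp (s * S (diag_vec j) \<omega>) * iexp (s * B (diag_vec j) \<omega>))"
        by (intro integral_cong_AE) (auto simp: exp_add[symmetric] algebra_simps)
      also have "\<dots> = expectation (\<lambda>\<omega>. indicator F \<omega> * iexp (s * S (diag_vec j) \<omega>)) *
          expectation (\<lambda>\<omega>. iexp (s * B (diag_vec j) \<omega>))"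
        by (rule indep_var_lebesgue_integral[OF ind integrable_bounded_mult_iexp integrable_iexp]) auto
      finally show ?thesis unfolding b by (simp only: mult.commute)
    qed
    have lim: "(\<lambda>j. of_real (v / x j) * expectation (\<lambda>\<omega>. indicator F \<omega> * iexp (s * S (diag_vec j) \<omega>)))
        \<longlonglongrightarrow> of_real c * expectation (\<lambda>\<omega>. indicator F \<omega> * iexp (s * X \<omega>))"
      unfolding c_def using x0 x0_ge by (intro tendsto_intros iexp_lim Fe) auto
    have "eventually (\<lambda>j. of_real (v / x j) * expectation (\<lambda>\<omega>. indicator F \<omega> * iexp (s * S (diag_vec j) \<omega>))
        = expectation (\<lambda>\<omega>. indicator F \<omega> * iexp (s * V \<omega>))) sequentially"
      using eventually_ge_at_top[of m] by eventually_elim (rule step[symmetric])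
    from tendsto_unique[OF trivial_limit_sequentially tendsto_eventually[OF this] lim] show ?thesis .
  qed
  define f where "f \<omega> = iexp (s * V \<omega>) - of_real c * iexp (s * X \<omega>)" for \<omega>
  have f_meas: "f \<in> borel_measurable (gen_sigma N K W UNIV)"
    unfolding f_def[abs_def] using V_meas X_gen by measurable
  have f_int: "integrable N f"
    unfolding f_def[abs_def] by (intro Bochner_Integration.integrable_diff integrable_mult_right integrable_iexp) auto
  have f_zero: "expectation (\<lambda>\<omega>. indicator F \<omega> * f \<omega>) = 0" if F: "F \<in> ?G" for F
  proof -
    have [measurable]: "F \<in> events" using F G_sub by auto
    have "expectation (\<lambda>\<omega>. indicator F \<omega> * f \<omega>) = expectation (\<lambda>\<omega>. indicator F \<omega> * iexp (s * V \<omega>)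
        - of_real c * (indicator F \<omega> * iexp (s * X \<omega>)))"
      by (intro Bochner_Integration.integral_cong) (auto simp: f_def algebra_simps)
    also have "\<dots> = expectation (\<lambda>\<omega>. indicator F \<omega> * iexp (s * V \<omega>))
        - of_real c * expectation (\<lambda>\<omega>. indicator F \<omega> * iexp (s * X \<omega>))"
      by (subst Bochner_Integration.integral_diff[OF integrable_bounded_mult_iexp
            integrable_mult_right[OF integrable_bounded_mult_iexp]]) auto
    also have "\<dots> = 0" unfolding eqF[OF F] by (rule diff_self)
    finally show ?thesis .
  qed
  have G_int: "Int_stable ?G"
  proof (rule Int_stableI)
    fix a b assume "a \<in> ?G" "b \<in> ?G"
    then obtain i j where ij: "a \<in> sets (gen_sigma N K W {..diag_vec i})" "b \<in> sets (gen_sigma N K W {..diag_vec j})"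
      by auto
    have sub: "sets (gen_sigma N K W {..diag_vec l}) \<subseteq> sets (gen_sigma N K W {..diag_vec (max i j)})"
      if "l \<le> max i j" for l
      by (rule sets_gen_sigma_mono) (use diag_vec_mono[OF that] in auto)
    have "a \<inter> b \<in> sets (gen_sigma N K W {..diag_vec (max i j)})"
      using ij sub[of i] sub[of j] by (intro sets.Int) auto
    then show "a \<inter> b \<in> ?G" by blast
  qed
  have G_top: "space N \<in> ?G" using sets.top[of "gen_sigma N K W {..diag_vec 0}"] by auto
  have G_events: "?G \<subseteq> events" using G_sub by auto
  have zero: "AE \<omega> in N. h (f \<omega>) = 0"
    if h: "h \<in> {Re, Im}" for h
  proof (rule AE_zero_if_integrals_zero[OF G_int G_top G_events])
    have "(\<lambda>\<omega>. h (f \<omega>)) \<in> borel_measurable (gen_sigma N K W UNIV)"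
      using f_meas h by auto
    moreover have "sets (sigma (space N) ?G) = sets (gen_sigma N K W UNIV)"
      using G_events sets.sets_into_space by (subst sets_measure_of) (auto simp: G_eq)
    ultimately show "(\<lambda>\<omega>. h (f \<omega>)) \<in> borel_measurable (sigma (space N) ?G)"
      by (simp cong: measurable_cong_sets)
    show "integrable N (\<lambda>\<omega>. h (f \<omega>))" using f_int h by auto
    fix F assume F: "F \<in> ?G"
    then have Fe: "F \<in> events" using G_events by auto
    have int: "integrable N (\<lambda>\<omega>. indicator F \<omega> * f \<omega>)"
    proof -
      have "integrable N (\<lambda>\<omega>. indicator F \<omega> *\<^sub>R f \<omega>)" by (rule integrable_mult_indicator[OF Fe f_int])
      moreover have "(\<lambda>\<omega>. indicator F \<omega> *\<^sub>R f \<omega>) = (\<lambda>\<omega>. indicator F \<omega> * f \<omega>)"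
        by (auto simp: fun_eq_iff indicator_def)
      ultimately show ?thesis by simp
    qed
    have "expectation (\<lambda>\<omega>. indicator F \<omega> * h (f \<omega>)) = expectation (\<lambda>\<omega>. h (indicator F \<omega> * f \<omega>))"
      using h by (intro Bochner_Integration.integral_cong) (auto simp: indicator_def)
    also have "\<dots> = h (expectation (\<lambda>\<omega>. indicator F \<omega> * f \<omega>))"
      using h integral_Re[OF int] integral_Im[OF int] by (elim insertE emptyE) (simp_all only:)
    also have "\<dots> = 0" using h f_zero[OF F] by auto
    finally show "expectation (\<lambda>\<omega>. indicator F \<omega> * h (f \<omega>)) = 0" .
  qed
  have f0: "AE \<omega> in N. iexp (s * V \<omega>) = of_real c * iexp (s * X \<omega>)"
    using zero[of Re, simplified] zero[of Im, simplified]
    by eventually_elim (auto simp: f_def complex_eq_iff)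
  \<comment> \<open>Both exponentials have modulus 1 and c is positive. The claim does not depend on
    the sample point, so on a probability space its almost sure truth is its truth.\<close>
  have "AE \<omega> in N. c = 1"
    using f0
  proof eventually_elim
    case (elim \<omega>)
    then have "norm (iexp (s * V \<omega>)) = norm (of_real c * iexp (s * X \<omega>))" by (rule arg_cong)
    then show ?case using c by (simp add: norm_mult)
  qed
  then have "c = 1" by simp
  with f0 show ?thesis by simp
qed

lemma AE_V_eq_X: "AE \<omega> in N. V \<omega> = X \<omega>"
proof -
  obtain \<delta> where gr: "good_radius \<delta>" using ex_good_radius by auto
  have \<delta>: "\<delta> > 0" using gr by (simp add: good_radius_def)
  have "AE \<omega> in N. \<forall>j :: nat. iexp (\<delta> / real (Suc j) * V \<omega>) = iexp (\<delta> / real (Suc j) * X \<omega>)"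
    unfolding AE_all_countable
  proof
    fix j :: nat
    have "\<bar>\<delta> / real (Suc j)\<bar> \<le> \<delta>" using \<delta> by (simp add: field_simps)
    then show "AE \<omega> in N. iexp (\<delta> / real (Suc j) * V \<omega>) = iexp (\<delta> / real (Suc j) * X \<omega>)"
      by (rule iexp_V_eq_iexp_X[OF gr])
  qed
  then show ?thesis by eventually_elim (use iexp_eq_imp_eq[OF \<delta>] in blast)
qed

theorem AE_rect_tendsto:
  "AE \<omega> in N. \<forall>n. filterlim (\<lambda>k. Min (range (\<lambda>i. n k $ i))) at_top sequentially \<longrightarrow>
     (\<lambda>k. \<Sum>j\<in>{..n k}. g j (W j \<omega>)) \<longlonglongrightarrow> V \<omega>"
  using AE_rect_tendsto_X AE_V_eq_X by eventually_elim (simp add: S_def U_def)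

end

section \<open>Complex-valued sums through real and imaginary parts\<close>

lemma rect_sums_Re_Im:
  assumes "\<forall>n. filterlim (\<lambda>k. Min (range (\<lambda>i. n k $ i))) at_top sequentially \<longrightarrow>
      (\<lambda>k. \<Sum>j\<in>{..n k}. Re (x j)) \<longlonglongrightarrow> Re L"
    and "\<forall>n. filterlim (\<lambda>k. Min (range (\<lambda>i. n k $ i))) at_top sequentially \<longrightarrow>
      (\<lambda>k. \<Sum>j\<in>{..n k}. Im (x j)) \<longlonglongrightarrow> Im L"
  shows "rect_sums x L"
  unfolding rect_sums_def using assms by (simp add: tendsto_complex_iff)

lemma rect_sums_unique:
  assumes "rect_sums x L" "rect_sums x L'"
  shows "L = L'"
  using assms Min_diag_vec_tendsto unfolding rect_sums_def by (blast intro: LIMSEQ_unique)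

lemma symmetric_rv_compose:
  assumes [measurable]: "X \<in> borel_measurable M" and sym: "symmetric_rv M X"
    and h[measurable]: "h \<in> borel_measurable borel" and odd: "\<And>z. h (- z) = - h z"
  shows "distr M borel (\<lambda>\<omega>. h (X \<omega>)) = distr M borel (\<lambda>\<omega>. - h (X \<omega>) :: real)"
proof -
  have "distr M borel (\<lambda>\<omega>. h (X \<omega>)) = distr (distr M borel X) borel h"
    by (simp add: distr_distr comp_def)
  also have "\<dots> = distr (distr M borel (\<lambda>\<omega>. - X \<omega>)) borel h"
    using sym by (simp add: symmetric_rv_def)
  also have "\<dots> = distr M borel (\<lambda>\<omega>. - h (X \<omega>))"
    by (simp add: distr_distr comp_def odd)
  finally show ?thesis .
qed

context
  fixes N :: "'b measure" and K :: "'c measure" and W :: "nat ^ 'd \<Rightarrow> 'b \<Rightarrow> 'c"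
    and g :: "'c \<Rightarrow> complex" and a :: "nat ^ 'd \<Rightarrow> complex" and V :: "'b \<Rightarrow> complex"
  assumes N: "prob_space N"
    and W: "prob_space.indep_vars N (\<lambda>_. K) W UNIV"
    and g: "g \<in> borel_measurable K"
    and g_sym: "\<And>k. symmetric_rv N (\<lambda>\<omega>. g (W k \<omega>))"
    and V: "V \<in> borel_measurable (gen_sigma N K W UNIV)"
    and V_sym: "symmetric_rv N V"
    and dec: "\<And>n. \<exists>B\<in>borel_measurable (gen_sigma N K W (- {..n})).
        AE \<omega> in N. V \<omega> = (\<Sum>k\<in>{..n}. a k * g (W k \<omega>)) + B \<omega>"
begin

interpretation prob_space N by (rule N)

text \<open>Both z \<mapsto> h (a z) and h are odd, so symmetry of the complex variables passes to
  the real terms even after multiplication by complex coefficients; additivity of h carries over the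
  decomposition.\<close>

lemma component_decomposition:
  fixes h :: "complex \<Rightarrow> real"
  assumes h: "h \<in> {Re, Im}"
  shows "\<exists>B. symmetric_decomposition N K W (\<lambda>k w. h (a k * g w)) (\<lambda>\<omega>. h (V \<omega>)) B"
proof -
  have "\<forall>n. \<exists>B. B \<in> borel_measurable (gen_sigma N K W (- {..n})) \<and>
      (AE \<omega> in N. V \<omega> = (\<Sum>k\<in>{..n}. a k * g (W k \<omega>)) + B \<omega>)"
    using dec unfolding Bex_def by (rule allI)
  from choice[OF this] obtain B where B: "\<And>n. B n \<in> borel_measurable (gen_sigma N K W (- {..n}))"
    "\<And>n. AE \<omega> in N. V \<omega> = (\<Sum>k\<in>{..n}. a k * g (W k \<omega>)) + B n \<omega>"
    by auto
  have [measurable]: "W k \<in> measurable N K" for k using W by (auto simp: indep_vars_def)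
  have [measurable]: "V \<in> borel_measurable N" by (rule measurable_gen_sigma_imp[OF _ V]) simp
  have gW[measurable]: "(\<lambda>\<omega>. g (W k \<omega>)) \<in> borel_measurable N" for k using g by measurable
  have h_meas[measurable]: "h \<in> borel_measurable borel" using h by auto
  have h_minus: "h (- z) = - h z" and h_add: "h (y + z) = h y + h z" for y z using h by auto
  have h_sum: "h (\<Sum>k\<in>F. f k) = (\<Sum>k\<in>F. h (f k))" for f :: "nat ^ 'd \<Rightarrow> complex" and F using h by auto
  have "symmetric_decomposition N K W (\<lambda>k w. h (a k * g w)) (\<lambda>\<omega>. h (V \<omega>)) (\<lambda>n \<omega>. h (B n \<omega>))"
  proof
    show "distr N borel (\<lambda>\<omega>. h (a k * g (W k \<omega>))) = distr N borel (\<lambda>\<omega>. - h (a k * g (W k \<omega>)))" for k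
      by (rule symmetric_rv_compose[OF gW g_sym, of "\<lambda>z. h (a k * z)"]) (auto simp: h_minus)
    show "distr N borel (\<lambda>\<omega>. h (V \<omega>)) = distr N borel (\<lambda>\<omega>. - h (V \<omega>))"
      by (rule symmetric_rv_compose[OF _ V_sym]) (auto simp: h_minus)
    show "AE \<omega> in N. h (V \<omega>) = (\<Sum>k\<in>{..n}. h (a k * g (W k \<omega>))) + h (B n \<omega>)" for n
      using B(2)[of n] by eventually_elim (simp add: h_add h_sum)
    show "(\<lambda>\<omega>. h (V \<omega>)) \<in> borel_measurable (gen_sigma N K W UNIV)" using V by measurable
    show "(\<lambda>\<omega>. h (B n \<omega>)) \<in> borel_measurable (gen_sigma N K W (- {..n}))" for n
      using B(1)[of n] by measurable
    show "(\<lambda>w. h (a k * g w)) \<in> borel_measurable K" for k using g by measurable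
  qed (rule W)
  then show ?thesis by blast
qed

theorem AE_rect_sums:
  "AE \<omega> in N. rect_sums (\<lambda>k. a k * g (W k \<omega>)) (V \<omega>)"
proof -
  obtain B1 B2 where "symmetric_decomposition N K W (\<lambda>k w. Re (a k * g w)) (\<lambda>\<omega>. Re (V \<omega>)) B1"
    "symmetric_decomposition N K W (\<lambda>k w. Im (a k * g w)) (\<lambda>\<omega>. Im (V \<omega>)) B2"
    using component_decomposition[of Re] component_decomposition[of Im] by auto
  from this[THEN symmetric_decomposition.AE_rect_tendsto]
  show ?thesis by eventually_elim (rule rect_sums_Re_Im)
qed

text \<open>Each of the real and imaginary parts contributes 8, from
  \<open>min 1 (y^2) \<le> 8 * sinc_gap y\<close> and gap sums at most 1. The two frequency ranges
  may differ, so the smaller radius is taken.\<close>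

lemma truncated_second_moments_le:
  "\<exists>\<delta>>0. \<forall>F. finite F \<longrightarrow> (\<Sum>k\<in>F. expectation (\<lambda>\<omega>. min 1 ((\<delta> * cmod (a k * g (W k \<omega>)))\<^sup>2))) \<le> 16"
proof -
  have [measurable]: "W k \<in> measurable N K" for k using W by (auto simp: indep_vars_def)
  have [measurable]: "(\<lambda>\<omega>. g (W k \<omega>)) \<in> borel_measurable N" for k using g by measurable
  have int: "integrable N (\<lambda>\<omega>. min 1 ((\<delta> * f \<omega>)\<^sup>2))" if [measurable]: "f \<in> borel_measurable N"
    for \<delta> and f :: "'b \<Rightarrow> real"
    by (rule integrable_const_bound[where B = 1]) (auto simp: min_def)
  have part: "\<exists>\<delta>>0. \<forall>F. finite F \<longrightarrow> (\<Sum>k\<in>F. expectation (\<lambda>\<omega>. min 1 ((\<delta> * h (a k * g (W k \<omega>)))\<^sup>2))) \<le> 8"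
    if h: "h \<in> {Re, Im}" for h :: "complex \<Rightarrow> real"
  proof -
    have [measurable]: "h \<in> borel_measurable borel" using h by auto
    obtain B where B: "symmetric_decomposition N K W (\<lambda>k w. h (a k * g w)) (\<lambda>\<omega>. h (V \<omega>)) B"
      using component_decomposition[OF h] by blast
    interpret B: symmetric_decomposition N K W "\<lambda>k w. h (a k * g w)" "\<lambda>\<omega>. h (V \<omega>)" B by (rule B)
    obtain \<delta> where \<delta>: "B.good_radius \<delta>" using B.ex_good_radius by blast
    show ?thesis
    proof (intro exI[of _ \<delta>] conjI allI impI)
      show "\<delta> > 0" using \<delta> by (simp add: B.good_radius_def)
      fix F :: "(nat ^ 'd) set" assume F: "finite F"
      have "expectation (\<lambda>\<omega>. min 1 ((\<delta> * h (a k * g (W k \<omega>)))\<^sup>2)) \<le> 8 * B.gap \<delta> k" for k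
      proof -
        have "expectation (\<lambda>\<omega>. min 1 ((\<delta> * h (a k * g (W k \<omega>)))\<^sup>2)) \<le>
            expectation (\<lambda>\<omega>. 8 * sinc_gap (\<delta> * h (a k * g (W k \<omega>))))"
        proof (intro integral_mono int)
          show "integrable N (\<lambda>\<omega>. 8 * sinc_gap (\<delta> * h (a k * g (W k \<omega>))))"
            by (rule integrable_const_bound[where B = 16]) (auto simp: sinc_gap_nonneg sinc_gap_le)
          show "min 1 ((\<delta> * h (a k * g (W k \<omega>)))\<^sup>2) \<le> 8 * sinc_gap (\<delta> * h (a k * g (W k \<omega>)))" for \<omega>
            using sinc_gap_lower[of "\<delta> * h (a k * g (W k \<omega>))"] by linarith
        qed measurable
        then show ?thesis by (simp add: B.gap_def B.U_def)
      qed
      then have "(\<Sum>k\<in>F. expectation (\<lambda>\<omega>. min 1 ((\<delta> * h (a k * g (W k \<omega>)))\<^sup>2))) \<le> (\<Sum>k\<in>F. 8 * B.gap \<delta> k)"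
        by (intro sum_mono)
      also have "\<dots> \<le> 8" using B.sum_gap_le_1[OF \<delta> F] by (simp add: sum_distrib_left[symmetric])
      finally show "(\<Sum>k\<in>F. expectation (\<lambda>\<omega>. min 1 ((\<delta> * h (a k * g (W k \<omega>)))\<^sup>2))) \<le> 8" .
    qed
  qed
  obtain d1 where d1: "d1 > 0" "\<And>F. finite F \<Longrightarrow> (\<Sum>k\<in>F. expectation (\<lambda>\<omega>. min 1 ((d1 * Re (a k * g (W k \<omega>)))\<^sup>2))) \<le> 8"
    using part[of Re] by auto
  obtain d2 where d2: "d2 > 0" "\<And>F. finite F \<Longrightarrow> (\<Sum>k\<in>F. expectation (\<lambda>\<omega>. min 1 ((d2 * Im (a k * g (W k \<omega>)))\<^sup>2))) \<le> 8"
    using part[of Im] by auto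
  define \<delta> where "\<delta> = min d1 d2"
  have mono: "(\<delta> * y)\<^sup>2 \<le> (d * y)\<^sup>2" if "\<delta> \<le> d" "d > 0" for d y :: real
    using that d1(1) d2(1) unfolding power_mult_distrib \<delta>_def by (intro mult_right_mono power_mono) auto
  have le: "min 1 ((\<delta> * cmod z)\<^sup>2) \<le> min 1 ((d1 * Re z)\<^sup>2) + min 1 ((d2 * Im z)\<^sup>2)" for z
  proof -
    have "(\<delta> * cmod z)\<^sup>2 = (\<delta> * Re z)\<^sup>2 + (\<delta> * Im z)\<^sup>2"
      by (simp add: power_mult_distrib cmod_power2 distrib_left)
    moreover have "(\<delta> * Re z)\<^sup>2 \<le> (d1 * Re z)\<^sup>2" by (rule mono) (use d1(1) in \<open>auto simp: \<delta>_def\<close>)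
    moreover have "(\<delta> * Im z)\<^sup>2 \<le> (d2 * Im z)\<^sup>2" by (rule mono) (use d2(1) in \<open>auto simp: \<delta>_def\<close>)
    moreover have "0 \<le> (d1 * Re z)\<^sup>2" "0 \<le> (d2 * Im z)\<^sup>2" by simp_all
    ultimately show ?thesis by linarith
  qed
  show ?thesis
  proof (intro exI[of _ \<delta>] conjI allI impI)
    show "\<delta> > 0" using d1 d2 by (simp add: \<delta>_def)
    fix F :: "(nat ^ 'd) set" assume F: "finite F"
    have "(\<Sum>k\<in>F. expectation (\<lambda>\<omega>. min 1 ((\<delta> * cmod (a k * g (W k \<omega>)))\<^sup>2))) \<le>
        (\<Sum>k\<in>F. expectation (\<lambda>\<omega>. min 1 ((d1 * Re (a k * g (W k \<omega>)))\<^sup>2)) +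
          expectation (\<lambda>\<omega>. min 1 ((d2 * Im (a k * g (W k \<omega>)))\<^sup>2)))"
    proof (rule sum_mono)
      fix k
      have "expectation (\<lambda>\<omega>. min 1 ((\<delta> * cmod (a k * g (W k \<omega>)))\<^sup>2)) \<le>
          expectation (\<lambda>\<omega>. min 1 ((d1 * Re (a k * g (W k \<omega>)))\<^sup>2) + min 1 ((d2 * Im (a k * g (W k \<omega>)))\<^sup>2))"
        by (intro integral_mono Bochner_Integration.integrable_add int le) auto
      also have "\<dots> = expectation (\<lambda>\<omega>. min 1 ((d1 * Re (a k * g (W k \<omega>)))\<^sup>2)) +
          expectation (\<lambda>\<omega>. min 1 ((d2 * Im (a k * g (W k \<omega>)))\<^sup>2))"
        by (intro Bochner_Integration.integral_add int) auto
      finally show "expectation (\<lambda>\<omega>. min 1 ((\<delta> * cmod (a k * g (W k \<omega>)))\<^sup>2)) \<le> \<dots>" .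
    qed
    also have "\<dots> \<le> 8 + 8" unfolding sum.distrib using d1(2)[OF F] d2(2)[OF F] by (intro add_mono)
    finally show "(\<Sum>k\<in>F. expectation (\<lambda>\<omega>. min 1 ((\<delta> * cmod (a k * g (W k \<omega>)))\<^sup>2))) \<le> 16" by simp
  qed
qed

end

text \<open>A common law other than the point mass at 0 gives some set |x| \<ge> \<epsilon> mass p >
  0. On it the truncated moment is at least min 1 ((\<delta> \<epsilon> |a_k|)^2), so these numbers
  have bounded finite sums, which is square summability up to finitely many indices.\<close>

lemma square_summable_if_truncated_moments_le:
  fixes a :: "'i \<Rightarrow> complex" and X :: "'i \<Rightarrow> 'b \<Rightarrow> complex"
  assumes "prob_space N"
    and X: "\<And>k. X k \<in> borel_measurable N" and id: "\<And>k. distr N borel (X k) = D"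
    and nz: "\<not> (AE x in D. x = 0)" and \<delta>: "\<delta> > 0"
    and bd: "\<And>F. finite F \<Longrightarrow> (\<Sum>k\<in>F. prob_space.expectation N (\<lambda>\<omega>. min 1 ((\<delta> * cmod (a k * X k \<omega>))\<^sup>2))) \<le> C"
  shows "(\<lambda>k. (cmod (a k))\<^sup>2) summable_on UNIV"
proof -
  interpret prob_space N by fact
  note [measurable] = X
  have D: "prob_space D" using id[of undefined] by (metis X prob_space_distr)
  interpret D: prob_space D by (rule D)
  have [simp]: "sets D = sets borel" "space D = UNIV" using id[of undefined] by auto
  have [measurable_cong]: "sets D = sets borel" by simp
  have "\<exists>n :: nat. D.prob {x. 1 / real (Suc n) \<le> cmod x} > 0"
  proof (rule ccontr)
    assume "\<not> ?thesis"
    then have z: "D.prob {x. 1 / real (Suc n) \<le> cmod x} = 0" for n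
      using zero_less_measure_iff by blast
    have "AE x in D. \<forall>n :: nat. \<not> 1 / real (Suc n) \<le> cmod x"
      unfolding AE_all_countable
    proof
      fix n :: nat
      have "{x. 1 / real (Suc n) \<le> cmod x} \<in> null_sets D"
        using z[of n] by (auto simp: null_sets_def D.emeasure_eq_measure simp del: of_nat_Suc)
      then show "AE x in D. \<not> 1 / real (Suc n) \<le> cmod x"
        by (rule AE_I') (auto simp del: of_nat_Suc)
    qed
    then have "AE x in D. x = 0"
    proof eventually_elim
      case (elim x)
      show "x = 0"
      proof (rule ccontr)
        assume "x \<noteq> 0"
        then have "cmod x > 0" by simp
        then obtain n :: nat where "1 / real (Suc n) < cmod x" by (rule nat_approx_posE)
        with elim show False by (meson less_imp_le)
      qed
    qed
    with nz show False by contradiction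
  qed
  then obtain n :: nat where n: "D.prob {x. 1 / real (Suc n) \<le> cmod x} > 0" by blast
  define \<epsilon> where "\<epsilon> = 1 / real (Suc n)"
  define p where "p = D.prob {x. \<epsilon> \<le> cmod x}"
  define c where "c = \<delta> * \<epsilon>"
  have p: "p > 0" using n by (simp add: p_def \<epsilon>_def)
  have \<epsilon>: "\<epsilon> > 0" by (simp add: \<epsilon>_def)
  have c: "c > 0" using \<delta> \<epsilon> by (simp add: c_def)
  define b where "b k = min 1 ((c * cmod (a k))\<^sup>2)" for k
  have b_nonneg: "b k \<ge> 0" for k by (simp add: b_def)
  have lower: "p * b k \<le> expectation (\<lambda>\<omega>. min 1 ((\<delta> * cmod (a k * X k \<omega>))\<^sup>2))" for k
  proof -
    let ?E = "{\<omega> \<in> space N. \<epsilon> \<le> cmod (X k \<omega>)}"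
    have "p = measure (distr N borel (X k)) {x. \<epsilon> \<le> cmod x}" by (simp add: p_def id)
    also have "\<dots> = prob ?E" by (subst measure_distr) (auto intro!: arg_cong[where f = prob])
    finally have "p * b k = expectation (\<lambda>\<omega>. indicator ?E \<omega> * b k)" by simp
    also have "\<dots> \<le> expectation (\<lambda>\<omega>. min 1 ((\<delta> * cmod (a k * X k \<omega>))\<^sup>2))"
    proof (rule integral_mono)
      show "integrable N (\<lambda>\<omega>. min 1 ((\<delta> * cmod (a k * X k \<omega>))\<^sup>2))"
        by (rule integrable_const_bound[where B = 1]) (auto simp: min_def)
      show "integrable N (\<lambda>\<omega>. indicator ?E \<omega> * b k)"
        by (rule integrable_const_bound[where B = 1]) (auto simp: indicator_def b_def min_def)
      fix \<omega>
      show "indicator ?E \<omega> * b k \<le> min 1 ((\<delta> * cmod (a k * X k \<omega>))\<^sup>2)"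
      proof (cases "\<omega> \<in> ?E")
        case True
        then have "c * cmod (a k) \<le> \<delta> * cmod (a k * X k \<omega>)"
          using \<delta> mult_right_mono[of \<epsilon> "cmod (X k \<omega>)" "cmod (a k)"]
          unfolding c_def norm_mult mult.assoc
          by (intro mult_left_mono) (simp_all add: mult.commute)
        then have "(c * cmod (a k))\<^sup>2 \<le> (\<delta> * cmod (a k * X k \<omega>))\<^sup>2"
          using c by (intro power_mono) auto
        then have "b k \<le> min 1 ((\<delta> * cmod (a k * X k \<omega>))\<^sup>2)" unfolding b_def by (rule min.mono[OF order_refl])
        then show ?thesis using True by simp
      qed simp
    qed
    finally show ?thesis .
  qed
  have b_sum: "(\<Sum>k\<in>F. b k) \<le> C / p" if "finite F" for F
  proof -
    have "p * (\<Sum>k\<in>F. b k) \<le> C"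
      unfolding sum_distrib_left using lower by (intro order.trans[OF sum_mono bd[OF that]])
    then show ?thesis using p by (simp add: field_simps)
  qed
  then have b_summable: "b summable_on UNIV"
    using b_nonneg by (intro nonneg_bdd_above_summable_on bdd_aboveI2[where M = "C / p"]) auto
  \<comment> \<open>The indices at which the truncation equals 1. Each contributes a full unit to a
    bounded sum, so they are finite in number; elsewhere the truncation is inactive.\<close>
  define T where "T = {k. (c * cmod (a k))\<^sup>2 \<ge> 1}"
  have fin: "finite T"
  proof (rule ccontr)
    assume inf: "infinite T"
    obtain m :: nat where m: "C / p < real m" using reals_Archimedean2 by blast
    obtain F where F: "finite F" "card F = m" "F \<subseteq> T" using infinite_arbitrarily_large[OF inf] by blast
    have "(\<Sum>k\<in>F. b k) = (\<Sum>k\<in>F. 1)" using F by (intro sum.cong) (auto simp: b_def T_def)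
    then show False using b_sum[OF F(1)] F m by simp
  qed
  have "(\<lambda>k. c\<^sup>2 * (cmod (a k))\<^sup>2) summable_on (T \<union> - T)"
  proof (rule summable_on_Un_disjoint)
    show "(\<lambda>k. c\<^sup>2 * (cmod (a k))\<^sup>2) summable_on - T"
      using summable_on_subset_banach[OF b_summable, of "- T"]
      by (subst summable_on_cong[where g = b]) (auto simp: b_def T_def power_mult_distrib)
  qed (use fin in auto)
  then have "(\<lambda>k. c\<^sup>2 * (cmod (a k))\<^sup>2) summable_on UNIV" by simp
  then show ?thesis using c by (subst (asm) summable_on_cmult_right') auto
qed

section \<open>Innovation decomposition of a causal solution\<close>

lemma sum_minus_vec_less:
  fixes m n :: "nat ^ 'd"
  assumes "n \<le> m" "n \<noteq> 0"
  shows "(\<Sum>i\<in>UNIV. (m - n) $ i) < (\<Sum>i\<in>UNIV. m $ i)"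
proof (rule sum_strict_mono_ex1)
  obtain i where "n $ i \<noteq> 0" using assms(2) by (auto simp: vec_eq_iff)
  moreover have "n $ i \<le> m $ i" using assms(1) by (simp add: less_eq_vec_def)
  ultimately have "(m - n) $ i < m $ i" by simp
  then show "\<exists>i\<in>UNIV. (m - n) $ i < m $ i" by blast
qed auto

text \<open>The coefficients of the formal quotient Theta/Phi, obtained by comparing coefficients in
  Phi \<alpha> = Theta, without any claim of convergence. The condition \<open>n \<noteq> 0\<close>
  makes the recursion terminate for every R; \<open>arma_coeff_rec\<close> removes it when 0 is not
  in R.\<close>

function arma_coeff ::
    "(nat ^ 'd) set \<Rightarrow> (nat ^ 'd) set \<Rightarrow> (nat ^ 'd \<Rightarrow> complex) \<Rightarrow> (nat ^ 'd \<Rightarrow> complex) \<Rightarrow>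
     nat ^ 'd \<Rightarrow> complex" where
  "arma_coeff R S \<phi> \<theta> m = (if m = 0 then 1 else 0) + (if m \<in> S then \<theta> m else 0) +
     (\<Sum>n\<in>{n\<in>R. n \<le> m \<and> n \<noteq> 0}. \<phi> n * arma_coeff R S \<phi> \<theta> (m - n))"
  by auto
termination
  by (relation "Wellfounded.measure (\<lambda>(R, S, \<phi>, \<theta>, m). \<Sum>i\<in>UNIV. m $ i)") (use sum_minus_vec_less in auto)

declare arma_coeff.simps [simp del]

lemma arma_coeff_rec:
  assumes "0 \<notin> R"
  shows "arma_coeff R S \<phi> \<theta> m = (if m = 0 then 1 else 0) + (if m \<in> S then \<theta> m else 0) +
     (\<Sum>n\<in>{n\<in>R. n \<le> m}. \<phi> n * arma_coeff R S \<phi> \<theta> (m - n))"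
proof -
  have "{n\<in>R. n \<le> m \<and> n \<noteq> 0} = {n\<in>R. n \<le> m}" using assms by auto
  then show ?thesis by (subst arma_coeff.simps) simp
qed

lemma int_vec_add: "int_vec (k + n) = int_vec k + int_vec n"
  by (simp add: int_vec_def vec_eq_iff)

lemma int_vec_0 [simp]: "int_vec 0 = 0"
  by (simp add: int_vec_def vec_eq_iff)

lemma atMost_eq_range_int_vec: "{..t} = range (\<lambda>k. t - int_vec k)"
proof (rule set_eqI)
  fix s
  have "s \<in> range (\<lambda>k. t - int_vec k)" if "s \<le> t"
  proof (rule range_eqI)
    show "s = t - int_vec (\<chi> i. nat (t $ i - s $ i))"
      using that by (auto simp: vec_eq_iff int_vec_def less_eq_vec_def)
  qed
  then show "s \<in> {..t} \<longleftrightarrow> s \<in> range (\<lambda>k. t - int_vec k)"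
    by (auto simp: less_eq_vec_def int_vec_def)
qed

lemma vec_add_diff_inverse: "(n :: nat ^ 'd) \<le> m \<Longrightarrow> m - n + n = m"
  by (simp add: vec_eq_iff less_eq_vec_def)

lemma le_vec_add: "(n :: nat ^ 'd) \<le> k + n"
  by (simp add: less_eq_vec_def)

text \<open>Induction on the size of the down-set, with t arbitrary. To expand Y at t - n, use the
  shifted down-set of all k with k + n in D: moved back by n it lies in D but misses 0, so it is
  strictly smaller.\<close>

lemma arma_innovation_decomposition:
  fixes Y Z :: "int ^ 'd \<Rightarrow> 'a \<Rightarrow> complex"
  assumes R: "finite R" "0 \<notin> R" and S: "finite S" "0 \<notin> S"
    and Z: "\<And>t. Z t \<in> borel_measurable M"
    and eq: "ARMA_equation M R S \<phi> \<theta> Z Y"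
    and Y: "\<And>t. Y t \<in> borel_measurable (past_sigma M Z t)"
    and D: "finite D" "\<And>k l. k \<in> D \<Longrightarrow> l \<le> k \<Longrightarrow> l \<in> D"
  shows "\<exists>B\<in>borel_measurable (gen_sigma M borel Z ((\<lambda>k. t - int_vec k) ` (- D))).
    AE \<omega> in M. Y t \<omega> = (\<Sum>k\<in>D. arma_coeff R S \<phi> \<theta> k * Z (t - int_vec k) \<omega>) + B \<omega>"
  using D
proof (induction "card D" arbitrary: D t rule: less_induct)
  case less
  let ?\<alpha> = "arma_coeff R S \<phi> \<theta>"
  let ?G = "\<lambda>t D. gen_sigma M borel Z ((\<lambda>k. t - int_vec k) ` (- D))"
  show ?case
  proof (cases "D = {}")
    case True
    \<comment> \<open>For the empty down-set Y itself is the remainder; causality enters the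
      induction here.\<close>
    have "Y t \<in> borel_measurable (?G t D)"
      using Y[of t] by (simp add: True past_sigma_eq atMost_eq_range_int_vec)
    then show ?thesis using True by (intro bexI[of _ "Y t"]) auto
  next
    case False
    then have zero: "0 \<in> D" using less.prems(2)[of _ 0] by (force simp: less_eq_vec_def)
    define D' where "D' n = {k. k + n \<in> D}" for n
    have D'_image: "(\<lambda>k. k + n) ` D' n = {m \<in> D. n \<le> m}" for n
    proof
      show "{m \<in> D. n \<le> m} \<subseteq> (\<lambda>k. k + n) ` D' n"
      proof
        fix m assume m: "m \<in> {m \<in> D. n \<le> m}"
        then have "m = m - n + n" by (simp add: vec_add_diff_inverse)
        then show "m \<in> (\<lambda>k. k + n) ` D' n" using m unfolding D'_def by (intro image_eqI[of _ _ "m - n"]) auto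
      qed
    qed (auto simp: D'_def le_vec_add)
    have inj: "inj_on (\<lambda>k. k + n) A" for n :: "nat ^ 'd" and A by (auto simp: inj_on_def)
    have fin': "finite (D' n)" for n
    proof (rule finite_imageD[OF _ inj])
      show "finite ((\<lambda>k. k + n) ` D' n)" unfolding D'_image using less.prems(1) by simp
    qed
    have IH: "\<exists>B\<in>borel_measurable (?G (t - int_vec n) (D' n)).
        AE \<omega> in M. Y (t - int_vec n) \<omega> = (\<Sum>k\<in>D' n. ?\<alpha> k * Z (t - int_vec n - int_vec k) \<omega>) + B \<omega>"
      if n: "n \<in> R" for n
    proof (rule less.hyps)
      have "n \<noteq> 0" using n R by auto
      have "card (D' n) = card {m \<in> D. n \<le> m}" by (simp add: card_image[OF inj] flip: D'_image)
      also have "\<dots> < card D"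
      proof (rule psubset_card_mono[OF less.prems(1)])
        have "\<not> n \<le> 0" using \<open>n \<noteq> 0\<close> by (auto simp: less_eq_vec_def vec_eq_iff)
        then show "{m \<in> D. n \<le> m} \<subset> D" using zero by blast
      qed
      finally show "card (D' n) < card D" .
      show "l \<in> D' n" if "k \<in> D' n" "l \<le> k" for k l
        using that less.prems(2)[of "k + n" "l + n"] by (simp add: D'_def less_eq_vec_def)
    qed (rule fin')
    have "\<forall>n\<in>R. \<exists>B. B \<in> borel_measurable (?G (t - int_vec n) (D' n)) \<and>
        (AE \<omega> in M. Y (t - int_vec n) \<omega> = (\<Sum>k\<in>D' n. ?\<alpha> k * Z (t - int_vec n - int_vec k) \<omega>) + B \<omega>)"
      using IH unfolding Bex_def by (rule ballI)
    from bchoice[OF this] obtain B where B: "\<And>n. n \<in> R \<Longrightarrow> B n \<in> borel_measurable (?G (t - int_vec n) (D' n))"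
      "\<And>n. n \<in> R \<Longrightarrow> AE \<omega> in M. Y (t - int_vec n) \<omega> =
        (\<Sum>k\<in>D' n. ?\<alpha> k * Z (t - int_vec n - int_vec k) \<omega>) + B n \<omega>" by auto
    have B_meas: "B n \<in> borel_measurable (?G t D)" if n: "n \<in> R" for n
    proof (rule measurable_gen_sigma_mono[OF B(1)[OF n]])
      have "t - int_vec n - int_vec k = t - int_vec (k + n)" for k by (simp add: int_vec_add)
      then show "(\<lambda>k. t - int_vec n - int_vec k) ` (- D' n) \<subseteq> (\<lambda>k. t - int_vec k) ` (- D)"
        by (auto simp: D'_def)
    qed
    \<comment> \<open>The remainder consists of the moving average terms with index outside D and
      the remainders of the shifted solutions. A shifted remainder avoids D as well, since k outside
      D' n means k + n outside D.\<close>
    define B' where "B' \<omega> = (\<Sum>n\<in>S - D. \<theta> n * Z (t - int_vec n) \<omega>) + (\<Sum>n\<in>R. \<phi> n * B n \<omega>)" for \<omega>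
    have "B' \<in> borel_measurable (?G t D)"
      unfolding B'_def[abs_def]
      by (intro borel_measurable_add borel_measurable_sum borel_measurable_times borel_measurable_const
          B_meas gen_sigma_component Z) auto
    moreover have "AE \<omega> in M. \<forall>n\<in>R. Y (t - int_vec n) \<omega> =
        (\<Sum>k\<in>D' n. ?\<alpha> k * Z (t - int_vec n - int_vec k) \<omega>) + B n \<omega>"
      using R(1) B(2) by (intro AE_finite_allI) auto
    then have "AE \<omega> in M. Y t \<omega> = (\<Sum>k\<in>D. ?\<alpha> k * Z (t - int_vec k) \<omega>) + B' \<omega>"
      using eq[unfolded ARMA_equation_def, rule_format, of t]
    proof eventually_elim
      case (elim \<omega>)
      let ?z = "\<lambda>k. Z (t - int_vec k) \<omega>"
      have inner: "(\<Sum>k\<in>D' n. ?\<alpha> k * Z (t - int_vec n - int_vec k) \<omega>) =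
          (\<Sum>m\<in>{m \<in> D. n \<le> m}. ?\<alpha> (m - n) * ?z m)" for n
      proof -
        have "(\<Sum>m\<in>{m \<in> D. n \<le> m}. ?\<alpha> (m - n) * ?z m) = (\<Sum>k\<in>D' n. ?\<alpha> (k + n - n) * ?z (k + n))"
          unfolding D'_image[symmetric] by (subst sum.reindex[OF inj]) simp
        also have "\<dots> = (\<Sum>k\<in>D' n. ?\<alpha> k * Z (t - int_vec n - int_vec k) \<omega>)"
          by (intro sum.cong) (auto simp: int_vec_add algebra_simps)
        finally show ?thesis ..
      qed
      \<comment> \<open>Insert the recursion for the coefficients; exchanging the two sums groups
        the autoregressive part by lag n, matching the decompositions from the induction
        hypothesis.\<close>
      have "(\<Sum>k\<in>D. ?\<alpha> k * ?z k) = (\<Sum>k\<in>D. (if k = 0 then 1 else 0) * ?z k) + (\<Sum>k\<in>D. (if k \<in> S then \<theta> k else 0) * ?z k)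
          + (\<Sum>m\<in>D. \<Sum>n\<in>{n\<in>R. n \<le> m}. \<phi> n * ?\<alpha> (m - n) * ?z m)"
        by (subst arma_coeff_rec[OF R(2)]) (simp add: distrib_right sum.distrib sum_distrib_right)
      also have "(\<Sum>k\<in>D. (if k = 0 then 1 else 0) * ?z k) = Z t \<omega>"
        using zero less.prems(1) by (simp add: if_distrib[of "\<lambda>x. x * _"] sum.delta' cong: if_cong)
      also have "(\<Sum>k\<in>D. (if k \<in> S then \<theta> k else 0) * ?z k) = (\<Sum>k\<in>S \<inter> D. \<theta> k * ?z k)"
        using less.prems(1) by (intro sum.mono_neutral_cong_right) auto
      also have "(\<Sum>m\<in>D. \<Sum>n\<in>{n\<in>R. n \<le> m}. \<phi> n * ?\<alpha> (m - n) * ?z m) =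
          (\<Sum>n\<in>R. \<phi> n * (\<Sum>m\<in>{m\<in>D. n \<le> m}. ?\<alpha> (m - n) * ?z m))"
        unfolding sum_distrib_left mult.assoc by (rule sum.swap_restrict[OF less.prems(1) R(1)])
      finally have \<alpha>: "(\<Sum>k\<in>D. ?\<alpha> k * ?z k) = Z t \<omega> + (\<Sum>k\<in>S \<inter> D. \<theta> k * ?z k)
          + (\<Sum>n\<in>R. \<phi> n * (\<Sum>m\<in>{m\<in>D. n \<le> m}. ?\<alpha> (m - n) * ?z m))" .
      have "(\<Sum>n\<in>R. \<phi> n * Y (t - int_vec n) \<omega>) =
          (\<Sum>n\<in>R. \<phi> n * (\<Sum>m\<in>{m\<in>D. n \<le> m}. ?\<alpha> (m - n) * ?z m)) + (\<Sum>n\<in>R. \<phi> n * B n \<omega>)"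
        unfolding sum.distrib[symmetric] using elim(1)
        by (intro sum.cong refl) (simp add: inner distrib_left)
      moreover have "(\<Sum>n\<in>S. \<theta> n * ?z n) = (\<Sum>n\<in>S \<inter> D. \<theta> n * ?z n) + (\<Sum>n\<in>S - D. \<theta> n * ?z n)"
        by (rule sum.Int_Diff[OF S(1)])
      moreover have "Y t \<omega> = Z t \<omega> + (\<Sum>n\<in>S. \<theta> n * ?z n) + (\<Sum>n\<in>R. \<phi> n * Y (t - int_vec n) \<omega>)"
        using elim(2) by (simp add: algebra_simps)
      ultimately show ?case unfolding \<alpha> B'_def by simp
    qed
    ultimately show ?thesis by blast
  qed
qed

section \<open>Multivariate power series\<close>

definition vec_sum :: "nat ^ 'd \<Rightarrow> nat" where "vec_sum k = (\<Sum>i\<in>UNIV. k $ i)"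

lemma vec_power_0 [simp]: "vec_power z 0 = 1"
  by (simp add: vec_power_def)

lemma vec_power_add: "vec_power z (k + n) = vec_power z k * vec_power z n"
  by (simp add: vec_power_def power_add prod.distrib)

lemma norm_vec_power_le:
  assumes "\<And>i. cmod (z $ i) \<le> \<rho>"
  shows "cmod (vec_power z k) \<le> \<rho> ^ vec_sum k"
proof -
  have "cmod (vec_power z k) = (\<Prod>i\<in>UNIV. cmod (z $ i) ^ (k $ i))"
    by (simp add: vec_power_def prod_norm[symmetric] norm_power)
  also have "\<dots> \<le> (\<Prod>i\<in>UNIV. \<rho> ^ (k $ i))"
    by (intro prod_mono conjI power_mono assms) auto
  also have "\<dots> = \<rho> ^ vec_sum k" by (simp add: power_sum vec_sum_def)
  finally show ?thesis .
qed

lemma polydisc_radius: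
  fixes z :: "complex ^ 'd"
  assumes "z \<in> polydisc"
  shows "\<exists>\<rho>. 0 < \<rho> \<and> \<rho> < 1 \<and> (\<forall>i. cmod (z $ i) < \<rho>)"
proof -
  define \<mu> where "\<mu> = Max (range (\<lambda>i. cmod (z $ i)))"
  have le: "cmod (z $ i) \<le> \<mu>" for i unfolding \<mu>_def by (intro Max_ge) auto
  have "\<mu> \<in> range (\<lambda>i. cmod (z $ i))" unfolding \<mu>_def by (intro Max_in) auto
  then have lt: "\<mu> < 1" "\<mu> \<ge> 0" using assms by (auto simp: polydisc_def)
  show ?thesis
  proof (intro exI[of _ "(\<mu> + 1) / 2"] conjI allI)
    show "cmod (z $ i) < (\<mu> + 1) / 2" for i using le[of i] lt by simp
  qed (use lt in auto)
qed

lemma sum_atMost_vec_prod: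
  fixes f :: "'d :: finite \<Rightarrow> nat \<Rightarrow> 'a :: comm_semiring_1"
  shows "(\<Sum>k\<in>{..n :: nat ^ 'd}. \<Prod>i\<in>UNIV. f i (k $ i)) = (\<Prod>i\<in>UNIV. \<Sum>j\<in>{..n $ i}. f i j)"
proof -
  have "(\<Prod>i\<in>UNIV. \<Sum>j\<in>{..n $ i}. f i j) = (\<Sum>h\<in>PiE UNIV (\<lambda>i. {..n $ i}). \<Prod>i\<in>UNIV. f i (h i))"
    by (rule prod_sum_PiE) auto
  also have "\<dots> = (\<Sum>k\<in>{..n}. \<Prod>i\<in>UNIV. f i (k $ i))"
    by (rule sum.reindex_bij_witness[where i = vec_nth and j = "\<lambda>h. \<chi> i. h i"])
       (auto simp: less_eq_vec_def PiE_def)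
  finally show ?thesis ..
qed

text \<open>Over a rectangle the sum factors into one-dimensional geometric sums, each at most 1 /
  (1 - x); every finite set lies in a rectangle.\<close>

lemma summable_on_power_vec_sum:
  fixes x :: real
  assumes x: "0 \<le> x" "x < 1"
  shows "(\<lambda>k :: nat ^ 'd. x ^ vec_sum k) summable_on UNIV"
proof (rule nonneg_bdd_above_summable_on)
  show "bdd_above (sum (\<lambda>k :: nat ^ 'd. x ^ vec_sum k) ` {F. F \<subseteq> UNIV \<and> finite F})"
  proof (rule bdd_aboveI2)
    fix F :: "(nat ^ 'd) set" assume "F \<in> {F. F \<subseteq> UNIV \<and> finite F}"
    then obtain n where n: "F \<subseteq> {..n}" using finite_subset_atMost_nat_vec[of F] by auto
    have "(\<Sum>k\<in>F. x ^ vec_sum k) \<le> (\<Sum>k\<in>{..n}. x ^ vec_sum k)"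
      using n x by (intro sum_mono2) auto
    also have "\<dots> = (\<Prod>i\<in>UNIV. \<Sum>j\<in>{..n $ i}. x ^ j)"
      using sum_atMost_vec_prod[of "\<lambda>_ j. x ^ j" n] by (simp add: vec_sum_def power_sum)
    also have "\<dots> \<le> (\<Prod>i\<in>(UNIV :: 'd set). 1 / (1 - x))"
    proof (intro prod_mono conjI)
      fix i :: 'd
      have "(\<Sum>j\<in>{..n $ i}. x ^ j) \<le> (\<Sum>j. x ^ j)"
        using x by (intro sum_le_suminf) (auto intro: summable_geometric)
      then show "(\<Sum>j\<in>{..n $ i}. x ^ j) \<le> 1 / (1 - x)" using x by (simp add: suminf_geometric)
    qed (use x in \<open>auto intro: sum_nonneg\<close>)
    finally show "(\<Sum>k\<in>F. x ^ vec_sum k) \<le> (\<Prod>i\<in>(UNIV :: 'd set). 1 / (1 - x))" .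
  qed
qed (use x in auto)

lemma summable_on_power_series:
  fixes \<alpha> :: "nat ^ 'd \<Rightarrow> complex"
  assumes bd: "\<And>k. cmod (\<alpha> k) \<le> C" and z: "z \<in> polydisc"
  shows "(\<lambda>k. \<alpha> k * vec_power z k) summable_on UNIV"
proof -
  obtain \<rho> where \<rho>: "0 < \<rho>" "\<rho> < 1" "\<And>i. cmod (z $ i) < \<rho>" using polydisc_radius[OF z] by blast
  have "(\<lambda>k :: nat ^ 'd. C * \<rho> ^ vec_sum k) summable_on UNIV"
    using \<rho> by (intro summable_on_cmult_right summable_on_power_vec_sum) auto
  then have "(\<lambda>k. norm (\<alpha> k * vec_power z k)) summable_on UNIV"
  proof (rule summable_on_comparison_test)
    fix k
    have "0 \<le> C" using bd[of k] norm_ge_zero order.trans by blast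
    then show "norm (\<alpha> k * vec_power z k) \<le> C * \<rho> ^ vec_sum k"
      unfolding norm_mult by (intro mult_mono bd norm_vec_power_le) (auto intro: less_imp_le \<rho>)
  qed auto
  then show ?thesis by (rule abs_summable_summable)
qed

lemma filterlim_atMost_diag_vec:
  "filterlim (\<lambda>n. {..diag_vec n :: nat ^ 'd}) (finite_subsets_at_top UNIV) sequentially"
  unfolding filterlim_finite_subsets_at_top
proof (intro allI impI)
  fix X :: "(nat ^ 'd) set" assume "finite X \<and> X \<subseteq> UNIV"
  then obtain m where m: "X \<subseteq> {..m}" using finite_subset_atMost_nat_vec[of X] by auto
  obtain j where j: "m \<le> diag_vec j" using ex_le_diag_vec by blast
  show "eventually (\<lambda>n. finite {..diag_vec n :: nat ^ 'd} \<and> X \<subseteq> {..diag_vec n} \<and> {..diag_vec n :: nat ^ 'd} \<subseteq> UNIV) sequentially"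
    using eventually_ge_at_top[of j]
  proof eventually_elim
    case (elim n)
    have "m \<le> diag_vec n" by (rule order.trans[OF j diag_vec_mono[OF elim]])
    then show ?case using m by (auto intro: order.trans)
  qed
qed

lemma has_sum_imp_diag_tendsto:
  assumes "(f has_sum l) (UNIV :: (nat ^ 'd) set)"
  shows "(\<lambda>n. \<Sum>k\<in>{..diag_vec n}. f k) \<longlonglongrightarrow> l"
  using assms filterlim_atMost_diag_vec unfolding has_sum_def by (rule filterlim_compose)

definition vec_power_deriv :: "nat ^ 'd \<Rightarrow> complex ^ 'd \<Rightarrow> complex ^ 'd \<Rightarrow> complex" where
  "vec_power_deriv k z h =
     (\<Sum>i\<in>UNIV. h $ i * of_nat (k $ i) * z $ i ^ (k $ i - 1) * (\<Prod>j\<in>UNIV - {i}. z $ j ^ (k $ j)))"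

lemma has_derivative_vec_power:
  "((\<lambda>z. vec_power z k) has_derivative vec_power_deriv k z) (at z within A)"
proof -
  have "((\<lambda>z. z $ i ^ (k $ i)) has_derivative (\<lambda>h. h $ i * of_nat (k $ i) * z $ i ^ (k $ i - 1))) (at z within A)" for i
    by (rule has_derivative_eq_rhs[OF has_derivative_power[OF
            bounded_linear.has_derivative[OF bounded_linear_vec_nth has_derivative_ident]]]) auto
  then show ?thesis unfolding vec_power_def vec_power_deriv_def by (rule has_derivative_prod)
qed

lemma norm_vec_power_deriv_le:
  assumes \<rho>: "0 < \<rho>" and z: "\<And>i. cmod (z $ i) \<le> \<rho>"
  shows "cmod (vec_power_deriv k z h) \<le> real (vec_sum k) * \<rho> ^ vec_sum k / \<rho> * norm h"
proof -
  have "cmod (vec_power_deriv k z h) \<le> (\<Sum>i\<in>UNIV. real (k $ i) * (\<rho> ^ vec_sum k / \<rho>) * norm h)"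
    unfolding vec_power_deriv_def
  proof (rule sum_norm_le)
    fix i
    have split: "\<rho> ^ vec_sum k = \<rho> ^ (k $ i) * (\<Prod>j\<in>UNIV - {i}. \<rho> ^ (k $ j))"
      unfolding vec_sum_def power_sum by (subst prod.remove[of _ i]) auto
    have p: "cmod (\<Prod>j\<in>UNIV - {i}. z $ j ^ (k $ j)) \<le> (\<Prod>j\<in>UNIV - {i}. \<rho> ^ (k $ j))"
      unfolding prod_norm[symmetric] by (intro prod_mono conjI) (auto simp: norm_power intro!: power_mono z)
    have q: "real (k $ i) * cmod (z $ i) ^ (k $ i - 1) \<le> real (k $ i) * (\<rho> ^ (k $ i) / \<rho>)"
    proof (cases "k $ i")
      case (Suc m)
      then have "cmod (z $ i) ^ (k $ i - 1) \<le> \<rho> ^ (k $ i) / \<rho>"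
        using \<rho> power_mono[OF z[of i] norm_ge_zero, of m] by simp
      then show ?thesis by (rule mult_left_mono) simp
    qed simp
    have "cmod (h $ i * of_nat (k $ i) * z $ i ^ (k $ i - 1) * (\<Prod>j\<in>UNIV - {i}. z $ j ^ (k $ j))) =
        cmod (h $ i) * (real (k $ i) * cmod (z $ i) ^ (k $ i - 1)) * cmod (\<Prod>j\<in>UNIV - {i}. z $ j ^ (k $ j))"
      by (simp add: norm_mult norm_power mult.assoc)
    also have "\<dots> \<le> norm h * (real (k $ i) * (\<rho> ^ (k $ i) / \<rho>)) * (\<Prod>j\<in>UNIV - {i}. \<rho> ^ (k $ j))"
      using \<rho> by (intro mult_mono[OF mult_mono[OF Finite_Cartesian_Product.norm_nth_le q] p]) auto
    also have "\<dots> = real (k $ i) * (\<rho> ^ vec_sum k / \<rho>) * norm h"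
      unfolding split by (simp add: mult_ac)
    finally show "cmod (h $ i * of_nat (k $ i) * z $ i ^ (k $ i - 1) * (\<Prod>j\<in>UNIV - {i}. z $ j ^ (k $ j)))
        \<le> real (k $ i) * (\<rho> ^ vec_sum k / \<rho>) * norm h" .
  qed
  also have "\<dots> = real (vec_sum k) * \<rho> ^ vec_sum k / \<rho> * norm h"
  proof -
    have "real (vec_sum k) = (\<Sum>i\<in>UNIV. real (k $ i))" by (simp add: vec_sum_def)
    then show ?thesis by (simp only: sum_distrib_right sum_divide_distrib times_divide_eq_right)
  qed
  finally show ?thesis .
qed

text \<open>Write \<rho> as the square of \<sigma> < 1. One power of \<sigma> absorbs the factor
  given by the total degree, and the other remains as a convergent majorant.\<close>

lemma summable_on_deriv_bound:
  fixes \<rho> :: real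
  assumes \<rho>: "0 < \<rho>" "\<rho> < 1"
  shows "(\<lambda>k :: nat ^ 'd. C * (real (vec_sum k) * \<rho> ^ vec_sum k / \<rho>)) summable_on UNIV"
proof (rule summable_on_cmult_right)
  define \<sigma> where "\<sigma> = sqrt \<rho>"
  have \<sigma>: "0 < \<sigma>" "\<sigma> < 1" "\<rho> = \<sigma> * \<sigma>" using \<rho> by (auto simp: \<sigma>_def)
  have "(\<lambda>n. of_nat n * \<sigma> ^ n) \<longlonglongrightarrow> 0" using \<sigma> by (intro powser_times_n_limit_0) auto
  then have "Bseq (\<lambda>n. real n * \<sigma> ^ n)" by (intro convergent_imp_Bseq) (auto simp: convergent_def)
  then obtain B where B: "\<And>n. norm (real n * \<sigma> ^ n) \<le> B" by (auto simp: Bseq_def)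
  have "(\<lambda>k :: nat ^ 'd. B / \<rho> * \<sigma> ^ vec_sum k) summable_on UNIV"
    using \<sigma> by (intro summable_on_cmult_right summable_on_power_vec_sum) auto
  then show "(\<lambda>k :: nat ^ 'd. real (vec_sum k) * \<rho> ^ vec_sum k / \<rho>) summable_on UNIV"
  proof (rule summable_on_comparison_test)
    fix k :: "nat ^ 'd"
    have "real (vec_sum k) * \<rho> ^ vec_sum k / \<rho> = (real (vec_sum k) * \<sigma> ^ vec_sum k) * \<sigma> ^ vec_sum k / \<rho>"
      by (simp add: \<sigma>(3) power_mult_distrib)
    also have "\<dots> \<le> B * \<sigma> ^ vec_sum k / \<rho>"
      using B[of "vec_sum k"] \<sigma> \<rho> by (intro divide_right_mono mult_right_mono) auto
    finally show "real (vec_sum k) * \<rho> ^ vec_sum k / \<rho> \<le> B / \<rho> * \<sigma> ^ vec_sum k" by simp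
  qed (use \<rho> in auto)
qed

text \<open>Termwise differentiation on a smaller polydisc, where the series of derivatives has a
  majorant independent of the point. Complex linearity of the derivative is inherited from the
  terms.\<close>

theorem mv_holomorphic_on_power_series:
  fixes \<alpha> :: "nat ^ 'd \<Rightarrow> complex"
  assumes bd: "\<And>k. cmod (\<alpha> k) \<le> C"
    and f: "power_series_expansion f \<alpha>"
  shows "mv_holomorphic_on f polydisc"
  unfolding mv_holomorphic_on_def
proof
  fix z0 :: "complex ^ 'd" assume z0: "z0 \<in> polydisc"
  obtain \<rho> where \<rho>: "0 < \<rho>" "\<rho> < 1" "\<And>i. cmod (z0 $ i) < \<rho>" using polydisc_radius[OF z0] by blast
  \<comment> \<open>A neighbourhood of the point that is also convex, as differentiating the limit
    of a sequence of functions requires.\<close>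
  define A where "A = {z :: complex ^ 'd. \<forall>i. z $ i \<in> ball 0 \<rho>}"
  have A_sub: "z \<in> polydisc" if "z \<in> A" for z
  proof -
    have "cmod (z $ i) < \<rho>" for i using that by (simp add: A_def)
    then show ?thesis using \<rho>(2) by (auto simp: polydisc_def intro: less_trans)
  qed
  have A_bd: "cmod (z $ i) \<le> \<rho>" if "z \<in> A" for z i using that by (auto simp: A_def intro: less_imp_le)
  have z0A: "z0 \<in> A" using \<rho> by (simp add: A_def)
  have "open A"
  proof -
    have "A = (\<Inter>i\<in>UNIV. (\<lambda>z. z $ i) -` ball 0 \<rho>)" by (auto simp: A_def)
    then show ?thesis by (auto intro!: open_INT open_vimage_vec_nth)
  qed
  have "convex A"
  proof -
    have "A = (\<Inter>i\<in>UNIV. (\<lambda>z. z $ i) -` ball 0 \<rho>)" by (auto simp: A_def)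
    then show ?thesis
      by (auto intro!: convex_INT convex_linear_vimage bounded_linear.linear[OF bounded_linear_vec_nth])
  qed
  have C: "0 \<le> C" using bd[of 0] norm_ge_zero order.trans by blast
  define b where "b k = C * (real (vec_sum k) * \<rho> ^ vec_sum k / \<rho>)" for k :: "nat ^ 'd"
  have b_sum: "b summable_on UNIV" unfolding b_def by (rule summable_on_deriv_bound[OF \<rho>(1,2)])
  have deriv_bd: "cmod (\<alpha> k * vec_power_deriv k z h) \<le> b k * norm h" if "z \<in> A" for k z h
  proof -
    have "cmod (\<alpha> k * vec_power_deriv k z h) \<le> C * (real (vec_sum k) * \<rho> ^ vec_sum k / \<rho> * norm h)"
      unfolding norm_mult using C by (intro mult_mono bd norm_vec_power_deriv_le \<rho> A_bd[OF that]) auto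
    then show ?thesis by (simp add: b_def mult.assoc)
  qed
  have deriv_abs: "(\<lambda>k. norm (\<alpha> k * vec_power_deriv k z h)) summable_on X" if "z \<in> A" for z h and X :: "(nat ^ 'd) set"
  proof (rule summable_on_comparison_test)
    show "(\<lambda>k. b k * norm h) summable_on X"
      by (intro summable_on_cmult_left summable_on_subset_banach[OF b_sum]) auto
  qed (use deriv_bd[OF that] in auto)
  define g' where "g' z h = (\<Sum>\<^sub>\<infinity>k. \<alpha> k * vec_power_deriv k z h)" for z h
  \<comment> \<open>This tail bounds the error of the partial derivative sums, uniformly over A and
    relative to \<open>norm h\<close>.\<close>
  have tail: "(\<lambda>n. \<Sum>\<^sub>\<infinity>k\<in>- {..diag_vec n}. b k) \<longlonglongrightarrow> 0"
  proof -
    have "(\<lambda>n. infsum b UNIV - (\<Sum>k\<in>{..diag_vec n}. b k)) \<longlonglongrightarrow> infsum b UNIV - infsum b UNIV"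
      using b_sum by (intro tendsto_intros has_sum_imp_diag_tendsto) (simp add: has_sum_infsum)
    moreover have "infsum b UNIV - (\<Sum>k\<in>{..diag_vec n}. b k) = (\<Sum>\<^sub>\<infinity>k\<in>- {..diag_vec n}. b k)" for n
      using infsum_Diff[OF b_sum, of "{..diag_vec n}"] by (simp add: Compl_eq_Diff_UNIV)
    ultimately show ?thesis by simp
  qed
  have "\<exists>g. \<forall>z\<in>A. (\<lambda>n. \<Sum>k\<in>{..diag_vec n}. \<alpha> k * vec_power z k) \<longlonglongrightarrow> g z \<and> (g has_derivative g' z) (at z within A)"
  proof (rule has_derivative_sequence[OF \<open>convex A\<close>])
    show "((\<lambda>z. \<Sum>k\<in>{..diag_vec n}. \<alpha> k * vec_power z k) has_derivative
        (\<lambda>h. \<Sum>k\<in>{..diag_vec n}. \<alpha> k * vec_power_deriv k z h)) (at z within A)" for n z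
      by (intro has_derivative_sum has_derivative_mult_right has_derivative_vec_power)
    show "(\<lambda>n. \<Sum>k\<in>{..diag_vec n}. \<alpha> k * vec_power z0 k) \<longlonglongrightarrow> f z0"
      using f z0 by (intro has_sum_imp_diag_tendsto) (simp add: power_series_expansion_def)
    fix e :: real assume "e > 0"
    then have "eventually (\<lambda>n. (\<Sum>\<^sub>\<infinity>k\<in>- {..diag_vec n}. b k) < e) sequentially"
      by (rule order_tendstoD(2)[OF tail])
    then show "\<forall>\<^sub>F n in sequentially. \<forall>z\<in>A. \<forall>h. norm ((\<Sum>k\<in>{..diag_vec n}. \<alpha> k * vec_power_deriv k z h) - g' z h) \<le> e * norm h"
    proof eventually_elim
      case (elim n)
      show ?case
      proof (intro ballI allI)
        fix z h assume z: "z \<in> A"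
        let ?t = "\<lambda>k. \<alpha> k * vec_power_deriv k z h"
        have s: "?t summable_on UNIV" by (rule abs_summable_summable[OF deriv_abs[OF z]])
        have "g' z h - (\<Sum>k\<in>{..diag_vec n}. ?t k) = (\<Sum>\<^sub>\<infinity>k\<in>- {..diag_vec n}. ?t k)"
          using infsum_Diff[OF s, of "{..diag_vec n}"] by (simp add: g'_def Compl_eq_Diff_UNIV)
        then have "norm ((\<Sum>k\<in>{..diag_vec n}. ?t k) - g' z h) = norm (\<Sum>\<^sub>\<infinity>k\<in>- {..diag_vec n}. ?t k)"
          by (subst norm_minus_commute) (rule arg_cong)
        also have "\<dots> \<le> (\<Sum>\<^sub>\<infinity>k\<in>- {..diag_vec n}. norm (?t k))"
          by (rule norm_infsum_bound[OF deriv_abs[OF z]])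
        also have "\<dots> \<le> (\<Sum>\<^sub>\<infinity>k\<in>- {..diag_vec n}. b k * norm h)"
          by (intro infsum_mono deriv_abs[OF z] deriv_bd[OF z] summable_on_cmult_left
              summable_on_subset_banach[OF b_sum]) auto
        also have "\<dots> = (\<Sum>\<^sub>\<infinity>k\<in>- {..diag_vec n}. b k) * norm h"
          by (rule infsum_cmult_left') 
        also have "\<dots> \<le> e * norm h" using elim by (intro mult_right_mono) auto
        finally show "norm ((\<Sum>k\<in>{..diag_vec n}. ?t k) - g' z h) \<le> e * norm h" .
      qed
    qed
  qed (rule z0A)
  then obtain g where g: "\<And>z. z \<in> A \<Longrightarrow> (\<lambda>n. \<Sum>k\<in>{..diag_vec n}. \<alpha> k * vec_power z k) \<longlonglongrightarrow> g z"
    "\<And>z. z \<in> A \<Longrightarrow> (g has_derivative g' z) (at z within A)" by blast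
  have gf: "g z = f z" if z: "z \<in> A" for z
  proof (rule LIMSEQ_unique[OF g(1)[OF z]])
    show "(\<lambda>n. \<Sum>k\<in>{..diag_vec n}. \<alpha> k * vec_power z k) \<longlonglongrightarrow> f z"
      using f A_sub[OF z] by (intro has_sum_imp_diag_tendsto) (simp add: power_series_expansion_def)
  qed
  have "(g has_derivative g' z0) (at z0)"
    using g(2)[OF z0A] unfolding at_within_open[OF z0A \<open>open A\<close>] .
  then have "(f has_derivative g' z0) (at z0)"
    by (rule has_derivative_transform_within_open[OF _ \<open>open A\<close> z0A gf])
  moreover have "g' z0 (c *s v) = c * g' z0 v" for c v
  proof -
    have *: "\<alpha> k * vec_power_deriv k z0 (c *s v) = c * (\<alpha> k * vec_power_deriv k z0 v)" for k
      by (simp add: vec_power_deriv_def sum_distrib_left mult_ac)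
    show ?thesis unfolding g'_def * by (rule infsum_cmult_right')
  qed
  ultimately show "\<exists>f'. (f has_derivative f') (at z0) \<and> (\<forall>c v. f' (c *s v) = c * f' v)" by blast
qed

section \<open>Parseval on the torus and the Hardy norm\<close>

definition torus_box :: "(real ^ 'd) set" where
  "torus_box = {t. \<forall>i. - pi < t $ i \<and> t $ i \<le> pi}"

lemma torus_box_borel [measurable]: "torus_box \<in> sets borel"
proof -
  have "torus_box = (\<Inter>i\<in>UNIV. {t :: real ^ 'd. - pi < t $ i \<and> t $ i \<le> pi})" by (auto simp: torus_box_def)
  also have "\<dots> \<in> sets borel" by (intro sets.countable_INT') auto
  finally show ?thesis .
qed

text \<open>Fubini for functions with separated variables. Lebesgue measure on the vector type is
  the image of a product measure indexed by \<open>Basis\<close>; the bijection between coordinates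
  i and unit vectors \<open>axis i 1\<close> translates the index.\<close>

lemma
  fixes f :: "'d :: finite \<Rightarrow> real \<Rightarrow> complex"
  assumes f: "\<And>i. integrable lborel (f i)"
  shows integral_prod_component_cart: "(LINT t|lborel. (\<Prod>i\<in>UNIV. f i (t $ i))) = (\<Prod>i\<in>UNIV. (LINT x|lborel. f i x))"
    and integrable_prod_component_cart: "integrable lborel (\<lambda>t :: real ^ 'd. \<Prod>i\<in>UNIV. f i (t $ i))"
proof -
  interpret product_sigma_finite "\<lambda>_ :: real ^ 'd. lborel :: real measure" ..
  define ix :: "real ^ 'd \<Rightarrow> 'd" where "ix = inv (\<lambda>i. axis i (1 :: real))"
  have inj: "inj (\<lambda>i :: 'd. axis i (1 :: real))" by (auto simp: inj_on_def axis_eq_axis)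
  have ix: "ix (axis i 1) = i" for i unfolding ix_def by (rule inv_f_f[OF inj])
  have Basis: "(Basis :: (real ^ 'd) set) = range (\<lambda>i. axis i 1)" by (auto simp: Basis_vec_def)
  let ?g = "\<lambda>b x. f (ix b) x"
  let ?T = "\<lambda>h :: real ^ 'd \<Rightarrow> real. \<Sum>b\<in>Basis. h b *\<^sub>R b"
  have prod_eq: "(\<Prod>i\<in>UNIV. h (axis i 1) i) = (\<Prod>b\<in>Basis. h b (ix b))" for h :: "real ^ 'd \<Rightarrow> 'd \<Rightarrow> complex"
    unfolding Basis by (subst prod.reindex[OF inj]) (simp add: ix)
  have comp: "?T h $ i = h (axis i 1)" for h i
  proof -
    have "?T h $ i = ?T h \<bullet> axis i 1" by (simp add: cart_eq_inner_axis)
    also have "\<dots> = h (axis i 1)" by (rule inner_sum_left_Basis) simp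
    finally show ?thesis .
  qed
  have eq: "(\<Prod>i\<in>UNIV. f i (?T h $ i)) = (\<Prod>b\<in>Basis. ?g b (h b))" for h
    unfolding comp by (rule prod_eq[of "\<lambda>b i. f i (h b)"])
  have [measurable]: "f i \<in> borel_measurable borel" for i using f[of i] by auto
  have meas: "(\<lambda>t :: real ^ 'd. \<Prod>i\<in>UNIV. f i (t $ i)) \<in> borel_measurable borel" by measurable
  have T: "?T \<in> measurable (Pi\<^sub>M Basis (\<lambda>_. lborel)) borel" by measurable
  have int: "integrable (Pi\<^sub>M Basis (\<lambda>_. lborel)) (\<lambda>h. \<Prod>b\<in>Basis. ?g b (h b))"
    by (rule product_integrable_prod) (use f in auto)
  show "integrable lborel (\<lambda>t :: real ^ 'd. \<Prod>i\<in>UNIV. f i (t $ i))"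
    unfolding lborel_eq[where 'a = "real ^ 'd"] integrable_distr_eq[OF T meas] eq by (rule int)
  have "(LINT t|lborel. (\<Prod>i\<in>UNIV. f i (t $ i))) = (LINT h|Pi\<^sub>M Basis (\<lambda>_. lborel). (\<Prod>b\<in>Basis. ?g b (h b)))"
    unfolding lborel_eq[where 'a = "real ^ 'd"] integral_distr[OF T meas] eq ..
  also have "\<dots> = (\<Prod>b\<in>Basis. (LINT x|lborel. ?g b x))"
    by (rule product_integral_prod) (use f in auto)
  also have "\<dots> = (\<Prod>i\<in>UNIV. (LINT x|lborel. f i x))"
    by (rule prod_eq[of "\<lambda>_ i. LINT x|lborel. f i x", symmetric])
  finally show "(LINT t|lborel. (\<Prod>i\<in>UNIV. f i (t $ i))) = (\<Prod>i\<in>UNIV. (LINT x|lborel. f i x))" .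
qed

lemma
  shows integrable_circle: "integrable lborel (\<lambda>x. indicator {- pi<..pi} x * exp (- \<i> * of_int m * of_real x) :: complex)"
    and integral_circle: "(LINT x|lborel. indicator {- pi<..pi} x * exp (- \<i> * of_int m * of_real x) :: complex) =
      (if m = 0 then 2 * pi else 0)"
proof -
  let ?e = "\<lambda>x :: real. exp (- \<i> * of_int m * of_real x)"
  have "set_integrable lborel {- pi..pi} ?e"
    by (rule borel_integrable_atLeastAtMost') (intro continuous_intros)
  then have "set_integrable lborel {- pi<..pi} ?e"
    by (rule set_integrable_subset) auto
  moreover have eq: "(\<lambda>x. indicator {- pi<..pi} x *\<^sub>R ?e x) = (\<lambda>x. indicator {- pi<..pi} x * ?e x)"
    by (auto simp: fun_eq_iff indicator_def)
  ultimately show "integrable lborel (\<lambda>x. indicator {- pi<..pi} x * ?e x)" by (simp add: set_integrable_def)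
  have "(LINT x|lborel. indicator {- pi<..pi} x * ?e x) = (LINT x|lborel. indicator {- pi<..pi} x *\<^sub>R ?e x)"
    by (simp only: eq)
  also have "\<dots> = (LBINT x=-pi..pi. ?e x)"
    by (subst interval_integral_Ioc) (simp_all add: set_lebesgue_integral_def)
  also have "\<dots> = (if m = 0 then 2 * pi else 0)"
  proof (cases "m = 0")
    case True
    have "(LBINT x=-pi..pi. (1 :: complex)) = of_real pi - of_real (- pi)"
      by (rule interval_integral_FTC_finite)
         (auto intro!: continuous_intros derivative_eq_intros simp: has_vector_derivative_def fun_eq_iff scaleR_conv_of_real)
    then show ?thesis using True by simp
  next
    case False
    define F where "F x = ?e x / (- \<i> * of_int m)" for x :: real
    have "(LBINT x=-pi..pi. ?e x) = F pi - F (- pi)"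
    proof (rule interval_integral_FTC_finite)
      fix x
      have "((\<lambda>z. exp (- \<i> * of_int m * z) / (- \<i> * of_int m)) has_field_derivative ?e x) (at (of_real x))"
        using False by (auto intro!: derivative_eq_intros)
      then show "(F has_vector_derivative ?e x) (at x within {min (- pi) pi..max (- pi) pi})"
        unfolding F_def by (rule has_vector_derivative_real_field)
    qed (intro continuous_intros)
    also have "F pi - F (- pi) = 0"
    proof -
      have "?e pi = ?e (- pi)"
        by (simp add: exp_eq_polar complex_eq_iff Re_exp Im_exp mult.commute)
      then show ?thesis by (simp add: F_def)
    qed
    finally show ?thesis using False by simp
  qed
  finally show "(LINT x|lborel. indicator {- pi<..pi} x * ?e x) = (if m = 0 then 2 * pi else 0)" .
qed

definition torus_point :: "real \<Rightarrow> real ^ 'd \<Rightarrow> complex ^ 'd" where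
  "torus_point r t = (\<chi> i. of_real r * exp (- \<i> * of_real (t $ i)))"

lemma torus_point_polydisc: "0 \<le> r \<Longrightarrow> r < 1 \<Longrightarrow> torus_point r t \<in> polydisc"
  by (simp add: torus_point_def polydisc_def norm_mult)

lemma vec_power_torus_point:
  "vec_power (torus_point r t) k = of_real (r ^ vec_sum k) * (\<Prod>i\<in>UNIV. exp (- \<i> * of_nat (k $ i) * of_real (t $ i)))"
proof -
  have "vec_power (torus_point r t) k = (\<Prod>i\<in>UNIV. of_real r ^ (k $ i) * exp (- \<i> * of_nat (k $ i) * of_real (t $ i)))"
    unfolding vec_power_def torus_point_def
    by (intro prod.cong refl) (simp add: power_mult_distrib exp_of_nat_mult[symmetric] mult_ac)
  then show ?thesis by (simp add: prod.distrib vec_sum_def power_sum)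
qed

lemma
  fixes k l :: "nat ^ 'd"
  shows torus_orthogonality: "(LINT t|lborel. indicator torus_box t *
      (vec_power (torus_point r t) k * cnj (vec_power (torus_point r t) l))) =
      (if k = l then of_real ((2 * pi) ^ CARD('d) * (r ^ vec_sum k)\<^sup>2) else 0)"
    and torus_integrable: "integrable lborel (\<lambda>t :: real ^ 'd. indicator torus_box t *
      (vec_power (torus_point r t) k * cnj (vec_power (torus_point r t) l)))"
proof -
  define m where "m i = int (k $ i) - int (l $ i)" for i
  define c where "c = complex_of_real (r ^ vec_sum k * r ^ vec_sum l)"
  let ?f = "\<lambda>i x. indicator {- pi<..pi} x * exp (- \<i> * of_int (m i) * of_real x) :: complex"
  have ind: "indicator torus_box t = (\<Prod>i\<in>UNIV. indicator {- pi<..pi} (t $ i) :: complex)" for t :: "real ^ 'd"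
  proof (cases "t \<in> torus_box")
    case False
    then obtain i where "t $ i \<notin> {- pi<..pi}" by (auto simp: torus_box_def)
    then have "(\<Prod>i\<in>UNIV. indicator {- pi<..pi} (t $ i) :: complex) = 0"
      by (intro prod_zero bexI[of _ i]) (simp_all add: indicator_def)
    then show ?thesis using False by simp
  qed (auto simp: torus_box_def)
  have eq: "indicator torus_box t * (vec_power (torus_point r t) k * cnj (vec_power (torus_point r t) l)) =
      c * (\<Prod>i\<in>UNIV. ?f i (t $ i))" for t :: "real ^ 'd"
  proof -
    have e: "exp (- \<i> * of_int (m i) * of_real (t $ i)) = exp (- \<i> * of_nat (k $ i) * of_real (t $ i)) *
        cnj (exp (- \<i> * of_nat (l $ i) * of_real (t $ i)))" for i
      by (simp add: exp_cnj exp_add[symmetric] m_def algebra_simps)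
    show ?thesis unfolding vec_power_torus_point ind c_def prod.distrib e
      by (simp add: cnj_prod mult_ac)
  qed
  show "integrable lborel (\<lambda>t :: real ^ 'd. indicator torus_box t *
      (vec_power (torus_point r t) k * cnj (vec_power (torus_point r t) l)))"
    unfolding eq by (intro integrable_mult_right integrable_prod_component_cart integrable_circle)
  have "(LINT t|lborel. indicator torus_box t *
      (vec_power (torus_point r t) k * cnj (vec_power (torus_point r t) l))) = c * (\<Prod>i\<in>UNIV. (LINT x|lborel. ?f i x))"
    unfolding eq integral_mult_right_zero integral_prod_component_cart[of ?f, OF integrable_circle] ..
  also have "\<dots> = c * (\<Prod>i\<in>UNIV. if m i = 0 then 2 * pi else 0)" by (simp only: integral_circle of_real_prod)
  also have "\<dots> = (if k = l then of_real ((2 * pi) ^ CARD('d) * (r ^ vec_sum k)\<^sup>2) else 0)"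
  proof (cases "k = l")
    case True
    then show ?thesis by (simp add: m_def c_def power2_eq_square)
  next
    case False
    then obtain i where "m i \<noteq> 0" by (auto simp: m_def vec_eq_iff)
    then have "(\<Prod>i\<in>UNIV. if m i = 0 then 2 * pi else 0) = 0" by (intro prod_zero) auto
    then show ?thesis using False by simp
  qed
  finally show "(LINT t|lborel. indicator torus_box t *
      (vec_power (torus_point r t) k * cnj (vec_power (torus_point r t) l))) =
      (if k = l then of_real ((2 * pi) ^ CARD('d) * (r ^ vec_sum k)\<^sup>2) else 0)" .
qed

text \<open>Expand the squared modulus into a double sum and use orthogonality of the monomials. For
  finite sums all interchanges are immediate; the passage to the full series is left to Fatou's
  lemma.\<close>

lemma torus_parseval_finite:
  fixes \<alpha> :: "nat ^ 'd \<Rightarrow> complex"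
  assumes F: "finite F"
  shows "(\<integral>\<^sup>+t\<in>torus_box. ennreal ((norm (\<Sum>k\<in>F. \<alpha> k * vec_power (torus_point r t) k))\<^sup>2) \<partial>lborel) =
    ennreal ((2 * pi) ^ CARD('d) * (\<Sum>k\<in>F. (cmod (\<alpha> k) * r ^ vec_sum k)\<^sup>2))"
proof -
  let ?v = "\<lambda>k t. vec_power (torus_point r t :: complex ^ 'd) k"
  let ?p = "\<lambda>t. \<Sum>k\<in>F. \<alpha> k * ?v k t"
  have eq: "complex_of_real (indicator torus_box t * (norm (?p t))\<^sup>2) =
      (\<Sum>k\<in>F. \<Sum>l\<in>F. \<alpha> k * cnj (\<alpha> l) * (indicator torus_box t * (?v k t * cnj (?v l t))))" for t
  proof -
    have "complex_of_real (indicator torus_box t * (norm (?p t))\<^sup>2) = indicator torus_box t * (?p t * cnj (?p t))"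
      by (simp only: of_real_mult complex_norm_square) (simp add: indicator_def)
    also have "?p t * cnj (?p t) = (\<Sum>k\<in>F. \<Sum>l\<in>F. \<alpha> k * cnj (\<alpha> l) * (?v k t * cnj (?v l t)))"
      by (simp add: cnj_sum sum_product mult_ac)
    finally show ?thesis by (simp add: sum_distrib_left mult_ac)
  qed
  have int_c: "integrable lborel (\<lambda>t. complex_of_real (indicator torus_box t * (norm (?p t))\<^sup>2))"
    unfolding eq by (intro Bochner_Integration.integrable_sum integrable_mult_right torus_integrable)
  then have int: "integrable lborel (\<lambda>t. indicator torus_box t * (norm (?p t))\<^sup>2)"
    using integrable_Re[OF int_c] by simp
  have "complex_of_real (LINT t|lborel. indicator torus_box t * (norm (?p t))\<^sup>2) =
      (LINT t|lborel. complex_of_real (indicator torus_box t * (norm (?p t))\<^sup>2))"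
    by (rule integral_complex_of_real[symmetric])
  also have "\<dots> = (\<Sum>k\<in>F. \<Sum>l\<in>F. \<alpha> k * cnj (\<alpha> l) * (LINT t|lborel. indicator torus_box t * (?v k t * cnj (?v l t))))"
    unfolding eq using torus_integrable
    by (subst Bochner_Integration.integral_sum, intro Bochner_Integration.integrable_sum integrable_mult_right torus_integrable,
        intro sum.cong refl, subst Bochner_Integration.integral_sum, intro integrable_mult_right torus_integrable) simp
  also have "\<dots> = (\<Sum>k\<in>F. \<Sum>l\<in>F. if k = l then \<alpha> k * cnj (\<alpha> k) * of_real ((2 * pi) ^ CARD('d) * (r ^ vec_sum k)\<^sup>2) else 0)"
    by (intro sum.cong refl) (simp add: torus_orthogonality)
  also have "\<dots> = (\<Sum>k\<in>F. \<alpha> k * cnj (\<alpha> k) * of_real ((2 * pi) ^ CARD('d) * (r ^ vec_sum k)\<^sup>2))"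
    using F by (simp add: sum.delta)
  also have "\<dots> = complex_of_real ((2 * pi) ^ CARD('d) * (\<Sum>k\<in>F. (cmod (\<alpha> k) * r ^ vec_sum k)\<^sup>2))"
    unfolding complex_norm_square[symmetric] by (simp add: sum_distrib_left power_mult_distrib mult_ac)
  finally have val: "(LINT t|lborel. indicator torus_box t * (norm (?p t))\<^sup>2) =
      (2 * pi) ^ CARD('d) * (\<Sum>k\<in>F. (cmod (\<alpha> k) * r ^ vec_sum k)\<^sup>2)" by (simp only: of_real_eq_iff)
  have "(\<integral>\<^sup>+t\<in>torus_box. ennreal ((norm (?p t))\<^sup>2) \<partial>lborel) = (\<integral>\<^sup>+t. ennreal (indicator torus_box t * (norm (?p t))\<^sup>2) \<partial>lborel)"
    by (intro nn_integral_cong) (auto simp: indicator_def)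
  also have "\<dots> = ennreal (LINT t|lborel. indicator torus_box t * (norm (?p t))\<^sup>2)"
    by (rule nn_integral_eq_integral[OF int]) auto
  finally show ?thesis unfolding val .
qed

text \<open>Boundedness of the coefficients gives holomorphy. For the means, Fatou's lemma along
  cubes yields the required upper bound from the finite Parseval identity, and powers of r are at
  most 1, so the bound is uniform in the radius.\<close>

theorem power_series_in_hardy_H2:
  fixes \<alpha> :: "nat ^ 'd \<Rightarrow> complex"
  assumes \<alpha>: "(\<lambda>k. (cmod (\<alpha> k))\<^sup>2) summable_on UNIV"
    and f: "power_series_expansion f \<alpha>"
  shows "f \<in> hardy_H2"
proof -
  define T where "T = (\<Sum>\<^sub>\<infinity>k. (cmod (\<alpha> k))\<^sup>2)"
  have T: "(\<Sum>k\<in>F. (cmod (\<alpha> k))\<^sup>2) \<le> T" if "finite F" for F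
    unfolding T_def using that by (intro finite_sum_le_infsum[OF \<alpha>]) auto
  have "cmod (\<alpha> k) \<le> sqrt T" for k using T[of "{k}"] by (simp add: real_le_rsqrt)
  then have hol: "mv_holomorphic_on f polydisc" using f by (rule mv_holomorphic_on_power_series)
  have "ennreal (1 / (2 * pi) ^ CARD('d)) * (\<integral>\<^sup>+t\<in>torus_box. ennreal ((norm (f (torus_point r t)))\<^sup>2) \<partial>lborel) \<le> ennreal T"
    if r: "r \<in> {0..<1}" for r
  proof -
    let ?p = "\<lambda>n t. \<Sum>k\<in>{..diag_vec n}. \<alpha> k * vec_power (torus_point r t :: complex ^ 'd) k"
    have meas[measurable]: "(\<lambda>t. vec_power (torus_point r t :: complex ^ 'd) k) \<in> borel_measurable borel" for k
      unfolding vec_power_torus_point by measurable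
    have lim: "(\<lambda>n. ennreal ((norm (?p n t))\<^sup>2) * indicator torus_box t) \<longlonglongrightarrow>
        ennreal ((norm (f (torus_point r t)))\<^sup>2) * indicator torus_box t" for t
    proof -
      have "(\<lambda>n. ?p n t) \<longlonglongrightarrow> f (torus_point r t)"
        using f torus_point_polydisc[of r t] r unfolding power_series_expansion_def
        by (intro has_sum_imp_diag_tendsto) auto
      then have "(\<lambda>n. ennreal ((norm (?p n t))\<^sup>2)) \<longlonglongrightarrow> ennreal ((norm (f (torus_point r t)))\<^sup>2)"
        by (intro tendsto_intros)
      then show ?thesis by (cases "t \<in> torus_box") auto
    qed
    have "(\<integral>\<^sup>+t\<in>torus_box. ennreal ((norm (f (torus_point r t)))\<^sup>2) \<partial>lborel) =
        (\<integral>\<^sup>+t. liminf (\<lambda>n. ennreal ((norm (?p n t))\<^sup>2) * indicator torus_box t) \<partial>lborel)"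
      by (intro nn_integral_cong lim_imp_Liminf[symmetric, OF _ lim]) simp
    also have "\<dots> \<le> liminf (\<lambda>n. \<integral>\<^sup>+t\<in>torus_box. ennreal ((norm (?p n t))\<^sup>2) \<partial>lborel)"
      by (rule nn_integral_liminf) measurable
    also have "\<dots> \<le> liminf (\<lambda>n. ennreal ((2 * pi) ^ CARD('d) * T))"
    proof (intro Liminf_mono always_eventually allI)
      fix n
      have "(\<Sum>k\<in>{..diag_vec n}. (cmod (\<alpha> k) * r ^ vec_sum k)\<^sup>2) \<le> (\<Sum>k\<in>{..diag_vec n}. (cmod (\<alpha> k))\<^sup>2)"
      proof (intro sum_mono power_mono)
        fix k :: "nat ^ 'd"
        have "r ^ vec_sum k \<le> 1" using r by (intro power_le_one) auto
        then show "cmod (\<alpha> k) * r ^ vec_sum k \<le> cmod (\<alpha> k)" by (intro mult_left_le) auto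
      qed (use r in auto)
      also have "\<dots> \<le> T" by (rule T) simp
      finally show "(\<integral>\<^sup>+t\<in>torus_box. ennreal ((norm (?p n t))\<^sup>2) \<partial>lborel) \<le> ennreal ((2 * pi) ^ CARD('d) * T)"
        unfolding torus_parseval_finite[OF finite_atMost_nat_vec] by (intro ennreal_leI mult_left_mono) auto
    qed
    also have "\<dots> = ennreal ((2 * pi) ^ CARD('d) * T)" by (rule Liminf_const) simp
    finally have "ennreal (1 / (2 * pi) ^ CARD('d)) * (\<integral>\<^sup>+t\<in>torus_box. ennreal ((norm (f (torus_point r t)))\<^sup>2) \<partial>lborel) \<le>
        ennreal (1 / (2 * pi) ^ CARD('d)) * ennreal ((2 * pi) ^ CARD('d) * T)"
      by (intro mult_left_mono) auto
    also have "\<dots> = ennreal T" by (subst ennreal_mult'[symmetric]) auto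
    finally show ?thesis .
  qed
  then have "(SUP r\<in>{0..<1::real}. ennreal (1 / (2 * pi) ^ CARD('d)) *
        (\<integral>\<^sup>+t\<in>torus_box. ennreal ((norm (f (torus_point r t)))\<^sup>2) \<partial>lborel)) \<le> ennreal T"
    by (rule SUP_least)
  also have "\<dots> < \<infinity>" by simp
  finally show ?thesis
    using hol unfolding hardy_H2_def torus_box_def torus_point_def by simp
qed

section \<open>The quotient of Theta by Phi\<close>

lemma has_sum_diff:
  fixes f g :: "'i \<Rightarrow> 'v :: real_normed_vector"
  assumes "(f has_sum a) A" "(g has_sum b) A"
  shows "((\<lambda>k. f k - g k) has_sum (a - b)) A"
  using has_sum_add[OF assms(1), of "\<lambda>k. - g k" "- b"] assms(2) by (simp add: has_sum_uminus)

lemma has_sum_sum: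
  fixes f :: "'j \<Rightarrow> 'i \<Rightarrow> 'v :: real_normed_vector"
  assumes "\<And>j. j \<in> J \<Longrightarrow> (f j has_sum a j) A"
  shows "((\<lambda>k. \<Sum>j\<in>J. f j k) has_sum (\<Sum>j\<in>J. a j)) A"
  using assms by (induction J rule: infinite_finite_induct) (auto intro: has_sum_add)

text \<open>Multiplication by the monomial of exponent n shifts the coefficient family by n; the
  recursion then says that everything cancels except the coefficients of Theta.\<close>

lemma arma_coeff_power_series:
  fixes R S :: "(nat ^ 'd) set"
  assumes R: "finite R" "0 \<notin> R" and S: "finite S"
    and f: "((\<lambda>k. arma_coeff R S \<phi> \<theta> k * vec_power z k) has_sum f) UNIV"
  shows "AR_poly R \<phi> z * f = MA_poly S \<theta> z"
proof -
  let ?\<alpha> = "arma_coeff R S \<phi> \<theta>"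
  have shift: "((\<lambda>m. if n \<le> m then ?\<alpha> (m - n) * vec_power z m else 0) has_sum vec_power z n * f) UNIV" for n
  proof -
    have inj: "inj (\<lambda>k. k + n)" by (auto simp: inj_on_def)
    have range: "range (\<lambda>k. k + n) = {m. n \<le> m}"
    proof
      show "{m. n \<le> m} \<subseteq> range (\<lambda>k. k + n)"
        using vec_add_diff_inverse by (auto intro!: range_eqI[OF sym])
    qed (auto simp: le_vec_add)
    have "((\<lambda>k. vec_power z n * (?\<alpha> k * vec_power z k)) has_sum vec_power z n * f) UNIV"
      by (rule has_sum_cmult_right[OF f])
    moreover have "(\<lambda>k. vec_power z n * (?\<alpha> k * vec_power z k)) = (\<lambda>m. ?\<alpha> (m - n) * vec_power z m) \<circ> (\<lambda>k. k + n)"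
      by (auto simp: fun_eq_iff vec_power_add mult_ac)
    ultimately have "((\<lambda>m. ?\<alpha> (m - n) * vec_power z m) has_sum vec_power z n * f) {m. n \<le> m}"
      using has_sum_reindex[OF inj, of "\<lambda>m. ?\<alpha> (m - n) * vec_power z m"] by (simp only: range)
    then show ?thesis
      by (subst (asm) has_sum_cong_neutral[where T = UNIV and g = "\<lambda>m. if n \<le> m then ?\<alpha> (m - n) * vec_power z m else 0"]) auto
  qed
  have "((\<lambda>m. \<Sum>n\<in>R. \<phi> n * (if n \<le> m then ?\<alpha> (m - n) * vec_power z m else 0)) has_sum (\<Sum>n\<in>R. \<phi> n * (vec_power z n * f))) UNIV"
    by (intro has_sum_sum has_sum_cmult_right shift)
  from has_sum_diff[OF f this]
  have "((\<lambda>m. ?\<alpha> m * vec_power z m - (\<Sum>n\<in>R. \<phi> n * (if n \<le> m then ?\<alpha> (m - n) * vec_power z m else 0)))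
      has_sum (AR_poly R \<phi> z * f)) UNIV"
    by (simp add: AR_poly_def left_diff_distrib sum_distrib_right mult.assoc)
  moreover have "?\<alpha> m * vec_power z m - (\<Sum>n\<in>R. \<phi> n * (if n \<le> m then ?\<alpha> (m - n) * vec_power z m else 0)) =
      (if m = 0 then 1 else 0) + (if m \<in> S then \<theta> m * vec_power z m else 0)" for m
  proof -
    have "(\<Sum>n\<in>R. \<phi> n * (if n \<le> m then ?\<alpha> (m - n) * vec_power z m else 0)) =
        (\<Sum>n\<in>{n \<in> R. n \<le> m}. \<phi> n * ?\<alpha> (m - n)) * vec_power z m"
      unfolding sum_distrib_right using R by (intro sum.mono_neutral_cong_right) auto
    then show ?thesis by (subst arma_coeff_rec[OF R(2)]) (auto simp: distrib_right)
  qed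
  ultimately have lhs: "((\<lambda>m. (if m = 0 then 1 else 0) + (if m \<in> S then \<theta> m * vec_power z m else 0))
      has_sum (AR_poly R \<phi> z * f)) UNIV" by simp
  have "((\<lambda>m. (if m = 0 then 1 else 0) + (if m \<in> S then \<theta> m * vec_power z m else 0))
      has_sum (1 + (\<Sum>n\<in>S. \<theta> n * vec_power z n))) UNIV"
  proof (rule has_sum_add)
    have "((\<lambda>m :: nat ^ 'd. 1 :: complex) has_sum 1) {0}" using has_sum_finite[of "{0 :: nat ^ 'd}" "\<lambda>_. 1 :: complex"] by simp
    then show "((\<lambda>m :: nat ^ 'd. if m = 0 then 1 else 0 :: complex) has_sum 1) UNIV"
      by (subst (asm) has_sum_cong_neutral[where T = UNIV and g = "\<lambda>m. if m = 0 then 1 else 0"]) auto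
    have "((\<lambda>m. \<theta> m * vec_power z m) has_sum (\<Sum>n\<in>S. \<theta> n * vec_power z n)) S" by (rule has_sum_finite[OF S])
    then show "((\<lambda>m. if m \<in> S then \<theta> m * vec_power z m else 0) has_sum (\<Sum>n\<in>S. \<theta> n * vec_power z n)) UNIV"
      by (subst (asm) has_sum_cong_neutral[where T = UNIV and g = "\<lambda>m. if m \<in> S then \<theta> m * vec_power z m else 0"]) auto
  qed
  from has_sum_unique[OF lhs this] show ?thesis by (simp add: MA_poly_def)
qed

text \<open>Phi may vanish at z itself. Along the complex line through 0 and z it is a polynomial in
  s with value 1 at s = 0, so its zeros are finite in number and do not accumulate at s = 1.\<close>

lemma AR_poly_scale_nonzero:
  fixes z :: "complex ^ 'd"
  assumes R: "finite R" "0 \<notin> R"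
  shows "eventually (\<lambda>s :: complex. AR_poly R \<phi> (s *s z) \<noteq> 0) (at 1)"
proof -
  define P where "P = 1 - (\<Sum>n\<in>R. monom (\<phi> n * vec_power z n) (vec_sum n))"
  have P: "poly P s = AR_poly R \<phi> (s *s z)" for s
    by (simp add: P_def AR_poly_def poly_sum poly_monom vec_power_def vec_sum_def power_mult_distrib
        prod.distrib power_sum mult_ac)
  have pos: "vec_sum n \<noteq> 0" if "n \<in> R" for n
  proof -
    have "n \<noteq> 0" using that R(2) by auto
    then show ?thesis by (auto simp: vec_sum_def vec_eq_iff)
  qed
  have "poly P 0 = 1" unfolding P_def by (simp add: poly_sum poly_monom, rule sum.neutral) (use pos in auto)
  then have "P \<noteq> 0" by auto
  then have "\<not> 1 islimpt {s. poly P s = 0}" by (intro islimpt_finite poly_roots_finite)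
  then show ?thesis by (simp add: islimpt_iff_eventually P)
qed

text \<open>Division by Phi is legitimate at points s z with s close to but different from 1;
  continuity of both functions carries the equality to z.\<close>

lemma AR_poly_cancel:
  fixes z :: "complex ^ 'd"
  assumes R: "finite R" "0 \<notin> R" and z: "z \<in> polydisc"
    and eq: "\<And>z. z \<in> polydisc \<Longrightarrow> AR_poly R \<phi> z * f z = AR_poly R \<phi> z * g z"
    and f: "isCont f z" and g: "isCont g z"
  shows "f z = g z"
proof -
  have scale: "((\<lambda>s. s *s z) \<longlongrightarrow> z) (at (1 :: complex))"
  proof -
    have "((\<lambda>s. \<chi> i. s * z $ i) \<longlongrightarrow> (\<chi> i. 1 * z $ i)) (at (1 :: complex))"
      by (intro tendsto_vec_lambda tendsto_intros)
    then show ?thesis by (simp add: vector_scalar_mult_def)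
  qed
  have "eventually (\<lambda>s. \<forall>i. cmod ((s *s z) $ i) < 1) (at (1 :: complex))"
  proof (rule eventually_all_finite)
    fix i
    have "((\<lambda>s. cmod ((s *s z) $ i)) \<longlongrightarrow> cmod (z $ i)) (at (1 :: complex))"
      by (intro tendsto_intros scale)
    then show "eventually (\<lambda>s. cmod ((s *s z) $ i) < 1) (at (1 :: complex))"
      by (rule order_tendstoD) (use z in \<open>simp add: polydisc_def\<close>)
  qed
  then have "eventually (\<lambda>s :: complex. f (s *s z) = g (s *s z)) (at 1)"
    using AR_poly_scale_nonzero[OF R, of \<phi> z]
  proof eventually_elim
    case (elim s)
    then have "s *s z \<in> polydisc" by (simp add: polydisc_def)
    from eq[OF this] elim(2) show ?case by simp
  qed
  moreover have "((\<lambda>s. f (s *s z)) \<longlongrightarrow> f z) (at (1 :: complex))" by (rule isCont_tendsto_compose[OF f scale])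
  ultimately have "((\<lambda>s. g (s *s z)) \<longlongrightarrow> f z) (at (1 :: complex))" by (simp cong: tendsto_cong)
  moreover have "((\<lambda>s. g (s *s z)) \<longlongrightarrow> g z) (at (1 :: complex))" by (rule isCont_tendsto_compose[OF g scale])
  ultimately show ?thesis by (rule tendsto_unique[OF trivial_limit_at])
qed

lemma power_series_zero_coeffs:
  fixes s :: "nat \<Rightarrow> complex"
  assumes "\<And>w. cmod w < 1 \<Longrightarrow> (\<lambda>m. s m * w ^ m) sums 0"
  shows "s m = 0"
proof -
  let ?F = "Abs_fps s"
  have "summable (\<lambda>m. s m * (1 / 2) ^ m)" using assms[of "1 / 2"] by (auto simp: sums_iff)
  from conv_radius_geI[OF this] have "fps_conv_radius ?F \<ge> ereal (1 / 2)" by (simp add: fps_conv_radius_def)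
  then have F: "fps_conv_radius ?F > 0" by (rule less_le_trans[rotated]) simp
  have "eventually (\<lambda>w :: complex. w \<in> ball 0 1) (nhds 0)" by (intro eventually_nhds_in_open) auto
  then have "eventually (\<lambda>w. eval_fps ?F w = eval_fps 0 w) (nhds 0)"
    by eventually_elim (use assms in \<open>simp add: eval_fps_def sums_iff\<close>)
  then have "?F = 0" by (intro eval_fps_eqD F) auto
  then show ?thesis by (simp add: fps_eq_iff)
qed

text \<open>Freeze the exponents at a one coordinate at a time. With the remaining variables fixed,
  the series is a power series in one variable whose coefficients are sums over slices, so each
  slice sum vanishes; after all coordinates only \<open>c a\<close> is left.\<close>

lemma multi_power_series_zero_coeffs:
  fixes c :: "nat ^ 'd \<Rightarrow> complex"
  assumes zero: "\<And>z. z \<in> polydisc \<Longrightarrow> ((\<lambda>k. c k * vec_power z k) has_sum 0) UNIV"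
  shows "c a = 0"
proof -
  have "((\<lambda>k. c k * (\<Prod>i\<in>- I. z $ i ^ (k $ i))) has_sum 0) {k. \<forall>i\<in>I. k $ i = a $ i}"
    if "finite I" "z \<in> polydisc" for I :: "'d set" and z :: "complex ^ 'd"
    using that
  proof (induction I arbitrary: z rule: finite_induct)
    case empty
    then show ?case using zero by (simp add: vec_power_def)
  next
    case (insert j I)
    let ?A = "{k. \<forall>i\<in>I. k $ i = a $ i}"
    define d where "d k = c k * (\<Prod>i\<in>- insert j I. z $ i ^ (k $ i))" for k
    define A where "A m = {k \<in> ?A. k $ j = m}" for m
    \<comment> \<open>The induction hypothesis for all points of the polydisc is used here: only the
      coordinate j of z is replaced by w.\<close>
    have w: "((\<lambda>k. w ^ (k $ j) * d k) has_sum 0) ?A" if "cmod w < 1" for w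
    proof -
      define z' where "z' = (\<chi> i. if i = j then w else z $ i)"
      have "z' \<in> polydisc" using insert.prems that by (auto simp: z'_def polydisc_def)
      then have "((\<lambda>k. c k * (\<Prod>i\<in>- I. z' $ i ^ (k $ i))) has_sum 0) ?A" by (rule insert.IH)
      moreover have "(\<Prod>i\<in>- I. z' $ i ^ (k $ i)) = w ^ (k $ j) * (\<Prod>i\<in>- insert j I. z $ i ^ (k $ i))" for k :: "nat ^ 'd"
      proof -
        have "(\<Prod>i\<in>- I. z' $ i ^ (k $ i)) = z' $ j ^ (k $ j) * (\<Prod>i\<in>- I - {j}. z' $ i ^ (k $ i))"
          using insert.hyps by (intro prod.remove) auto
        also have "(\<Prod>i\<in>- I - {j}. z' $ i ^ (k $ i)) = (\<Prod>i\<in>- insert j I. z $ i ^ (k $ i))"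
          by (intro prod.cong) (auto simp: z'_def)
        finally show ?thesis by (simp add: z'_def)
      qed
      ultimately show ?thesis by (simp add: d_def mult_ac)
    qed
    \<comment> \<open>At w = 1/2 the series restricted to the slice m differs from d by the nonzero
      constant factor (1/2)^m.\<close>
    have d_sum: "d summable_on A m" for m
    proof -
      have "(\<lambda>k. (1 / 2) ^ (k $ j) * d k) summable_on ?A" using w[of "1 / 2"] by (auto simp: summable_on_def)
      then have "(\<lambda>k. (1 / 2) ^ (k $ j) * d k) summable_on A m"
        by (rule summable_on_subset_banach) (auto simp: A_def)
      then have "(\<lambda>k. (1 / 2) ^ m * d k) summable_on A m"
        by (rule summable_on_cong[THEN iffD1, rotated]) (auto simp: A_def)
      then show ?thesis by (subst (asm) summable_on_cmult_right') auto
    qed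
    have "(\<lambda>m. infsum d (A m) * w ^ m) sums 0" if "cmod w < 1" for w
    proof -
      let ?h = "\<lambda>k. w ^ (k $ j) * d k"
      have inj: "inj_on snd (Sigma UNIV A)" by (auto simp: inj_on_def A_def)
      have img: "snd ` Sigma UNIV A = ?A" by (force simp: A_def)
      have "(?h \<circ> snd has_sum 0) (Sigma UNIV A)"
        using w[OF that] has_sum_reindex[OF inj, of ?h 0] by (simp only: img)
      then have "((\<lambda>m. infsum d (A m) * w ^ m) has_sum 0) UNIV"
      proof (rule has_sum_Sigma[OF isUCont_plus])
        fix m
        have "((\<lambda>k. w ^ m * d k) has_sum w ^ m * infsum d (A m)) (A m)"
          by (intro has_sum_cmult_right) (simp add: d_sum)
        then have "(?h has_sum w ^ m * infsum d (A m)) (A m)"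
          by (rule has_sum_cong[THEN iffD1, rotated]) (auto simp: A_def)
        then show "((\<lambda>k. (?h \<circ> snd) (m, k)) has_sum infsum d (A m) * w ^ m) (A m)"
          by (simp add: mult.commute)
      qed
      then show ?thesis by (rule has_sum_imp_sums)
    qed
    then have "infsum d (A (a $ j)) = 0" by (rule power_series_zero_coeffs)
    then have "(d has_sum 0) (A (a $ j))" using has_sum_infsum[OF d_sum[of "a $ j"]] by simp
    moreover have "A (a $ j) = {k. \<forall>i\<in>insert j I. k $ i = a $ i}" by (auto simp: A_def)
    ultimately have "(d has_sum 0) {k. \<forall>i\<in>insert j I. k $ i = a $ i}" by (simp only:)
    then show ?case unfolding d_def .
  qed
  from this[of UNIV 0] have "(c has_sum 0) {k. \<forall>i. k $ i = a $ i}" by (simp add: polydisc_def)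
  also have "{k. \<forall>i. k $ i = a $ i} = {a}" by (auto simp: vec_eq_iff)
  finally have "(c has_sum 0) {a}" .
  moreover have "(c has_sum c a) {a}" using has_sum_finite[of "{a}" c] by simp
  ultimately show ?thesis by (rule has_sum_unique[symmetric])
qed

lemma power_series_expansion_unique:
  assumes "power_series_expansion f \<alpha>" "power_series_expansion f \<beta>"
  shows "\<alpha> = \<beta>"
proof
  fix k
  have "\<alpha> k - \<beta> k = 0"
  proof (rule multi_power_series_zero_coeffs)
    fix z :: "complex ^ 'a" assume "z \<in> polydisc"
    then have "((\<lambda>k. \<alpha> k * vec_power z k - \<beta> k * vec_power z k) has_sum f z - f z) UNIV"
      using assms unfolding power_series_expansion_def by (intro has_sum_diff) auto
    then show "((\<lambda>k. (\<alpha> k - \<beta> k) * vec_power z k) has_sum 0) UNIV" by (simp add: left_diff_distrib)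
  qed
  then show "\<alpha> k = \<beta> k" by simp
qed

lemma hardy_H2_isCont: "f \<in> hardy_H2 \<Longrightarrow> z \<in> polydisc \<Longrightarrow> isCont f z"
  unfolding hardy_H2_def mv_holomorphic_on_def by (auto intro: has_derivative_continuous)

text \<open>The series is summed first and then shown to solve Phi f = Theta. Any other solution in
  the Hardy space agrees with it on the polydisc by cancellation, so its expansion is obtained
  without expanding a general Hardy function.\<close>

theorem
  fixes R S :: "(nat ^ 'd) set"
  assumes R: "finite R" "0 \<notin> R" and S: "finite S"
    and sq: "(\<lambda>k. (cmod (arma_coeff R S \<phi> \<theta> k))\<^sup>2) summable_on UNIV"
  shows arma_quotient_in_hardy_H2: "\<exists>f\<in>hardy_H2. \<forall>z\<in>polydisc. AR_poly R \<phi> z * f z = MA_poly S \<theta> z"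
    and arma_quotient_expansion:
      "\<And>f. f \<in> hardy_H2 \<Longrightarrow> (\<forall>z\<in>polydisc. AR_poly R \<phi> z * f z = MA_poly S \<theta> z) \<Longrightarrow>
        power_series_expansion f (arma_coeff R S \<phi> \<theta>)"
proof -
  let ?\<alpha> = "arma_coeff R S \<phi> \<theta>"
  define f where "f z = (\<Sum>\<^sub>\<infinity>k. ?\<alpha> k * vec_power z k)" for z
  have "cmod (?\<alpha> k) \<le> sqrt (\<Sum>\<^sub>\<infinity>k. (cmod (?\<alpha> k))\<^sup>2)" for k
    using finite_sum_le_infsum[OF sq, of "{k}"] by (simp add: real_le_rsqrt)
  then have exp: "power_series_expansion f ?\<alpha>"
    unfolding power_series_expansion_def f_def by (auto intro!: has_sum_infsum summable_on_power_series)
  then have f: "f \<in> hardy_H2" by (rule power_series_in_hardy_H2[OF sq])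
  have eq: "AR_poly R \<phi> z * f z = MA_poly S \<theta> z" if "z \<in> polydisc" for z
    using exp that unfolding power_series_expansion_def by (intro arma_coeff_power_series R S) auto
  show "\<exists>f\<in>hardy_H2. \<forall>z\<in>polydisc. AR_poly R \<phi> z * f z = MA_poly S \<theta> z" using f eq by blast
  fix g assume g: "g \<in> hardy_H2" "\<forall>z\<in>polydisc. AR_poly R \<phi> z * g z = MA_poly S \<theta> z"
  have "f z = g z" if z: "z \<in> polydisc" for z
  proof (rule AR_poly_cancel[OF R z, of \<phi>])
    show "AR_poly R \<phi> w * f w = AR_poly R \<phi> w * g w" if "w \<in> polydisc" for w
      using eq[OF that] bspec[OF g(2) that] by (rule trans[OF _ sym])
  qed (rule hardy_H2_isCont[OF f z], rule hardy_H2_isCont[OF g(1) z])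
  then show "power_series_expansion g ?\<alpha>" using exp by (simp add: power_series_expansion_def)
qed

section \<open>Fields of pairs\<close>

text \<open>Doob-Dynkin factorization. It expresses a causal solution as a measurable function of
  the innovations, the form in which causality can be carried to another probability space or to a
  copy.\<close>

lemma gen_sigma_factorization:
  fixes f :: "'b \<Rightarrow> 'v :: {banach, second_countable_topology}"
  assumes W: "\<And>i. i \<in> I \<Longrightarrow> W i \<in> measurable N K"
    and f: "f \<in> borel_measurable (gen_sigma N K W I)"
  shows "\<exists>y\<in>borel_measurable (Pi\<^sub>M I (\<lambda>_. K)). \<forall>\<omega>\<in>space N. f \<omega> = y (\<lambda>i\<in>I. W i \<omega>)"
proof -
  let ?P = "Pi\<^sub>M I (\<lambda>_. K)" and ?W = "\<lambda>\<omega>. \<lambda>i\<in>I. W i \<omega>"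
  have Wm: "?W \<in> measurable N ?P" by (rule measurable_restrict) (rule W)
  have sub: "sets (gen_sigma N K W I) \<subseteq> sets (vimage_algebra (space N) ?W ?P)"
    unfolding sets_gen_sigma
  proof (rule sets.sigma_sets_subset[of _ "vimage_algebra (space N) ?W ?P", unfolded space_vimage_algebra], clarify)
    fix i A assume i: "i \<in> I" and A: "A \<in> sets K"
    have "?W \<in> measurable (vimage_algebra (space N) ?W ?P) ?P"
      by (rule measurable_vimage_algebra1) (use Wm measurable_space in auto)
    then have "(\<lambda>\<omega>. ?W \<omega> i) \<in> measurable (vimage_algebra (space N) ?W ?P) K"
      by (rule measurable_compose[OF _ measurable_component_singleton[OF i]])
    from measurable_sets[OF this A] show "W i -` A \<inter> space N \<in> sets (vimage_algebra (space N) ?W ?P)"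
      using i by simp
  qed
  have ex: "\<exists>B\<in>sets ?P. A = ?W -` B \<inter> space N" if "A \<in> sets (gen_sigma N K W I)" for A
  proof -
    have "A \<in> sets (vimage_algebra (space N) ?W ?P)" using that sub by blast
    then show ?thesis
      using Wm by (subst (asm) sets_vimage_algebra2) (auto dest: measurable_space)
  qed
  obtain F where F: "\<And>n. simple_function (gen_sigma N K W I) (F n)"
    and lim: "\<And>\<omega>. \<omega> \<in> space N \<Longrightarrow> (\<lambda>n. F n \<omega>) \<longlonglongrightarrow> f \<omega>"
    using borel_measurable_implies_sequence_metric[OF f, of undefined] by auto
  have step: "\<exists>y\<in>borel_measurable ?P. \<forall>\<omega>\<in>space N. F n \<omega> = y (?W \<omega>)" for n
  proof -
    have meas: "F n -` {c} \<inter> space N \<in> sets (gen_sigma N K W I)" if "c \<in> F n ` space N" for c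
      using F[of n] that by (auto simp: simple_function_def)
    have fin: "finite (F n ` space N)" using F[of n] by (simp add: simple_function_def)
    have "\<forall>c\<in>F n ` space N. \<exists>B. B \<in> sets ?P \<and> F n -` {c} \<inter> space N = ?W -` B \<inter> space N"
      using ex[OF meas] by (simp add: Bex_def)
    from bchoice[OF this] obtain B where
      "\<forall>c\<in>F n ` space N. B c \<in> sets ?P \<and> F n -` {c} \<inter> space N = ?W -` B c \<inter> space N" ..
    then have B: "\<And>c. c \<in> F n ` space N \<Longrightarrow> B c \<in> sets ?P"
      "\<And>c. c \<in> F n ` space N \<Longrightarrow> F n -` {c} \<inter> space N = ?W -` B c \<inter> space N" by blast+
    define y where "y x = (\<Sum>c\<in>F n ` space N. indicator (B c) x *\<^sub>R c)" for x
    have "y \<in> borel_measurable ?P"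
      unfolding y_def[abs_def] using B(1) by (intro borel_measurable_sum borel_measurable_scaleR borel_measurable_indicator) auto
    moreover have "F n \<omega> = y (?W \<omega>)" if \<omega>: "\<omega> \<in> space N" for \<omega>
    proof -
      have "indicator (B c) (?W \<omega>) *\<^sub>R c = (if c = F n \<omega> then c else 0)" if c: "c \<in> F n ` space N" for c
      proof -
        have "?W \<omega> \<in> B c \<longleftrightarrow> F n \<omega> = c" using B(2)[OF c] \<omega> by blast
        then show ?thesis by (auto simp: indicator_def)
      qed
      then have "y (?W \<omega>) = (\<Sum>c\<in>F n ` space N. if c = F n \<omega> then c else 0)"
        unfolding y_def by (intro sum.cong) auto
      also have "\<dots> = F n \<omega>" using fin \<omega> by (simp add: sum.delta)
      finally show ?thesis ..
    qed
    ultimately show ?thesis by blast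
  qed
  then have "\<forall>n. \<exists>y. y \<in> borel_measurable ?P \<and> (\<forall>\<omega>\<in>space N. F n \<omega> = y (?W \<omega>))" by blast
  from choice[OF this] obtain y where y: "\<And>n. y n \<in> borel_measurable ?P"
    "\<And>n \<omega>. \<omega> \<in> space N \<Longrightarrow> F n \<omega> = y n (?W \<omega>)" by auto
  show ?thesis
  proof (intro bexI ballI)
    \<comment> \<open>The functions y n converge on the image of the sample space; elsewhere
      \<open>lim\<close> supplies some value while measurability is kept.\<close>
    show "(\<lambda>x. lim (\<lambda>n. y n x)) \<in> borel_measurable ?P" by (rule borel_measurable_lim_metric[OF y(1)])
    fix \<omega> assume \<omega>: "\<omega> \<in> space N"
    from limI[OF lim[OF \<omega>]] show "f \<omega> = lim (\<lambda>n. y n (?W \<omega>))" by (simp add: y(2)[OF \<omega>])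
  qed
qed

lemma measurable_gen_sigma_restrict:
  assumes W: "\<And>i. i \<in> I \<Longrightarrow> W i \<in> measurable N K"
  shows "(\<lambda>\<omega>. \<lambda>i\<in>I. W i \<omega>) \<in> measurable (gen_sigma N K W I) (Pi\<^sub>M I (\<lambda>_. K))"
  by (rule measurable_restrict) (rule gen_sigma_component[OF W])

lemma measurable_gen_sigma_compose:
  assumes Z: "\<And>i \<omega>. i \<in> I \<Longrightarrow> \<omega> \<in> space N \<Longrightarrow> Z i \<omega> = q (W i \<omega>)" and q: "q \<in> measurable K L"
    and W: "\<And>i. i \<in> I \<Longrightarrow> W i \<in> measurable N K"
    and f: "f \<in> measurable (gen_sigma N L Z I) T"
  shows "f \<in> measurable (gen_sigma N K W I) T"
proof -
  have "sets (gen_sigma N L Z I) \<subseteq> sets (gen_sigma N K W I)"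
    unfolding sets_gen_sigma
  proof (rule sigma_sets_mono, clarify)
    fix i A assume i: "i \<in> I" and A: "A \<in> sets L"
    have "Z i -` A \<inter> space N = W i -` (q -` A \<inter> space K) \<inter> space N"
      using Z[OF i] measurable_space[OF W[OF i]] by auto
    then show "Z i -` A \<inter> space N \<in> sigma_sets (space N) (\<Union>i\<in>I. {W i -` A \<inter> space N |A. A \<in> sets K})"
      using i measurable_sets[OF q A] by (intro sigma_sets.Basic) blast
  qed
  then show ?thesis using f measurable_mono[of T T "gen_sigma N L Z I" "gen_sigma N K W I"] by auto
qed

text \<open>Combine both families into one indexed by bool and 'i, prove its independence by
  factoring first between the families and then within each, and regroup the indices (True, i) and
  (False, i).\<close>

lemma (in prob_space) indep_vars_Pair:
  fixes X X' :: "'i \<Rightarrow> 'a \<Rightarrow> 'c"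
  assumes X: "indep_vars (\<lambda>_. K) X UNIV" and X': "indep_vars (\<lambda>_. K) X' UNIV"
    and XX': "indep_var (Pi\<^sub>M UNIV (\<lambda>_. K)) (\<lambda>\<omega> i. X i \<omega>) (Pi\<^sub>M UNIV (\<lambda>_. K)) (\<lambda>\<omega> i. X' i \<omega>)"
  shows "indep_vars (\<lambda>_. K \<Otimes>\<^sub>M K) (\<lambda>i \<omega>. (X i \<omega>, X' i \<omega>)) UNIV"
proof -
  define F where "F j = (if fst j then X (snd j) else X' (snd j))" for j :: "bool \<times> 'i"
  have Xm[measurable]: "X i \<in> measurable M K" "X' i \<in> measurable M K" for i
    using X X' by (auto simp: indep_vars_def)
  have Fm: "F j \<in> measurable M K" for j by (simp add: F_def)
  have part: "prob (\<Inter>i\<in>J. Y i -` C i \<inter> space M) = (\<Prod>i\<in>J. prob (Y i -` C i \<inter> space M))"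
    if "indep_vars (\<lambda>_. K) Y UNIV" "finite J" "J \<noteq> {}" "\<And>i. i \<in> J \<Longrightarrow> C i \<in> sets K"
    for Y :: "'i \<Rightarrow> 'a \<Rightarrow> 'c" and J C
    using that by (intro indep_varsD) auto
  define ev where "ev Y J C = {\<omega> \<in> space M. \<forall>i\<in>J. Y i \<omega> \<in> C i}"
    for Y :: "'i \<Rightarrow> 'a \<Rightarrow> 'c" and J and C :: "'i \<Rightarrow> 'c set"
  have part': "prob (ev Y J C) = (\<Prod>i\<in>J. prob (Y i -` C i \<inter> space M))"
    if "indep_vars (\<lambda>_. K) Y UNIV" "finite J" "\<And>i. i \<in> J \<Longrightarrow> C i \<in> sets K" for Y J C
  proof (cases "J = {}")
    case False
    then have "ev Y J C = (\<Inter>i\<in>J. Y i -` C i \<inter> space M)" by (auto simp: ev_def)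
    then show ?thesis using part[OF that(1,2) False that(3)] by simp
  qed (simp add: ev_def prob_space)
  have F: "indep_vars (\<lambda>_. K) F UNIV"
    unfolding indep_vars_def2
  proof (intro conjI ballI Fm indep_setsI)
    show "{F j -` A \<inter> space M |A. A \<in> sets K} \<subseteq> events" for j using measurable_sets[OF Fm[of j]] by auto
    fix A J assume J: "J \<noteq> {}" "J \<subseteq> UNIV" "finite J" and A: "\<forall>j\<in>J. A j \<in> {F j -` A \<inter> space M |A. A \<in> sets K}"
    from A have "\<forall>j\<in>J. \<exists>C. C \<in> sets K \<and> A j = F j -` C \<inter> space M" by auto
    from bchoice[OF this] obtain C where C: "\<And>j. j \<in> J \<Longrightarrow> C j \<in> sets K" "\<And>j. j \<in> J \<Longrightarrow> A j = F j -` C j \<inter> space M"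
      by auto
    define J1 where "J1 = {i. (True, i) \<in> J}"
    define J2 where "J2 = {i. (False, i) \<in> J}"
    have J_eq: "J = Pair True ` J1 \<union> Pair False ` J2"
    proof
      show "J \<subseteq> Pair True ` J1 \<union> Pair False ` J2"
      proof
        fix j assume "j \<in> J" then show "j \<in> Pair True ` J1 \<union> Pair False ` J2"
          by (cases j; cases "fst j") (auto simp: J1_def J2_def)
      qed
    qed (auto simp: J1_def J2_def)
    have fin: "finite J1" "finite J2"
      using J(3) finite_imageD[of "Pair True" J1] finite_imageD[of "Pair False" J2] J_eq by (auto simp: inj_on_def)
    define D where "D J' C' = {h \<in> space (Pi\<^sub>M UNIV (\<lambda>_. K)). \<forall>i\<in>J'. h i \<in> C' i}"
      for J' :: "'i set" and C' :: "'i \<Rightarrow> 'c set"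
    have D: "D J' C' \<in> sets (Pi\<^sub>M UNIV (\<lambda>_. K))" if "finite J'" "\<And>i. i \<in> J' \<Longrightarrow> C' i \<in> sets K" for J' C'
      unfolding D_def using that by measurable
    have sp: "(\<lambda>i. Y i \<omega>) \<in> space (Pi\<^sub>M UNIV (\<lambda>_. K))" if "\<omega> \<in> space M" "\<And>i. Y i \<in> measurable M K" for Y :: "'i \<Rightarrow> 'a \<Rightarrow> 'c" and \<omega>
      using that measurable_space[of "Y _" M K] by (auto simp: space_PiM)
    have "(\<Inter>j\<in>J. A j) = ev X J1 (\<lambda>i. C (True, i)) \<inter> ev X' J2 (\<lambda>i. C (False, i))"
    proof -
      have AT: "A (True, i) = X i -` C (True, i) \<inter> space M" if "i \<in> J1" for i
        using C(2)[of "(True, i)"] that by (simp add: J1_def F_def)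
      have AF: "A (False, i) = X' i -` C (False, i) \<inter> space M" if "i \<in> J2" for i
        using C(2)[of "(False, i)"] that by (simp add: J2_def F_def)
      have ne: "J1 \<noteq> {} \<or> J2 \<noteq> {}" using J(1) J_eq by auto
      have "\<omega> \<in> (\<Inter>j\<in>J. A j) \<longleftrightarrow> \<omega> \<in> ev X J1 (\<lambda>i. C (True, i)) \<inter> ev X' J2 (\<lambda>i. C (False, i))" for \<omega>
      proof -
        have "\<omega> \<in> (\<Inter>j\<in>J. A j) \<longleftrightarrow> (\<forall>i\<in>J1. \<omega> \<in> A (True, i)) \<and> (\<forall>i\<in>J2. \<omega> \<in> A (False, i))"
          by (subst J_eq) auto
        also have "\<dots> \<longleftrightarrow> (\<forall>i\<in>J1. \<omega> \<in> X i -` C (True, i) \<inter> space M) \<and>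
            (\<forall>i\<in>J2. \<omega> \<in> X' i -` C (False, i) \<inter> space M)" by (simp add: AT AF)
        finally show ?thesis using ne unfolding ev_def by blast
      qed
      then show ?thesis by blast
    qed
    also have "\<dots> = ((\<lambda>\<omega> i. X i \<omega>) -` D J1 (\<lambda>i. C (True, i)) \<inter> space M) \<inter> ((\<lambda>\<omega> i. X' i \<omega>) -` D J2 (\<lambda>i. C (False, i)) \<inter> space M)"
      using sp[of _ X] sp[of _ X'] by (auto simp: ev_def D_def)
    finally have "prob (\<Inter>j\<in>J. A j) =
        prob (((\<lambda>\<omega> i. X i \<omega>) -` D J1 (\<lambda>i. C (True, i)) \<inter> space M) \<inter> ((\<lambda>\<omega> i. X' i \<omega>) -` D J2 (\<lambda>i. C (False, i)) \<inter> space M))"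
      by simp
    also have "\<dots> = prob ((\<lambda>\<omega> i. X i \<omega>) -` D J1 (\<lambda>i. C (True, i)) \<inter> space M) *
        prob ((\<lambda>\<omega> i. X' i \<omega>) -` D J2 (\<lambda>i. C (False, i)) \<inter> space M)"
    proof -
      have "indep_set {(\<lambda>\<omega> i. X i \<omega>) -` A \<inter> space M |A. A \<in> sets (Pi\<^sub>M UNIV (\<lambda>_. K))}
          {(\<lambda>\<omega> i. X' i \<omega>) -` A \<inter> space M |A. A \<in> sets (Pi\<^sub>M UNIV (\<lambda>_. K))}"
        using XX' unfolding indep_var_def indep_vars_def2 indep_set_def
        by (elim conjE indep_sets_mono_sets) (auto split: bool.split)
      then show ?thesis
        using D[OF fin(1), of "\<lambda>i. C (True, i)"] D[OF fin(2), of "\<lambda>i. C (False, i)"] C(1)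
        by (intro indep_setD[of "{(\<lambda>\<omega> i. X i \<omega>) -` A \<inter> space M |A. A \<in> sets (Pi\<^sub>M UNIV (\<lambda>_. K))}"
            "{(\<lambda>\<omega> i. X' i \<omega>) -` A \<inter> space M |A. A \<in> sets (Pi\<^sub>M UNIV (\<lambda>_. K))}"])
           (auto simp: J1_def J2_def)
    qed
    also have "(\<lambda>\<omega> i. X i \<omega>) -` D J1 (\<lambda>i. C (True, i)) \<inter> space M = ev X J1 (\<lambda>i. C (True, i))"
      using sp[of _ X] by (auto simp: ev_def D_def)
    also have "(\<lambda>\<omega> i. X' i \<omega>) -` D J2 (\<lambda>i. C (False, i)) \<inter> space M = ev X' J2 (\<lambda>i. C (False, i))"
      using sp[of _ X'] by (auto simp: ev_def D_def)
    also have "prob (ev X J1 (\<lambda>i. C (True, i))) * prob (ev X' J2 (\<lambda>i. C (False, i))) =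
        (\<Prod>i\<in>J1. prob (X i -` C (True, i) \<inter> space M)) * (\<Prod>i\<in>J2. prob (X' i -` C (False, i) \<inter> space M))"
      using C(1) by (intro arg_cong2[where f = "(*)"] part' X X' fin) (auto simp: J1_def J2_def)
    also have "\<dots> = (\<Prod>j\<in>Pair True ` J1. prob (A j)) * (\<Prod>j\<in>Pair False ` J2. prob (A j))"
    proof (intro arg_cong2[where f = "(*)"])
      show "(\<Prod>i\<in>J1. prob (X i -` C (True, i) \<inter> space M)) = (\<Prod>j\<in>Pair True ` J1. prob (A j))"
        by (subst prod.reindex) (auto simp: inj_on_def J1_def C(2) F_def)
      show "(\<Prod>i\<in>J2. prob (X' i -` C (False, i) \<inter> space M)) = (\<Prod>j\<in>Pair False ` J2. prob (A j))"
        by (subst prod.reindex) (auto simp: inj_on_def J2_def C(2) F_def)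
    qed
    also have "\<dots> = (\<Prod>j\<in>J. prob (A j))"
      by (subst J_eq, rule prod.union_disjoint[symmetric]) (use fin in auto)
    finally show "prob (\<Inter>j\<in>J. A j) = (\<Prod>j\<in>J. prob (A j))" .
  qed
  define Q where "Q i = {(True, i), (False, i)}" for i :: 'i
  have "indep_vars (\<lambda>i. Pi\<^sub>M (Q i) (\<lambda>_. K)) (\<lambda>i \<omega>. restrict (\<lambda>j. F j \<omega>) (Q i)) UNIV"
    by (rule indep_vars_restrict[OF F]) (auto simp: disjoint_family_on_def Q_def)
  then have "indep_vars (\<lambda>_. K \<Otimes>\<^sub>M K) (\<lambda>i \<omega>. (\<lambda>h. (h (True, i), h (False, i))) (restrict (\<lambda>j. F j \<omega>) (Q i))) UNIV"
    by (rule indep_vars_compose2)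
       (intro measurable_Pair measurable_component_singleton; simp add: Q_def)
  then show ?thesis by (simp add: Q_def F_def)
qed

text \<open>The pair has a product law with equal factors, so exchanging its components preserves
  the law and changes the sign of the difference.\<close>

lemma (in prob_space) indep_var_diff_symmetric:
  fixes X X' :: "'a \<Rightarrow> complex"
  assumes ind: "indep_var borel X borel X'" and same: "distr M borel X' = distr M borel X"
  shows "symmetric_rv M (\<lambda>\<omega>. X \<omega> - X' \<omega>)"
proof -
  have [measurable]: "X \<in> borel_measurable M" "X' \<in> borel_measurable M"
    using ind by (auto dest: indep_var_rv1 indep_var_rv2)
  let ?D = "distr M borel X"
  interpret D: prob_space ?D by (rule prob_space_distr) simp
  interpret DD: pair_prob_space ?D ?D ..
  have pair: "distr M (borel \<Otimes>\<^sub>M borel) (\<lambda>\<omega>. (X \<omega>, X' \<omega>)) = ?D \<Otimes>\<^sub>M ?D"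
    using ind by (simp add: indep_var_distribution_eq same)
  have diff: "distr M borel (\<lambda>\<omega>. h (X \<omega>) (X' \<omega>)) = distr (?D \<Otimes>\<^sub>M ?D) borel (\<lambda>(a, b). h a b)"
    if [measurable]: "(\<lambda>(a, b). h a b) \<in> borel_measurable (borel \<Otimes>\<^sub>M borel)" for h :: "complex \<Rightarrow> complex \<Rightarrow> complex"
    unfolding pair[symmetric] by (subst distr_distr) (auto simp: comp_def)
  have "distr M borel (\<lambda>\<omega>. - (X \<omega> - X' \<omega>)) = distr (?D \<Otimes>\<^sub>M ?D) borel (\<lambda>(a, b). - (a - b))"
    by (rule diff) simp
  also have "\<dots> = distr (distr (?D \<Otimes>\<^sub>M ?D) (?D \<Otimes>\<^sub>M ?D) (\<lambda>(a, b). (b, a))) borel (\<lambda>(a, b). a - b)"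
    by (subst distr_distr) (auto simp: comp_def case_prod_beta')
  also have "\<dots> = distr (?D \<Otimes>\<^sub>M ?D) borel (\<lambda>(a, b). a - b)"
    using DD.distr_pair_swap by simp
  also have "\<dots> = distr M borel (\<lambda>\<omega>. X \<omega> - X' \<omega>)"
    by (rule diff[symmetric]) simp
  finally show ?thesis by (simp add: symmetric_rv_def)
qed

text \<open>Independence of a family says that its joint law is the product of its marginals; it is
  therefore determined by the joint law.\<close>

lemma indep_vars_transfer_law:
  fixes X :: "'i \<Rightarrow> 'a \<Rightarrow> 'c" and X' :: "'i \<Rightarrow> 'b \<Rightarrow> 'c"
  assumes M: "prob_space M" and N: "prob_space N"
    and X: "prob_space.indep_vars M (\<lambda>_. K) X UNIV"
    and X': "\<And>i. X' i \<in> measurable N K"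
    and law: "distr N (Pi\<^sub>M UNIV (\<lambda>_. K)) (\<lambda>\<omega> i. X' i \<omega>) = distr M (Pi\<^sub>M UNIV (\<lambda>_. K)) (\<lambda>\<omega> i. X i \<omega>)"
  shows "prob_space.indep_vars N (\<lambda>_. K) X' UNIV" and "distr N K (X' i) = distr M K (X i)"
proof -
  interpret M: prob_space M by fact
  interpret N: prob_space N by fact
  have Xm: "X i \<in> measurable M K" for i using X by (auto simp: M.indep_vars_def)
  let ?P = "Pi\<^sub>M UNIV (\<lambda>_. K) :: ('i \<Rightarrow> 'c) measure"
  have Pm: "(\<lambda>\<omega> i. X i \<omega>) \<in> measurable M ?P" "(\<lambda>\<omega> i. X' i \<omega>) \<in> measurable N ?P"
    using Xm X' by (auto intro!: measurable_PiM_single' measurable_space[OF Xm] measurable_space[OF X'] simp: PiE_iff)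
  have comp: "(\<lambda>h. h i) \<in> measurable ?P K" for i by (rule measurable_component_singleton) simp
  have marg: "distr N K (X' i) = distr M K (X i)" for i
  proof -
    have "distr N K (X' i) = distr (distr N ?P (\<lambda>\<omega> i. X' i \<omega>)) K (\<lambda>h. h i)"
      by (subst distr_distr[OF comp Pm(2)]) (simp add: comp_def)
    also have "\<dots> = distr M K (X i)"
      unfolding law by (subst distr_distr[OF comp Pm(1)]) (simp add: comp_def)
    finally show ?thesis .
  qed
  then show "distr N K (X' i) = distr M K (X i)" .
  have "distr M ?P (\<lambda>\<omega> i. X i \<omega>) = Pi\<^sub>M UNIV (\<lambda>i. distr M K (X i))"
    using X M.indep_vars_iff_distr_eq_PiM'[of UNIV X "\<lambda>_. K"] Xm by (simp add: restrict_UNIV)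
  then have "distr N ?P (\<lambda>\<omega> i. X' i \<omega>) = Pi\<^sub>M UNIV (\<lambda>i. distr N K (X' i))"
    by (simp add: law marg)
  then show "N.indep_vars (\<lambda>_. K) X' UNIV"
    using N.indep_vars_iff_distr_eq_PiM'[of UNIV X' "\<lambda>_. K"] X' by (simp add: restrict_UNIV)
qed

section \<open>Series representation\<close>

lemma measurable_fst_snd_borel [measurable]:
  "fst \<in> borel_measurable (borel :: (complex \<times> complex) measure)"
  "snd \<in> borel_measurable (borel :: (complex \<times> complex) measure)"
  by (auto intro!: borel_measurable_continuous_onI continuous_intros)

lemma inj_sub_int_vec: "inj (\<lambda>k. t - int_vec k)"
  by (auto simp: inj_def int_vec_def vec_eq_iff)

lemma (in prob_space) indep_vars_reindex_inj:
  assumes "indep_vars M' X (h ` I)" "inj_on h I"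
  shows "indep_vars (\<lambda>k. M' (h k)) (\<lambda>k. X (h k)) I"
  unfolding indep_vars_def2
proof (intro conjI ballI indep_setsI)
  show "X (h i) \<in> measurable M (M' (h i))" if "i \<in> I" for i
    using assms(1) that by (auto simp: indep_vars_def)
  show "{X (h i) -` A \<inter> space M |A. A \<in> sets (M' (h i))} \<subseteq> events" if "i \<in> I" for i
    using assms(1) that by (auto simp: indep_vars_def)
  fix A J assume J: "J \<noteq> {}" "J \<subseteq> I" "finite J"
    and A: "\<forall>j\<in>J. A j \<in> {X (h j) -` A \<inter> space M |A. A \<in> sets (M' (h j))}"
  have inj: "inj_on h J" using assms(2) J(2) by (rule inj_on_subset)
  let ?g = "the_inv_into J h"
  have g: "?g (h j) = j" if "j \<in> J" for j using the_inv_into_f_f[OF inj that] .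
  have "prob (\<Inter>i\<in>h ` J. A (?g i)) = (\<Prod>i\<in>h ` J. prob (A (?g i)))"
    using assms(1) unfolding indep_vars_def2
    by (elim conjE indep_setsD) (use J A in \<open>auto simp: g\<close>)
  moreover have "(\<Inter>i\<in>h ` J. A (?g i)) = (\<Inter>j\<in>J. A j)" by (auto simp: g)
  moreover have "(\<Prod>i\<in>h ` J. prob (A (?g i))) = (\<Prod>j\<in>J. prob (A j))"
    by (subst prod.reindex[OF inj]) (simp add: g)
  ultimately show "prob (\<Inter>j\<in>J. A j) = (\<Prod>j\<in>J. prob (A j))" by simp
qed

lemma iid_field_measurable:
  assumes "prob_space M" "iid_field M Z"
  shows "Z t \<in> borel_measurable M"
  using assms by (auto simp: iid_field_def prob_space.indep_vars_def)

lemma iid_field_indep_shift: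
  assumes "prob_space M" "iid_field M Z"
  shows "prob_space.indep_vars M (\<lambda>_. borel) (\<lambda>k. Z (t - int_vec k)) UNIV"
proof -
  interpret prob_space M by fact
  have "indep_vars (\<lambda>_. borel) Z (range (\<lambda>k. t - int_vec k))"
    using assms(2) unfolding iid_field_def by (auto intro: indep_vars_subset)
  from indep_vars_reindex_inj[OF this inj_sub_int_vec] show ?thesis .
qed

lemma strictly_stationary_distr:
  assumes Y: "random_field M Y" and st: "strictly_stationary M Y"
  shows "distr M borel (Y t) = distr M borel (Y 0)"
proof -
  let ?P = "Pi\<^sub>M {0 :: int ^ 'b} (\<lambda>_. borel) :: (int ^ 'b \<Rightarrow> complex) measure"
  have [measurable]: "Y s \<in> borel_measurable M" for s using Y by (auto simp: random_field_def)
  have eq: "distr M ?P (\<lambda>\<omega>. \<lambda>s\<in>{0}. Y (s + t) \<omega>) = distr M ?P (\<lambda>\<omega>. \<lambda>s\<in>{0}. Y s \<omega>)"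
    using st unfolding strictly_stationary_def by auto
  have proj: "distr (distr M ?P (\<lambda>\<omega>. \<lambda>s\<in>{0}. Y (s + h) \<omega>)) borel (\<lambda>x. x 0) = distr M borel (Y h)" for h
    by (subst distr_distr) (auto simp: comp_def)
  show ?thesis using proj[of t] proj[of 0] eq by simp
qed

lemma symmetric_rv_cong_distr:
  assumes [measurable]: "X \<in> borel_measurable M" "X' \<in> borel_measurable N"
    and "distr M borel X = distr N borel X'" "symmetric_rv M X"
  shows "symmetric_rv N X'"
proof -
  have "distr N borel (\<lambda>\<omega>. - X' \<omega>) = distr (distr N borel X') borel uminus" by (simp add: distr_distr comp_def)
  also have "\<dots> = distr M borel (\<lambda>\<omega>. - X \<omega>)" unfolding assms(3)[symmetric] by (simp add: distr_distr comp_def)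
  finally show ?thesis using assms(3,4) by (simp add: symmetric_rv_def)
qed

lemma causal_innovation_decomposition:
  fixes Y Z :: "int ^ 'd \<Rightarrow> 'a \<Rightarrow> complex"
  assumes R: "finite R" "0 \<notin> R" and S: "finite S" "0 \<notin> S"
    and Z: "\<And>t. Z t \<in> borel_measurable M"
    and eq: "ARMA_equation M R S \<phi> \<theta> Z Y"
    and Y: "\<And>t. Y t \<in> borel_measurable (past_sigma M Z t)"
  shows "\<exists>B\<in>borel_measurable (gen_sigma M borel (\<lambda>k. Z (t - int_vec k)) (- {..n})).
      AE \<omega> in M. Y t \<omega> = (\<Sum>k\<in>{..n}. arma_coeff R S \<phi> \<theta> k * Z (t - int_vec k) \<omega>) + B \<omega>"
    and "Y t \<in> borel_measurable (gen_sigma M borel (\<lambda>k. Z (t - int_vec k)) UNIV)"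
proof -
  show "\<exists>B\<in>borel_measurable (gen_sigma M borel (\<lambda>k. Z (t - int_vec k)) (- {..n})).
      AE \<omega> in M. Y t \<omega> = (\<Sum>k\<in>{..n}. arma_coeff R S \<phi> \<theta> k * Z (t - int_vec k) \<omega>) + B \<omega>"
    unfolding gen_sigma_reindex[of M borel Z "\<lambda>k. t - int_vec k"]
    by (rule arma_innovation_decomposition[OF R S Z eq Y]) auto
  show "Y t \<in> borel_measurable (gen_sigma M borel (\<lambda>k. Z (t - int_vec k)) UNIV)"
    unfolding gen_sigma_reindex[of M borel Z "\<lambda>k. t - int_vec k"] using Y[of t] by (simp add: past_sigma_eq atMost_eq_range_int_vec)
qed

text \<open>Apply the general result with the innovations themselves as W. Stationarity and
  identical distribution move the symmetry assumptions from index 0 to all indices.\<close>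

lemma symmetric_causal_solution_series:
  fixes Y Z :: "int ^ 'd \<Rightarrow> 'a \<Rightarrow> complex"
  assumes M: "prob_space M" and R: "finite R" "0 \<notin> R" and S: "finite S" "0 \<notin> S"
    and Z: "iid_field M Z" and Y: "causal_solution M R S \<phi> \<theta> Z Y"
    and sym: "symmetric_rv M (Z 0)" "symmetric_rv M (Y 0)"
  shows "AE \<omega> in M. rect_sums (\<lambda>k. arma_coeff R S \<phi> \<theta> k * Z (t - int_vec k) \<omega>) (Y t \<omega>)"
proof -
  have Zm: "Z t \<in> borel_measurable M" for t by (rule iid_field_measurable[OF M Z])
  have Ym: "Y t \<in> borel_measurable M" for t
    using Y by (simp add: causal_solution_def ARMA_solution_def random_field_def)
  have eq: "ARMA_equation M R S \<phi> \<theta> Z Y" and past: "Y t \<in> borel_measurable (past_sigma M Z t)" for t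
    using Y by (simp_all add: causal_solution_def ARMA_solution_def)
  note dec = causal_innovation_decomposition[OF R S Zm eq past]
  show ?thesis
  proof (rule AE_rect_sums[where g = "\<lambda>z. z" and W = "\<lambda>k. Z (t - int_vec k)" and K = borel, OF M
        iid_field_indep_shift[OF M Z] _ _ dec(2) _ dec(1)])
    show "symmetric_rv M (\<lambda>\<omega>. Z (t - int_vec k) \<omega>)" for k
      by (rule symmetric_rv_cong_distr[OF Zm Zm _ sym(1)]) (use Z in \<open>auto simp: iid_field_def\<close>)
    have "distr M borel (Y t) = distr M borel (Y 0)"
      using Y by (intro strictly_stationary_distr) (auto simp: causal_solution_def ARMA_solution_def)
    then show "symmetric_rv M (Y t)" by (intro symmetric_rv_cong_distr[OF Ym Ym _ sym(2)]) simp
  qed simp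
qed

text \<open>The innovations are pairs, with the difference as the function g: each solution and its
  remainder are measurable with respect to one component, hence with respect to the pairs, and the
  two decompositions can be subtracted.\<close>

lemma difference_of_causal_solutions:
  fixes Y1 Y2 Z1 Z2 :: "int ^ 'd \<Rightarrow> 'a \<Rightarrow> complex"
  assumes M: "prob_space M" and R: "finite R" "0 \<notin> R" and S: "finite S" "0 \<notin> S"
    and Z: "iid_field M Z1" "iid_field M Z2"
    and ind: "prob_space.indep_var M (Pi\<^sub>M UNIV (\<lambda>_. borel)) (\<lambda>\<omega> t. Z1 t \<omega>) (Pi\<^sub>M UNIV (\<lambda>_. borel)) (\<lambda>\<omega> t. Z2 t \<omega>)"
    and eq: "ARMA_equation M R S \<phi> \<theta> Z1 Y1" "ARMA_equation M R S \<phi> \<theta> Z2 Y2"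
    and past: "\<And>t. Y1 t \<in> borel_measurable (past_sigma M Z1 t)" "\<And>t. Y2 t \<in> borel_measurable (past_sigma M Z2 t)"
    and sym: "\<And>t. symmetric_rv M (\<lambda>\<omega>. Z1 t \<omega> - Z2 t \<omega>)" "\<And>t. symmetric_rv M (\<lambda>\<omega>. Y1 t \<omega> - Y2 t \<omega>)"
  shows "AE \<omega> in M. rect_sums (\<lambda>k. arma_coeff R S \<phi> \<theta> k * (Z1 (t - int_vec k) \<omega> - Z2 (t - int_vec k) \<omega>)) (Y1 t \<omega> - Y2 t \<omega>)"
    and "\<exists>\<delta>>0. \<forall>F. finite F \<longrightarrow> (\<Sum>k\<in>F. prob_space.expectation M (\<lambda>\<omega>. min 1 ((\<delta> *
      cmod (arma_coeff R S \<phi> \<theta> k * (Z1 (t - int_vec k) \<omega> - Z2 (t - int_vec k) \<omega>)))\<^sup>2))) \<le> 16"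
proof -
  interpret prob_space M by fact
  have Zm: "Z1 t \<in> borel_measurable M" "Z2 t \<in> borel_measurable M" for t
    using iid_field_measurable[OF M Z(1)] iid_field_measurable[OF M Z(2)] by auto
  let ?K = "borel \<Otimes>\<^sub>M borel :: (complex \<times> complex) measure"
  let ?W = "\<lambda>k \<omega>. (Z1 (t - int_vec k) \<omega>, Z2 (t - int_vec k) \<omega>)"
  have "indep_vars (\<lambda>_. ?K) (\<lambda>t \<omega>. (Z1 t \<omega>, Z2 t \<omega>)) UNIV"
    using Z ind by (intro indep_vars_Pair) (auto simp: iid_field_def)
  then have "indep_vars (\<lambda>_. ?K) (\<lambda>t \<omega>. (Z1 t \<omega>, Z2 t \<omega>)) (range (\<lambda>k. t - int_vec k))"
    by (rule indep_vars_subset) simp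
  from indep_vars_reindex_inj[OF this inj_sub_int_vec]
  have indep: "indep_vars (\<lambda>_. ?K) ?W UNIV" .
  have Wm: "?W k \<in> measurable M ?K" for k using Zm by measurable
  have gen1: "f \<in> borel_measurable (gen_sigma M ?K ?W I)"
    if "f \<in> borel_measurable (gen_sigma M borel (\<lambda>k. Z1 (t - int_vec k)) I)" for f :: "'a \<Rightarrow> complex" and I
    by (rule measurable_gen_sigma_compose[OF _ measurable_fst Wm that]) simp
  have gen2: "f \<in> borel_measurable (gen_sigma M ?K ?W I)"
    if "f \<in> borel_measurable (gen_sigma M borel (\<lambda>k. Z2 (t - int_vec k)) I)" for f :: "'a \<Rightarrow> complex" and I
    by (rule measurable_gen_sigma_compose[OF _ measurable_snd Wm that]) simp
  note dec1 = causal_innovation_decomposition[OF R S Zm(1) eq(1) past(1)]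
  note dec2 = causal_innovation_decomposition[OF R S Zm(2) eq(2) past(2)]
  let ?g = "\<lambda>(a, b). a - b :: complex"
  have g: "?g \<in> borel_measurable ?K" by measurable
  have gs: "symmetric_rv M (\<lambda>\<omega>. ?g (?W k \<omega>))" for k using sym(1) by simp
  have V: "(\<lambda>\<omega>. Y1 t \<omega> - Y2 t \<omega>) \<in> borel_measurable (gen_sigma M ?K ?W UNIV)"
    by (intro borel_measurable_diff gen1[OF dec1(2)] gen2[OF dec2(2)])
  have dec: "\<exists>B\<in>borel_measurable (gen_sigma M ?K ?W (- {..n})).
      AE \<omega> in M. Y1 t \<omega> - Y2 t \<omega> = (\<Sum>k\<in>{..n}. arma_coeff R S \<phi> \<theta> k * ?g (?W k \<omega>)) + B \<omega>" for n
  proof -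
    obtain B1 B2 where B: "B1 \<in> borel_measurable (gen_sigma M borel (\<lambda>k. Z1 (t - int_vec k)) (- {..n}))"
      "B2 \<in> borel_measurable (gen_sigma M borel (\<lambda>k. Z2 (t - int_vec k)) (- {..n}))"
      "AE \<omega> in M. Y1 t \<omega> = (\<Sum>k\<in>{..n}. arma_coeff R S \<phi> \<theta> k * Z1 (t - int_vec k) \<omega>) + B1 \<omega>"
      "AE \<omega> in M. Y2 t \<omega> = (\<Sum>k\<in>{..n}. arma_coeff R S \<phi> \<theta> k * Z2 (t - int_vec k) \<omega>) + B2 \<omega>"
      using dec1(1)[of t n] dec2(1)[of t n] by blast
    show ?thesis
    proof (intro bexI)
      show "(\<lambda>\<omega>. B1 \<omega> - B2 \<omega>) \<in> borel_measurable (gen_sigma M ?K ?W (- {..n}))"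
        by (intro borel_measurable_diff gen1[OF B(1)] gen2[OF B(2)])
      show "AE \<omega> in M. Y1 t \<omega> - Y2 t \<omega> = (\<Sum>k\<in>{..n}. arma_coeff R S \<phi> \<theta> k * ?g (?W k \<omega>)) + (B1 \<omega> - B2 \<omega>)"
        using B(3,4) by eventually_elim (simp add: right_diff_distrib sum_subtractf)
    qed
  qed
  from AE_rect_sums[where g = ?g and W = ?W, OF M indep g gs V sym(2) dec]
  show "AE \<omega> in M. rect_sums (\<lambda>k. arma_coeff R S \<phi> \<theta> k * (Z1 (t - int_vec k) \<omega> - Z2 (t - int_vec k) \<omega>)) (Y1 t \<omega> - Y2 t \<omega>)"
    by simp
  from truncated_second_moments_le[where g = ?g and W = ?W, OF M indep g gs V sym(2) dec]
  show "\<exists>\<delta>>0. \<forall>F. finite F \<longrightarrow> (\<Sum>k\<in>F. expectation (\<lambda>\<omega>. min 1 ((\<delta> *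
      cmod (arma_coeff R S \<phi> \<theta> k * (Z1 (t - int_vec k) \<omega> - Z2 (t - int_vec k) \<omega>)))\<^sup>2))) \<le> 16"
    by simp
qed

section \<open>Transfer to an extension and to an independent copy\<close>

lemma extension_iid_field:
  fixes Z :: "int ^ 'd \<Rightarrow> 'a \<Rightarrow> complex"
  assumes M: "prob_space M" and Z: "iid_field M Z" and ext: "prob_space_extension N M p"
  shows "iid_field N (\<lambda>t. Z t \<circ> p)"
proof -
  have N: "prob_space N" and p[measurable]: "p \<in> measurable N M" and dp: "distr N M p = M"
    using ext by (auto simp: prob_space_extension_def)
  have [measurable]: "Z t \<in> borel_measurable M" for t by (rule iid_field_measurable[OF M Z])
  let ?P = "Pi\<^sub>M UNIV (\<lambda>_. borel) :: (int ^ 'd \<Rightarrow> complex) measure"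
  have Zm: "(\<lambda>\<omega> t. Z t \<omega>) \<in> measurable M ?P" by (rule measurable_PiM_single') auto
  have "distr M ?P (\<lambda>\<omega> t. Z t \<omega>) = distr N ?P (\<lambda>\<omega> t. (Z t \<circ> p) \<omega>)"
    by (subst dp[symmetric], subst distr_distr[OF Zm p]) (simp add: comp_def)
  note law = indep_vars_transfer_law[OF M N _ _ this[symmetric]]
  show ?thesis
    unfolding iid_field_def
    using law Z by (auto simp: iid_field_def comp_def)
qed

text \<open>Laws and null sets pull back along p because p maps the measure of N to that of M.
  Strict causality is not a property of laws; it follows from writing Y as a function of the past of
  Z and composing with p.\<close>

lemma extension_causal_solution:
  fixes Y Z :: "int ^ 'd \<Rightarrow> 'a \<Rightarrow> complex"
  assumes M: "prob_space M" and Z: "iid_field M Z" and ext: "prob_space_extension N M p"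
    and Y: "causal_solution M R S \<phi> \<theta> Z Y"
  shows "causal_solution N R S \<phi> \<theta> (\<lambda>t. Z t \<circ> p) (\<lambda>t. Y t \<circ> p)"
proof -
  have N: "prob_space N" and p[measurable]: "p \<in> measurable N M" and dp: "distr N M p = M"
    using ext by (auto simp: prob_space_extension_def)
  have Zm[measurable]: "Z t \<in> borel_measurable M" for t by (rule iid_field_measurable[OF M Z])
  have Ym[measurable]: "Y t \<in> borel_measurable M" for t
    using Y by (simp add: causal_solution_def ARMA_solution_def random_field_def)
  have rf: "random_field N (\<lambda>t. Y t \<circ> p)" by (auto simp: random_field_def)
  have st: "strictly_stationary N (\<lambda>t. Y t \<circ> p)"
    unfolding strictly_stationary_def
  proof (intro allI impI)
    fix h :: "int ^ 'd" and J :: "(int ^ 'd) set" assume J: "finite J"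
    have eq: "distr N (Pi\<^sub>M J (\<lambda>_. borel)) (\<lambda>\<omega>. \<lambda>t\<in>J. (Y (t + h) \<circ> p) \<omega>) =
        distr M (Pi\<^sub>M J (\<lambda>_. borel)) (\<lambda>\<omega>. \<lambda>t\<in>J. Y (t + h) \<omega>)" for h
    proof -
      have "(\<lambda>\<omega>. \<lambda>t\<in>J. Y (t + h) \<omega>) \<in> measurable M (Pi\<^sub>M J (\<lambda>_. borel))"
        by (rule measurable_restrict) simp
      from distr_distr[OF this p] show ?thesis by (simp add: dp comp_def)
    qed
    have "distr M (Pi\<^sub>M J (\<lambda>_. borel)) (\<lambda>\<omega>. \<lambda>t\<in>J. Y (t + h) \<omega>) = distr M (Pi\<^sub>M J (\<lambda>_. borel)) (\<lambda>\<omega>. \<lambda>t\<in>J. Y t \<omega>)"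
      using Y J by (simp add: causal_solution_def ARMA_solution_def strictly_stationary_def)
    then show "distr N (Pi\<^sub>M J (\<lambda>_. borel)) (\<lambda>\<omega>. \<lambda>t\<in>J. (Y (t + h) \<circ> p) \<omega>) =
        distr N (Pi\<^sub>M J (\<lambda>_. borel)) (\<lambda>\<omega>. \<lambda>t\<in>J. (Y t \<circ> p) \<omega>)"
      using eq[of h] eq[of 0] by simp
  qed
  have ae: "ARMA_equation N R S \<phi> \<theta> (\<lambda>t. Z t \<circ> p) (\<lambda>t. Y t \<circ> p)"
    unfolding ARMA_equation_def
  proof
    fix t
    have "AE \<omega> in distr N M p. Y t \<omega> - (\<Sum>n\<in>R. \<phi> n * Y (t - int_vec n) \<omega>) =
        Z t \<omega> + (\<Sum>n\<in>S. \<theta> n * Z (t - int_vec n) \<omega>)"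
      using Y unfolding dp by (simp add: causal_solution_def ARMA_solution_def ARMA_equation_def)
    from AE_distrD[OF p this]
    show "AE \<omega> in N. (Y t \<circ> p) \<omega> - (\<Sum>n\<in>R. \<phi> n * (Y (t - int_vec n) \<circ> p) \<omega>) =
        (Z t \<circ> p) \<omega> + (\<Sum>n\<in>S. \<theta> n * (Z (t - int_vec n) \<circ> p) \<omega>)" by simp
  qed
  have "Y t \<circ> p \<in> borel_measurable (past_sigma N (\<lambda>t. Z t \<circ> p) t)" for t
  proof -
    have "Y t \<in> borel_measurable (gen_sigma M borel Z {..t})"
      using Y by (simp add: causal_solution_def past_sigma_eq)
    from gen_sigma_factorization[OF Zm this] obtain y where y: "y \<in> borel_measurable (Pi\<^sub>M {..t} (\<lambda>_. borel))"
      "\<And>\<omega>. \<omega> \<in> space M \<Longrightarrow> Y t \<omega> = y (\<lambda>s\<in>{..t}. Z s \<omega>)" by blast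
    have "(\<lambda>\<omega>. y (\<lambda>s\<in>{..t}. (Z s \<circ> p) \<omega>)) \<in> borel_measurable (gen_sigma N borel (\<lambda>t. Z t \<circ> p) {..t})"
      by (rule measurable_compose[OF measurable_gen_sigma_restrict y(1)]) simp
    then show ?thesis
      unfolding past_sigma_eq
      by (rule measurable_cong[THEN iffD1, rotated]) (use y(2) measurable_space[OF p] in simp)
  qed
  then show ?thesis using rf st ae by (simp add: causal_solution_def ARMA_solution_def)
qed

locale causal_copy = prob_space N for N :: "'b measure" +
  fixes R S :: "(nat ^ 'd) set" and \<phi> \<theta> :: "nat ^ 'd \<Rightarrow> complex"
    and Z Y Z' Y' :: "int ^ 'd \<Rightarrow> 'b \<Rightarrow> complex"
  assumes R: "finite R" "0 \<notin> R" and S: "finite S" "0 \<notin> S"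
    and Z: "iid_field N Z" and Y: "causal_solution N R S \<phi> \<theta> Z Y"
    and copy: "independent_copy N Y Z Y' Z'"
begin

abbreviation P :: "(int ^ 'd \<Rightarrow> complex \<times> complex) measure" where "P \<equiv> Pi\<^sub>M UNIV (\<lambda>_. borel)"

lemma joint_indep: "indep_var P (joint_field Y Z) P (joint_field Y' Z')"
  using copy by (simp add: independent_copy_def)

lemma joint_meas [measurable]: "joint_field Y Z \<in> measurable N P" "joint_field Y' Z' \<in> measurable N P"
  using indep_var_rv1[OF joint_indep] indep_var_rv2[OF joint_indep] by auto

lemma joint_law: "distr N P (joint_field Y' Z') = distr N P (joint_field Y Z)"
  using copy by (simp add: independent_copy_def)

lemma P_component [measurable]: "(\<lambda>u. u t) \<in> borel_measurable P"
  by (rule measurable_component_singleton) simp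

lemma field_meas [measurable]:
  "Y t \<in> borel_measurable N" "Z t \<in> borel_measurable N" "Y' t \<in> borel_measurable N" "Z' t \<in> borel_measurable N"
proof -
  have fstP: "(\<lambda>u. fst (u t)) \<in> borel_measurable P" and sndP: "(\<lambda>u. snd (u t)) \<in> borel_measurable P" by measurable
  show "Y t \<in> borel_measurable N" "Z t \<in> borel_measurable N" "Y' t \<in> borel_measurable N" "Z' t \<in> borel_measurable N"
    using measurable_compose[OF joint_meas(1) fstP] measurable_compose[OF joint_meas(1) sndP]
      measurable_compose[OF joint_meas(2) fstP] measurable_compose[OF joint_meas(2) sndP]
    by (simp_all add: joint_field_def)
qed

lemma law_transfer:
  assumes "h \<in> measurable P T"
  shows "distr N T (\<lambda>\<omega>. h (joint_field Y' Z' \<omega>)) = distr N T (\<lambda>\<omega>. h (joint_field Y Z \<omega>))"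
  using distr_distr[OF assms joint_meas(2)] distr_distr[OF assms joint_meas(1)] joint_law
  by (simp add: comp_def)

lemma AE_transfer:
  assumes "{u \<in> space P. Q u} \<in> sets P" "AE \<omega> in N. Q (joint_field Y Z \<omega>)"
  shows "AE \<omega> in N. Q (joint_field Y' Z' \<omega>)"
proof (rule AE_distrD[OF joint_meas(2)])
  show "AE u in distr N P (joint_field Y' Z'). Q u"
    unfolding joint_law AE_distr_iff[OF joint_meas(1) assms(1)] by (rule assms(2))
qed

lemma iid_copy: "iid_field N Z'"
proof -
  let ?T = "Pi\<^sub>M UNIV (\<lambda>_. borel) :: (int ^ 'd \<Rightarrow> complex) measure"
  have "(\<lambda>u t. snd (u t)) \<in> measurable P ?T" by (rule measurable_PiM_single') auto
  from law_transfer[OF this]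
  have "distr N ?T (\<lambda>\<omega> t. Z' t \<omega>) = distr N ?T (\<lambda>\<omega> t. Z t \<omega>)" by (simp add: joint_field_def)
  note law = indep_vars_transfer_law[OF prob_space_axioms prob_space_axioms _ _ this]
  show ?thesis unfolding iid_field_def using law Z field_meas by (auto simp: iid_field_def)
qed

lemma ARMA_equation_copy: "ARMA_equation N R S \<phi> \<theta> Z' Y'"
  unfolding ARMA_equation_def
proof
  fix t
  let ?Q = "\<lambda>u :: int ^ 'd \<Rightarrow> complex \<times> complex. fst (u t) - (\<Sum>n\<in>R. \<phi> n * fst (u (t - int_vec n))) =
      snd (u t) + (\<Sum>n\<in>S. \<theta> n * snd (u (t - int_vec n)))"
  have "AE \<omega> in N. ?Q (joint_field Y Z \<omega>)"
    using Y by (simp add: causal_solution_def ARMA_solution_def ARMA_equation_def joint_field_def)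
  moreover have "{u \<in> space P. ?Q u} \<in> sets P" by measurable
  ultimately have "AE \<omega> in N. ?Q (joint_field Y' Z' \<omega>)" by (rule AE_transfer[rotated])
  then show "AE \<omega> in N. Y' t \<omega> - (\<Sum>n\<in>R. \<phi> n * Y' (t - int_vec n) \<omega>) = Z' t \<omega> + (\<Sum>n\<in>S. \<theta> n * Z' (t - int_vec n) \<omega>)"
    by (simp add: joint_field_def)
qed

text \<open>\<open>Y'\<close> itself need not be measurable with respect to the past of \<open>Z'\<close>; only a version of it is.\<close>

lemma causal_version_copy:
  "\<exists>Y2. (\<forall>t. Y2 t \<in> borel_measurable (past_sigma N Z' t)) \<and> (\<forall>t. AE \<omega> in N. Y' t \<omega> = Y2 t \<omega>)"
proof -
  have "\<exists>y. y \<in> borel_measurable (past_sigma N Z' t) \<and> (AE \<omega> in N. Y' t \<omega> = y \<omega>)" for t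
  proof -
    have "Y t \<in> borel_measurable (gen_sigma N borel Z {..t})"
      using Y by (simp add: causal_solution_def past_sigma_eq)
    from gen_sigma_factorization[OF field_meas(2) this] obtain y where
      y[measurable]: "y \<in> borel_measurable (Pi\<^sub>M {..t} (\<lambda>_. borel))"
      and y_eq: "\<And>\<omega>. \<omega> \<in> space N \<Longrightarrow> Y t \<omega> = y (\<lambda>s\<in>{..t}. Z s \<omega>)" by blast
    have meas: "(\<lambda>\<omega>. y (\<lambda>s\<in>{..t}. Z' s \<omega>)) \<in> borel_measurable (past_sigma N Z' t)"
      unfolding past_sigma_eq by (rule measurable_compose[OF measurable_gen_sigma_restrict y]) simp
    have restr: "(\<lambda>u. \<lambda>s\<in>{..t}. snd (u s)) \<in> measurable P (Pi\<^sub>M {..t} (\<lambda>_. borel))"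
      by (rule measurable_restrict) measurable
    have yr[measurable]: "(\<lambda>u. y (\<lambda>s\<in>{..t}. snd (u s))) \<in> borel_measurable P"
      by (rule measurable_compose[OF restr y])
    have "AE \<omega> in N. fst (joint_field Y' Z' \<omega> t) = y (\<lambda>s\<in>{..t}. snd (joint_field Y' Z' \<omega> s))"
    proof (rule AE_transfer)
      show "{u \<in> space P. fst (u t) = y (\<lambda>s\<in>{..t}. snd (u s))} \<in> sets P" by measurable
      show "AE \<omega> in N. fst (joint_field Y Z \<omega> t) = y (\<lambda>s\<in>{..t}. snd (joint_field Y Z \<omega> s))"
        using y_eq by (intro AE_I2) (simp add: joint_field_def)
    qed
    then have "AE \<omega> in N. Y' t \<omega> = y (\<lambda>s\<in>{..t}. Z' s \<omega>)" by (simp add: joint_field_def)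
    with meas show ?thesis by blast
  qed
  then have "\<forall>t. \<exists>y. y \<in> borel_measurable (past_sigma N Z' t) \<and> (AE \<omega> in N. Y' t \<omega> = y \<omega>)" by blast
  from choice[OF this] show ?thesis by blast
qed

lemma indep_Z_Z': "indep_var (Pi\<^sub>M UNIV (\<lambda>_. borel)) (\<lambda>\<omega> t. Z t \<omega>) (Pi\<^sub>M UNIV (\<lambda>_. borel)) (\<lambda>\<omega> t. Z' t \<omega>)"
proof -
  have s: "(\<lambda>u t. snd (u t)) \<in> measurable P (Pi\<^sub>M UNIV (\<lambda>_. borel))" by (rule measurable_PiM_single') auto
  from indep_var_compose[OF joint_indep s s] show ?thesis by (simp add: comp_def joint_field_def)
qed

lemma
  shows symmetric_diff_Z: "symmetric_rv N (\<lambda>\<omega>. Z t \<omega> - Z' t \<omega>)"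
    and symmetric_diff_Y: "symmetric_rv N (\<lambda>\<omega>. Y t \<omega> - Y' t \<omega>)"
proof -
  have s: "(\<lambda>u. snd (u t)) \<in> borel_measurable P" and f: "(\<lambda>u. fst (u t)) \<in> borel_measurable P" by measurable
  show "symmetric_rv N (\<lambda>\<omega>. Z t \<omega> - Z' t \<omega>)"
    using indep_var_compose[OF joint_indep s s] law_transfer[OF s]
    by (intro indep_var_diff_symmetric) (simp_all add: comp_def joint_field_def)
  show "symmetric_rv N (\<lambda>\<omega>. Y t \<omega> - Y' t \<omega>)"
    using indep_var_compose[OF joint_indep f f] law_transfer[OF f]
    by (intro indep_var_diff_symmetric) (simp_all add: comp_def joint_field_def)
qed

text \<open>For every index the law is the image under subtraction of the product of the common law
  of Z with itself, an expression free of the index.\<close>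

lemma distr_diff_Z: "distr N borel (\<lambda>\<omega>. Z s \<omega> - Z' s \<omega>) = distr N borel (\<lambda>\<omega>. Z t \<omega> - Z' t \<omega>)"
proof -
  have "distr N borel (\<lambda>\<omega>. Z s \<omega> - Z' s \<omega>) =
      distr (distr N borel (Z 0) \<Otimes>\<^sub>M distr N borel (Z 0)) borel (\<lambda>(a, b). a - b)" for s
  proof -
    have m: "(\<lambda>u. snd (u s)) \<in> borel_measurable P" by measurable
    have ind: "indep_var borel (Z s) borel (Z' s)"
      using indep_var_compose[OF joint_indep m m] by (simp add: comp_def joint_field_def)
    have same: "distr N borel (Z' s) = distr N borel (Z s)"
      using law_transfer[OF m] by (simp add: joint_field_def)
    have "distr N borel (Z s) = distr N borel (Z 0)" using Z by (simp add: iid_field_def)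
    then have "distr N (borel \<Otimes>\<^sub>M borel) (\<lambda>\<omega>. (Z s \<omega>, Z' s \<omega>)) = distr N borel (Z 0) \<Otimes>\<^sub>M distr N borel (Z 0)"
      using ind same by (simp add: indep_var_distribution_eq)
    then show ?thesis by (simp flip: \<open>distr N (borel \<Otimes>\<^sub>M borel) _ = _\<close> add: distr_distr comp_def)
  qed
  then show ?thesis by metis
qed

text \<open>Stationarity of both summands separately would not suffice; by independence the joint
  law of the two blocks is a product of block laws of Y, which is invariant under shifts.\<close>

lemma stationary_diff: "strictly_stationary N (\<lambda>t \<omega>. Y t \<omega> - Y' t \<omega>)"
  unfolding strictly_stationary_def
proof (intro allI impI)
  fix h :: "int ^ 'd" and J :: "(int ^ 'd) set" assume J: "finite J"
  let ?T = "Pi\<^sub>M J (\<lambda>_. borel) :: (int ^ 'd \<Rightarrow> complex) measure"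
  let ?F = "\<lambda>h (u :: int ^ 'd \<Rightarrow> complex \<times> complex). \<lambda>t\<in>J. fst (u (t + h))"
  have F: "?F h \<in> measurable P ?T" for h by (rule measurable_restrict) measurable
  have D: "(\<lambda>(a, b). \<lambda>t\<in>J. a t - b t) \<in> measurable (?T \<Otimes>\<^sub>M ?T) ?T"
    by (rule measurable_PiM_single') (auto simp: split_beta)
  have pair: "distr N (?T \<Otimes>\<^sub>M ?T) (\<lambda>\<omega>. (?F h (joint_field Y Z \<omega>), ?F h (joint_field Y' Z' \<omega>))) =
      distr N ?T (\<lambda>\<omega>. \<lambda>t\<in>J. Y t \<omega>) \<Otimes>\<^sub>M distr N ?T (\<lambda>\<omega>. \<lambda>t\<in>J. Y t \<omega>)" for h
  proof -
    have "indep_var ?T (\<lambda>\<omega>. ?F h (joint_field Y Z \<omega>)) ?T (\<lambda>\<omega>. ?F h (joint_field Y' Z' \<omega>))"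
      using indep_var_compose[OF joint_indep F[of h] F[of h]] by (simp add: comp_def)
    moreover have "distr N ?T (\<lambda>\<omega>. ?F h (joint_field Y Z \<omega>)) = distr N ?T (\<lambda>\<omega>. \<lambda>t\<in>J. Y t \<omega>)"
      using Y J unfolding causal_solution_def ARMA_solution_def strictly_stationary_def
      by (simp add: joint_field_def)
    ultimately show ?thesis
      using law_transfer[OF F[of h]] by (simp add: indep_var_distribution_eq)
  qed
  have "distr N ?T (\<lambda>\<omega>. \<lambda>t\<in>J. Y (t + h) \<omega> - Y' (t + h) \<omega>) =
      distr (distr N ?T (\<lambda>\<omega>. \<lambda>t\<in>J. Y t \<omega>) \<Otimes>\<^sub>M distr N ?T (\<lambda>\<omega>. \<lambda>t\<in>J. Y t \<omega>)) ?T (\<lambda>(a, b). \<lambda>t\<in>J. a t - b t)" for h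
  proof -
    have m: "(\<lambda>\<omega>. (?F h (joint_field Y Z \<omega>), ?F h (joint_field Y' Z' \<omega>))) \<in> measurable N (?T \<Otimes>\<^sub>M ?T)"
      by (intro measurable_Pair measurable_compose[OF joint_meas(1) F] measurable_compose[OF joint_meas(2) F])
    show ?thesis
      unfolding pair[of h, symmetric] distr_distr[OF D m]
      by (rule distr_cong) (auto simp: joint_field_def)
  qed
  from this[of h] this[of 0]
  show "distr N ?T (\<lambda>\<omega>. \<lambda>t\<in>J. Y (t + h) \<omega> - Y' (t + h) \<omega>) = distr N ?T (\<lambda>\<omega>. \<lambda>t\<in>J. Y t \<omega> - Y' t \<omega>)"
    by simp
qed

lemma ARMA_solution_diff: "ARMA_solution N R S \<phi> \<theta> (\<lambda>t \<omega>. Z t \<omega> - Z' t \<omega>) (\<lambda>t \<omega>. Y t \<omega> - Y' t \<omega>)"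
  unfolding ARMA_solution_def
proof (intro conjI stationary_diff)
  show "random_field N (\<lambda>t \<omega>. Y t \<omega> - Y' t \<omega>)" by (auto simp: random_field_def)
  show "ARMA_equation N R S \<phi> \<theta> (\<lambda>t \<omega>. Z t \<omega> - Z' t \<omega>) (\<lambda>t \<omega>. Y t \<omega> - Y' t \<omega>)"
    unfolding ARMA_equation_def
  proof
    fix t
    have "AE \<omega> in N. Y t \<omega> - (\<Sum>n\<in>R. \<phi> n * Y (t - int_vec n) \<omega>) = Z t \<omega> + (\<Sum>n\<in>S. \<theta> n * Z (t - int_vec n) \<omega>)"
      using Y by (simp add: causal_solution_def ARMA_solution_def ARMA_equation_def)
    then show "AE \<omega> in N. Y t \<omega> - Y' t \<omega> - (\<Sum>n\<in>R. \<phi> n * (Y (t - int_vec n) \<omega> - Y' (t - int_vec n) \<omega>)) =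
        Z t \<omega> - Z' t \<omega> + (\<Sum>n\<in>S. \<theta> n * (Z (t - int_vec n) \<omega> - Z' (t - int_vec n) \<omega>))"
      using ARMA_equation_copy[unfolded ARMA_equation_def, rule_format, of t]
    proof eventually_elim
      case (elim \<omega>)
      then show ?case by (simp only: right_diff_distrib sum_subtractf) (simp add: algebra_simps)
    qed
  qed
qed

lemma
  shows series_diff: "AE \<omega> in N. rect_sums (\<lambda>k. arma_coeff R S \<phi> \<theta> k * (Z (t - int_vec k) \<omega> - Z' (t - int_vec k) \<omega>)) (Y t \<omega> - Y' t \<omega>)"
    and moments_diff: "\<exists>\<delta>>0. \<forall>F. finite F \<longrightarrow> (\<Sum>k\<in>F. expectation (\<lambda>\<omega>. min 1 ((\<delta> *
      cmod (arma_coeff R S \<phi> \<theta> k * (Z (t - int_vec k) \<omega> - Z' (t - int_vec k) \<omega>)))\<^sup>2))) \<le> 16"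
proof -
  \<comment> \<open>Work with a causal version of Y' and return to Y' at the end; equation, symmetry
    and series are unaffected by changes on null sets.\<close>
  obtain Y2 where Y2: "\<And>t. Y2 t \<in> borel_measurable (past_sigma N Z' t)" "\<And>t. AE \<omega> in N. Y' t \<omega> = Y2 t \<omega>"
    using causal_version_copy by blast
  have Y2m[measurable]: "Y2 t \<in> borel_measurable N" for t
    using Y2(1)[of t] unfolding past_sigma_eq by (rule measurable_gen_sigma_imp[rotated]) simp
  have eq: "ARMA_equation N R S \<phi> \<theta> Z Y" and past: "\<And>t. Y t \<in> borel_measurable (past_sigma N Z t)"
    using Y by (auto simp: causal_solution_def ARMA_solution_def)
  have eq2: "ARMA_equation N R S \<phi> \<theta> Z' Y2"
    unfolding ARMA_equation_def
  proof
    fix t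
    have "AE \<omega> in N. \<forall>n\<in>R. Y' (t - int_vec n) \<omega> = Y2 (t - int_vec n) \<omega>"
      using R(1) Y2(2) by (intro AE_finite_allI) auto
    then show "AE \<omega> in N. Y2 t \<omega> - (\<Sum>n\<in>R. \<phi> n * Y2 (t - int_vec n) \<omega>) = Z' t \<omega> + (\<Sum>n\<in>S. \<theta> n * Z' (t - int_vec n) \<omega>)"
      using Y2(2)[of t] ARMA_equation_copy[unfolded ARMA_equation_def, rule_format, of t]
      by eventually_elim simp
  qed
  have sym: "symmetric_rv N (\<lambda>\<omega>. Y t \<omega> - Y2 t \<omega>)" for t
  proof (rule symmetric_rv_cong_distr[OF _ _ _ symmetric_diff_Y])
    show "distr N borel (\<lambda>\<omega>. Y t \<omega> - Y' t \<omega>) = distr N borel (\<lambda>\<omega>. Y t \<omega> - Y2 t \<omega>)"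
      by (rule distr_cong_AE) (use Y2(2)[of t] in auto)
  qed measurable
  note diff = difference_of_causal_solutions[OF prob_space_axioms R S Z iid_copy indep_Z_Z' eq eq2 past Y2(1)
      symmetric_diff_Z sym]
  show "AE \<omega> in N. rect_sums (\<lambda>k. arma_coeff R S \<phi> \<theta> k * (Z (t - int_vec k) \<omega> - Z' (t - int_vec k) \<omega>)) (Y t \<omega> - Y' t \<omega>)"
    using diff(1)[of t] Y2(2)[of t] by eventually_elim simp
  show "\<exists>\<delta>>0. \<forall>F. finite F \<longrightarrow> (\<Sum>k\<in>F. expectation (\<lambda>\<omega>. min 1 ((\<delta> *
      cmod (arma_coeff R S \<phi> \<theta> k * (Z (t - int_vec k) \<omega> - Z' (t - int_vec k) \<omega>)))\<^sup>2))) \<le> 16"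
    by (rule diff(2))
qed

end

text \<open>The product space carries an independent copy, and the differences Z - Z' are
  identically distributed and nondegenerate, so the bound on truncated moments forces square
  summability.\<close>

lemma arma_coeff_square_summable:
  fixes M :: "'a measure" and R S :: "(nat ^ 'd) set" and Z Y :: "int ^ 'd \<Rightarrow> 'a \<Rightarrow> complex"
  assumes M: "prob_space M" and R: "finite R" "0 \<notin> R" and S: "finite S" "0 \<notin> S"
    and Z: "iid_field M Z" and nd: "\<not> deterministic_field M Z"
    and Y: "causal_solution M R S \<phi> \<theta> Z Y"
  shows "(\<lambda>k. (cmod (arma_coeff R S \<phi> \<theta> k))\<^sup>2) summable_on UNIV"
proof -
  interpret M: prob_space M by fact
  interpret MM: pair_prob_space M M ..
  have Zm[measurable]: "Z t \<in> borel_measurable M" for t by (rule iid_field_measurable[OF M Z])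
  have rfs: "random_field M Y" "random_field M Z"
    using Y Zm by (auto simp: causal_solution_def ARMA_solution_def random_field_def)
  note copy = independent_copy_exists[OF M rfs]
  interpret C: causal_copy "M \<Otimes>\<^sub>M M" R S \<phi> \<theta> "\<lambda>t. Z t \<circ> fst" "\<lambda>t. Y t \<circ> fst" "\<lambda>t. Z t \<circ> snd" "\<lambda>t. Y t \<circ> snd"
    by unfold_locales (use R S copy in \<open>auto intro: extension_iid_field[OF M Z] extension_causal_solution[OF M Z _ Y]\<close>)
  let ?X = "\<lambda>k \<omega>. (Z (0 - int_vec k) \<circ> fst) \<omega> - (Z (0 - int_vec k) \<circ> snd) \<omega>"
  let ?D = "distr (M \<Otimes>\<^sub>M M) borel (\<lambda>\<omega>. (Z 0 \<circ> fst) \<omega> - (Z 0 \<circ> snd) \<omega>)"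
  obtain \<delta> where \<delta>: "\<delta> > 0" "\<And>F. finite F \<Longrightarrow> (\<Sum>k\<in>F. MM.expectation (\<lambda>\<omega>. min 1 ((\<delta> *
      cmod (arma_coeff R S \<phi> \<theta> k * ?X k \<omega>))\<^sup>2))) \<le> 16"
    using C.moments_diff[of 0] by blast
  show ?thesis
  proof (rule square_summable_if_truncated_moments_le[where X = ?X and D = ?D and C = 16, OF MM.prob_space_axioms _ _ _ \<delta>])
    show "?X k \<in> borel_measurable (M \<Otimes>\<^sub>M M)" for k by measurable
    show "distr (M \<Otimes>\<^sub>M M) borel (?X k) = ?D" for k by (rule C.distr_diff_Z)
    \<comment> \<open>If the two copies agreed almost surely, then for almost every first coordinate
      x the variable \<open>Z 0\<close> would almost surely equal the constant \<open>Z 0 x\<close>,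
      making the whole field deterministic.\<close>
    show "\<not> (AE x in ?D. x = 0)"
    proof
      assume "AE x in ?D. x = 0"
      then have "AE \<omega> in M \<Otimes>\<^sub>M M. Z 0 (fst \<omega>) - Z 0 (snd \<omega>) = 0"
        by (subst (asm) AE_distr_iff) auto
      from MM.AE_pair[OF this] have "AE x in M. AE y in M. Z 0 x - Z 0 y = 0" by simp
      from eventually_happens'[OF _ this] obtain x where "AE y in M. Z 0 x - Z 0 y = 0"
        using M.ae_filter_bot by (auto simp: trivial_limit_def)
      then have "AE y in M. Z 0 y = Z 0 x" by eventually_elim simp
      then have "M.prob {\<omega> \<in> space M. Z 0 \<omega> = Z 0 x} = 1" by (subst M.prob_Collect_eq_1) auto
      moreover have "M.prob {\<omega> \<in> space M. Z t \<omega> = Z 0 x} = measure (distr M borel (Z t)) {Z 0 x}" for t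
        by (subst measure_distr) (auto intro!: arg_cong[where f = M.prob])
      ultimately have "M.prob {\<omega> \<in> space M. Z t \<omega> = Z 0 x} = 1" for t
        using Z unfolding iid_field_def by metis
      then show False using nd by (auto simp: deterministic_field_def)
    qed
  qed
qed

theorem theorem3p7:
  fixes M :: "'a measure"
    and R S :: "(nat ^ 'd) set"
    and \<phi> \<theta> :: "nat ^ 'd \<Rightarrow> complex"
    and Z Y :: "int ^ 'd \<Rightarrow> 'a \<Rightarrow> complex"
  assumes "prob_space M"
    and "finite R" and "0 \<notin> R"
    and "finite S" and "0 \<notin> S"
    and "iid_field M Z" and "\<not> deterministic_field M Z"
    and "causal_solution M R S \<phi> \<theta> Z Y"
  shows
    "(\<exists>f\<in>hardy_H2. \<forall>z\<in>polydisc. AR_poly R \<phi> z * f z = MA_poly S \<theta> z)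
     \<and>
     (\<forall>f\<in>hardy_H2. (\<forall>z\<in>polydisc. AR_poly R \<phi> z * f z = MA_poly S \<theta> z) \<longrightarrow>
        (\<exists>\<alpha>. power_series_expansion f \<alpha>) \<and>
        (\<forall>\<alpha>. power_series_expansion f \<alpha> \<longrightarrow>
          (\<forall>(N :: 'b measure) p Y' Z'.
             prob_space_extension N M p \<and>
             independent_copy N (\<lambda>t. Y t \<circ> p) (\<lambda>t. Z t \<circ> p) Y' Z' \<longrightarrow>
             (let sym = (symmetric_rv M (Y 0) \<and> symmetric_rv M (Z 0));
                  Yt = (\<lambda>t \<omega>. if sym then Y t (p \<omega>) else Y t (p \<omega>) - Y' t \<omega>);
                  Zt = (\<lambda>t \<omega>. if sym then Z t (p \<omega>) else Z t (p \<omega>) - Z' t \<omega>)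
              in ARMA_solution N R S \<phi> \<theta> Zt Yt \<and>
                 (\<forall>t. AE \<omega> in N.
                    rect_sums (\<lambda>k. \<alpha> k * Zt (t - int_vec k) \<omega>) (Yt t \<omega>))))))
     \<and>
     (symmetric_rv M (Z 0) \<longrightarrow>
        (\<forall>Y1 Y2. causal_solution M R S \<phi> \<theta> Z Y1 \<and> symmetric_rv M (Y1 0) \<and>
                 causal_solution M R S \<phi> \<theta> Z Y2 \<and> symmetric_rv M (Y2 0) \<longrightarrow>
                 (\<forall>t. AE \<omega> in M. Y1 t \<omega> = Y2 t \<omega>)))"
proof -
  note M = assms(1) and R = assms(2,3) and S = assms(4,5) and Z = assms(6) and Y = assms(8)
  have sq: "(\<lambda>k. (cmod (arma_coeff R S \<phi> \<theta> k))\<^sup>2) summable_on UNIV"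
    by (rule arma_coeff_square_summable[OF M R S Z assms(7) Y])
  have Zm[measurable]: "Z t \<in> borel_measurable M" for t by (rule iid_field_measurable[OF M Z])
  have Ym[measurable]: "Y t \<in> borel_measurable M" for t
    using Y by (simp add: causal_solution_def ARMA_solution_def random_field_def)
  \<comment> \<open>Proved for the recursive coefficients; uniqueness of power series expansions
    later replaces them by any expansion of the quotient.\<close>
  have copy_part: "let sym = (symmetric_rv M (Y 0) \<and> symmetric_rv M (Z 0));
        Yt = (\<lambda>t \<omega>. if sym then Y t (p \<omega>) else Y t (p \<omega>) - Y' t \<omega>);
        Zt = (\<lambda>t \<omega>. if sym then Z t (p \<omega>) else Z t (p \<omega>) - Z' t \<omega>)
      in ARMA_solution N R S \<phi> \<theta> Zt Yt \<and>
         (\<forall>t. AE \<omega> in N. rect_sums (\<lambda>k. arma_coeff R S \<phi> \<theta> k * Zt (t - int_vec k) \<omega>) (Yt t \<omega>))"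
    if ext: "prob_space_extension N M p" and copy: "independent_copy N (\<lambda>t. Y t \<circ> p) (\<lambda>t. Z t \<circ> p) Y' Z'"
    for N :: "'b measure" and p Y' Z'
  proof -
    have N: "prob_space N" and p[measurable]: "p \<in> measurable N M" and dp: "distr N M p = M"
      using ext by (auto simp: prob_space_extension_def)
    note Zp = extension_iid_field[OF M Z ext] and Yp = extension_causal_solution[OF M Z ext Y]
    show ?thesis
    proof (cases "symmetric_rv M (Y 0) \<and> symmetric_rv M (Z 0)")
      case True
      \<comment> \<open>Symmetry is assumed on M, but the series is needed on N; composition with p
        preserves laws.\<close>
      have law: "distr M borel X = distr N borel (X \<circ> p)" if "X \<in> borel_measurable M" for X :: "'a \<Rightarrow> complex"
        by (subst dp[symmetric], rule distr_distr[OF that p])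
      have "symmetric_rv N (Z 0 \<circ> p)" "symmetric_rv N (Y 0 \<circ> p)"
        using True by (auto intro!: symmetric_rv_cong_distr[OF _ _ law])
      from symmetric_causal_solution_series[OF N R S Zp Yp this]
      show ?thesis using True Yp by (simp add: causal_solution_def comp_def)
    next
      case False
      interpret causal_copy N R S \<phi> \<theta> "\<lambda>t. Z t \<circ> p" "\<lambda>t. Y t \<circ> p" Z' Y'
        by (rule causal_copy.intro[OF N], unfold_locales) (use R S Zp Yp copy in auto)
      have "(symmetric_rv M (Y 0) \<and> symmetric_rv M (Z 0)) = False" using False by blast
      then show ?thesis unfolding Let_def
        using ARMA_solution_diff series_diff by (simp only: if_False comp_def) simp
    qed
  qed
  have expansion: "power_series_expansion f (arma_coeff R S \<phi> \<theta>)"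
    if "f \<in> hardy_H2" "\<forall>z\<in>polydisc. AR_poly R \<phi> z * f z = MA_poly S \<theta> z" for f
    using that by (rule arma_quotient_expansion[OF R S(1) sq])
  show ?thesis
  proof (intro conjI ballI allI impI)
    show "\<exists>f\<in>hardy_H2. \<forall>z\<in>polydisc. AR_poly R \<phi> z * f z = MA_poly S \<theta> z"
      by (rule arma_quotient_in_hardy_H2[OF R S(1) sq])
  next
    fix f :: "complex ^ 'd \<Rightarrow> complex"
    assume f: "f \<in> hardy_H2" "\<forall>z\<in>polydisc. AR_poly R \<phi> z * f z = MA_poly S \<theta> z"
    then show "\<exists>\<alpha>. power_series_expansion f \<alpha>" using expansion by blast
    fix \<alpha> and N :: "'b measure" and p Y' Z'
    assume \<alpha>: "power_series_expansion f \<alpha>"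
      and "prob_space_extension N M p \<and> independent_copy N (\<lambda>t. Y t \<circ> p) (\<lambda>t. Z t \<circ> p) Y' Z'"
    then show "let sym = (symmetric_rv M (Y 0) \<and> symmetric_rv M (Z 0));
        Yt = (\<lambda>t \<omega>. if sym then Y t (p \<omega>) else Y t (p \<omega>) - Y' t \<omega>);
        Zt = (\<lambda>t \<omega>. if sym then Z t (p \<omega>) else Z t (p \<omega>) - Z' t \<omega>)
      in ARMA_solution N R S \<phi> \<theta> Zt Yt \<and>
         (\<forall>t. AE \<omega> in N. rect_sums (\<lambda>k. \<alpha> k * Zt (t - int_vec k) \<omega>) (Yt t \<omega>))"
      unfolding power_series_expansion_unique[OF \<alpha> expansion[OF f]] using copy_part by blast
  next
    fix Y1 Y2 t
    assume sym: "symmetric_rv M (Z 0)"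
      and *: "causal_solution M R S \<phi> \<theta> Z Y1 \<and> symmetric_rv M (Y1 0) \<and>
        causal_solution M R S \<phi> \<theta> Z Y2 \<and> symmetric_rv M (Y2 0)"
    \<comment> \<open>Both solutions are rectangular limits of one and the same series, and such a
      limit is unique along cubes.\<close>
    have "AE \<omega> in M. rect_sums (\<lambda>k. arma_coeff R S \<phi> \<theta> k * Z (t - int_vec k) \<omega>) (Y1 t \<omega>)"
      "AE \<omega> in M. rect_sums (\<lambda>k. arma_coeff R S \<phi> \<theta> k * Z (t - int_vec k) \<omega>) (Y2 t \<omega>)"
      using * sym by (auto intro!: symmetric_causal_solution_series[OF M R S Z])
    then show "AE \<omega> in M. Y1 t \<omega> = Y2 t \<omega>" by eventually_elim (rule rect_sums_unique)
  qed
qed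

end
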